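(* Let $M$ and $N$ be dual lattices of positive rank, let $\mathbb{F}$ be an arbitrary field, and let $C\subseteq N_{\mathbb{R}}$ be a full pointed rational polyhedral cone which is simplicial. Let $R_{\mathbb{F}}=\mathbb{F}[C^\vee\cap M]$ be the associated toric algebra. Let $\mathcal{B}$ be the minimal generating set of the semigroup $C^\vee\cap M$ and let $v_C\in N$ be the sum of the primitive generators of $C$. Let $D$ be any positive integer such that $D\cdot\operatorname{Cl}(R_{\mathbb{F}})=0$, and set $$T:=\max\Big\{\max_{m\in\mathcal{B}}\langle m,v_C\rangle,\ D\Big\}.$$ Then $P^{(T(r-1)+1)}\subseteq P^r$ for all integers $r>0$, all monomial prime ideals $P$ of $R_{\mathbb{F}}$, and all height one prime ideals $P$ of $R_{\mathbb{F}}$. In particular, one can take $D=\#\operatorname{Cl}(R_{\mathbb{F}})$.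
   Context: A lattice is a free abelian group of finite rank. $\langle\cdot,\cdot\rangle: M\times N\to\mathbb{Z}$ is a perfect bilinear pairing, extended to $M_{\mathbb{R}}\times N_{\mathbb{R}}\to\mathbb{R}$, where $M_{\mathbb{R}}=M\otimes_{\mathbb{Z}}\mathbb{R}$ and $N_{\mathbb{R}}=N\otimes_{\mathbb{Z}}\mathbb{R}$. A rational polyhedral cone in $N_{\mathbb{R}}$ is a set $\{\sum_{v\in G}a_vv : a_v\in\mathbb{R}_{\ge0}\}$ for a finite set $G\subseteq N$; it is full if it spans $N_{\mathbb{R}}$ and pointed if it contains no line through the origin. The dual cone is $C^\vee=\{w\in M_{\mathbb{R}} : \langle w,v\rangle\ge0\text{ for all }v\in C\}$. The primitive generators of $C$ are the vectors $u_\rho$, one for each one-dimensional face (ray) $\rho$ of $C$, where $u_\rho\in\rho\cap N$ is primitive, i.e. $\frac1k u_\rho\notin N$ for all integers $k>1$. $C$ is simplicial if its primitive generators form part of an $\mathbb{R}$-basis of $N_{\mathbb{R}}$. Since $C$ is full, $C^\vee\cap M$ has a unique minimal generating set $\mathcal{B}$ (the Hilbert basis), consisting of its irreducible elements: the nonzero elements that are not a sum of two nonzero elements of $C^\vee\cap M$. The toric algebra $R_{\mathbb{F}}=\mathbb{F}[C^\vee\cap M]$ is the semigroup algebra with $\mathbb{F}$-basis of monomials $\{\chi^m : m\in C^\vee\cap M\}$, $\chi^m\chi^{m'}=\chi^{m+m'}$; it is a Noetherian normal domain. An ideal of $R_{\mathbb{F}}$ is monomial if it is generated by a subset of these monomials.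 $\operatorname{Cl}(R)$ denotes the divisor class group of a Noetherian normal domain $R$ (free abelian group on height one primes modulo principal divisors), and $D\cdot\operatorname{Cl}(R)=0$ means that every element is annihilated by $D$. For a prime ideal $P$ of a Noetherian domain $R$ and an integer $a\ge1$, the symbolic power is $P^{(a)}=P^aR_P\cap R=\{f\in R : uf\in P^a\text{ for some }u\in R\setminus P\}$. *)

theory Defs
  imports "HOL-Analysis.Analysis" "HOL-Algebra.Ideal_Product"
    "HOL-Algebra.Free_Abelian_Groups"
begin

section \<open>Dual lattices\<close>

text \<open>A lattice and its real extension are modelled by one real vector space: the type plays
  the role of \<open>L \<otimes> \<real>\<close>, and \<open>L\<close> is the subgroup generated by an \<open>\<real>\<close>-basis. Up to a unique
  isomorphism extending the identity of \<open>L\<close>, this is the map \<open>L \<rightarrow> L \<otimes> \<real>\<close> for a free abelian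
  group \<open>L\<close> of finite rank, and the rank of \<open>L\<close> is the dimension of the vector space.\<close>

definition is_lattice :: "'v::real_vector set \<Rightarrow> bool" where
  "is_lattice L \<longleftrightarrow>
     (\<exists>E. finite E \<and> independent E \<and> span E = UNIV \<and>
          L = {\<Sum>e\<in>E. of_int (c e) *\<^sub>R e | c. True})"

text \<open>The real bilinear form \<open>pair\<close> is the extension of the pairing \<open>M \<times> N \<rightarrow> \<int>\<close>. Perfectness
  says that both induced maps \<open>M \<rightarrow> Hom(N, \<int>)\<close> and \<open>N \<rightarrow> Hom(M, \<int>)\<close> are bijective.\<close>

definition dual_lattices ::
    "'m::real_vector set \<Rightarrow> 'n::real_vector set \<Rightarrow> ('m \<Rightarrow> 'n \<Rightarrow> real) \<Rightarrow> bool" where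
  "dual_lattices M N pair \<longleftrightarrow>
     is_lattice M \<and> is_lattice N \<and> bilinear pair \<and>
     (\<forall>m\<in>M. \<forall>n\<in>N. pair m n \<in> \<int>) \<and>
     (\<forall>f :: 'n \<Rightarrow> int. (\<forall>x\<in>N. \<forall>y\<in>N. f (x + y) = f x + f y) \<longrightarrow>
        (\<exists>!m. m \<in> M \<and> (\<forall>n\<in>N. pair m n = of_int (f n)))) \<and>
     (\<forall>g :: 'm \<Rightarrow> int. (\<forall>x\<in>M. \<forall>y\<in>M. g (x + y) = g x + g y) \<longrightarrow>
        (\<exists>!n. n \<in> N \<and> (\<forall>m\<in>M. pair m n = of_int (g m))))"


section \<open>Cones\<close>

definition rational_polyhedral_cone :: "'n::real_vector set \<Rightarrow> 'n set \<Rightarrow> bool" where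
  "rational_polyhedral_cone N C \<longleftrightarrow>
     (\<exists>G. finite G \<and> G \<subseteq> N \<and> C = {\<Sum>v\<in>G. a v *\<^sub>R v | a. \<forall>v\<in>G. 0 \<le> a v})"

definition full_cone :: "'n::real_vector set \<Rightarrow> bool" where
  "full_cone C \<longleftrightarrow> span C = UNIV"

definition pointed_cone :: "'n::real_vector set \<Rightarrow> bool" where
  "pointed_cone C \<longleftrightarrow> \<not> (\<exists>v. v \<noteq> 0 \<and> range (\<lambda>t. t *\<^sub>R v) \<subseteq> C)"

definition dual_cone :: "('m \<Rightarrow> 'n \<Rightarrow> real) \<Rightarrow> 'n set \<Rightarrow> 'm set" where
  "dual_cone pair C = {w. \<forall>v\<in>C. pair w v \<ge> 0}"

text \<open>The zero vector is not primitive in this sense, and a ray of a pointed rational cone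
  contains exactly one primitive vector, so this set is in bijection with the rays.\<close>

definition primitive_generators :: "'n::real_vector set \<Rightarrow> 'n set \<Rightarrow> 'n set" where
  "primitive_generators N C =
     {u. \<exists>\<rho>. \<rho> face_of C \<and> dim \<rho> = 1 \<and> u \<in> \<rho> \<inter> N \<and>
             (\<forall>k::int. k > 1 \<longrightarrow> (1 / of_int k) *\<^sub>R u \<notin> N)}"

definition simplicial_cone :: "'n::real_vector set \<Rightarrow> 'n set \<Rightarrow> bool" where
  "simplicial_cone N C \<longleftrightarrow>
     (\<exists>E. independent E \<and> span E = UNIV \<and> primitive_generators N C \<subseteq> E)"


section \<open>Semigroup algebras\<close>

text \<open>Semigroups contain \<open>0\<close> here, as the empty sum.\<close>

definition semigroup_generated :: "'m::comm_monoid_add set \<Rightarrow> 'm set" where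
  "semigroup_generated G = {sum_list xs | xs. set xs \<subseteq> G}"

definition minimal_generating_set :: "'m::comm_monoid_add set \<Rightarrow> 'm set \<Rightarrow> bool" where
  "minimal_generating_set B S \<longleftrightarrow>
     semigroup_generated B = S \<and> (\<forall>B'. B' \<subset> B \<longrightarrow> semigroup_generated B' \<noteq> S)"

text \<open>The product on \<open>'m \<Rightarrow>\<^sub>0 'f\<close> is convolution, so the whole type is the group algebra of
  \<open>'m\<close>; the carrier consists of the elements supported in \<open>S\<close>.\<close>

definition semigroup_algebra :: "'m::comm_monoid_add set \<Rightarrow> ('m \<Rightarrow>\<^sub>0 'f::field) ring" where
  "semigroup_algebra S =
     \<lparr>carrier = {p. Poly_Mapping.keys p \<subseteq> S},
      monoid.mult = (*), one = 1, ring.zero = 0, add = (+)\<rparr>"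

definition monomial_ideal ::
    "'m::comm_monoid_add set \<Rightarrow> ('m \<Rightarrow>\<^sub>0 'f::field) set \<Rightarrow> bool" where
  "monomial_ideal S I \<longleftrightarrow>
     (\<exists>A \<subseteq> S. I = genideal (semigroup_algebra S) ((\<lambda>m. Poly_Mapping.single m 1) ` A))"


section \<open>Symbolic powers and the divisor class group\<close>

definition symbolic_power :: "('a, 'b) ring_scheme \<Rightarrow> 'a set \<Rightarrow> nat \<Rightarrow> 'a set" where
  "symbolic_power R P a =
     {f \<in> carrier R. \<exists>u \<in> carrier R - P. u \<otimes>\<^bsub>R\<^esub> f \<in> P [^]\<^bsub>ideals_set R\<^esub> a}"

definition ideal_height :: "('a, 'b) ring_scheme \<Rightarrow> 'a set \<Rightarrow> enat" where
  "ideal_height R P =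
     Sup {enat n | n. \<exists>Q :: nat \<Rightarrow> 'a set.
            (\<forall>i\<le>n. primeideal (Q i) R) \<and> (\<forall>i<n. Q i \<subset> Q (Suc i)) \<and> Q n = P}"

definition height_one_primes :: "('a, 'b) ring_scheme \<Rightarrow> 'a set set" where
  "height_one_primes R = {P. primeideal P R \<and> ideal_height R P = 1}"

text \<open>The valuation of the discrete valuation ring \<open>R\<^sub>P\<close> at a nonzero \<open>f \<in> R\<close>: it is the largest
  \<open>n\<close> with \<open>f \<in> P\<^sup>n R\<^sub>P\<close>, and \<open>P\<^sup>n R\<^sub>P \<inter> R\<close> is the symbolic power.\<close>

definition prime_valuation :: "('a, 'b) ring_scheme \<Rightarrow> 'a set \<Rightarrow> 'a \<Rightarrow> nat" where
  "prime_valuation R P f = (GREATEST n. f \<in> symbolic_power R P n)"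

text \<open>The divisors of the nonzero elements \<open>f / g\<close> of the fraction field.\<close>

definition principal_divisors :: "('a, 'b) ring_scheme \<Rightarrow> ('a set \<Rightarrow>\<^sub>0 int) set" where
  "principal_divisors R =
     {d \<in> carrier (free_Abelian_group (height_one_primes R)).
        \<exists>f \<in> carrier R - {\<zero>\<^bsub>R\<^esub>}. \<exists>g \<in> carrier R - {\<zero>\<^bsub>R\<^esub>}. \<forall>P \<in> height_one_primes R.
          Poly_Mapping.lookup d P = int (prime_valuation R P f) - int (prime_valuation R P g)}"

text \<open>Written multiplicatively, as are all groups of this library.\<close>

definition divisor_class_group :: "('a, 'b) ring_scheme \<Rightarrow> ('a set \<Rightarrow>\<^sub>0 int) set monoid" where
  "divisor_class_group R = free_Abelian_group (height_one_primes R) Mod principal_divisors R"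

definition annihilates_class_group :: "nat \<Rightarrow> ('a, 'b) ring_scheme \<Rightarrow> bool" where
  "annihilates_class_group D R \<longleftrightarrow>
     (\<forall>c \<in> carrier (divisor_class_group R).
        c [^]\<^bsub>divisor_class_group R\<^esub> D = \<one>\<^bsub>divisor_class_group R\<^esub>)"

end

theory Submission
  imports Defs "HOL-Algebra.Multiplicative_Group"
begin

hide_const (open) up_ring.coeff up_ring.monom

text \<open>
  Let \<open>u\<close> range over the primitive generators of \<open>C\<close>, which form an \<open>\<real>\<close>-basis because \<open>C\<close> is
  simplicial, and put \<open>l u = pair _ u\<close>. The semigroup \<open>S\<close> is cut out of \<open>M\<close> by the inequalities
  \<open>l u \<ge> 0\<close>, and for some \<open>d > 0\<close> it contains \<open>d\<close> times the dual basis.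

  A monomial prime \<open>P\<close> is the set of elements on whose exponents a partial sum \<open>\<lambda>\<close> of the \<open>l u\<close> is
  positive. As \<open>\<lambda>\<close> is at most \<open>T\<close> on the Hilbert basis, a monomial with \<open>\<lambda> > T (r - 1)\<close> is a product
  with at least \<open>r\<close> factors in \<open>P\<close>.

  The group algebra \<open>L\<close> of \<open>M\<close>, a localization of \<open>R\<close>, is factorial by Gauss's lemma. Hence the
  height one primes of \<open>R\<close> are the facet primes \<open>l u > 0\<close> and the contractions \<open>p L \<inter> R\<close> of prime
  elements \<open>p\<close>; their symbolic powers are given by the orders along \<open>l u\<close> and \<open>p\<close>, and divisibility in
  \<open>R\<close> is detected by these valuations. If \<open>D [Q] = div h\<close>, then
  \<open>Q\<^bsup>(D (r - 1) + 1)\<^esup> = h\<^bsup>r - 1\<^esup> Q \<subseteq> Q\<^bsup>r\<^esup>\<close>. Every divisor is equivalent to a combination of facet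
  primes, each of which is killed by \<open>d\<close>, so the class group is finite.
\<close>

section \<open>Factorial subrings and Gauss's lemma\<close>

text \<open>Two unrelated mechanisms share the exponent \<open>T * (r - 1) + 1\<close>: for monomial
  primes the pairing with \<open>v\<^sub>C\<close> bounds how much a single generator can
  contribute, for height one primes \<open>D\<close> makes a multiple of the divisor principal. The
  maximum in \<open>T\<close> serves both. The obstacle in the second is that valuations and the
  class group are defined through symbolic powers of abstract height one primes, so all of these
  primes and their symbolic powers have to be known explicitly first. The simplicial hypothesis acts
  through the vectors \<open>w i\<close>: a monomial can be raised along any chosen set of facets
  without changing its order along the others. This determines the monomials in a prime, clears
  denominators without entering a given facet prime, and makes each facet class torsion. All rings
  are subsets of one type, the group algebra of a real vector space. Fractions are replaced by
  monomial multiples or by multiples with constants; no fraction field and no local ring is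
  constructed.\<close>

locale set_domain =
  fixes A :: "'a::comm_ring_1 set"
  assumes zero_mem: "0 \<in> A" and one_mem: "1 \<in> A"
    and add_mem: "a \<in> A \<Longrightarrow> b \<in> A \<Longrightarrow> a + b \<in> A"
    and minus_mem: "a \<in> A \<Longrightarrow> - a \<in> A"
    and mult_mem: "a \<in> A \<Longrightarrow> b \<in> A \<Longrightarrow> a * b \<in> A"
    and no_zero_divisors: "a \<in> A \<Longrightarrow> b \<in> A \<Longrightarrow> a * b = 0 \<Longrightarrow> a = 0 \<or> b = 0"
begin

lemma diff_mem: "a \<in> A \<Longrightarrow> b \<in> A \<Longrightarrow> a - b \<in> A"
  using add_mem minus_mem by (metis uminus_add_conv_diff add.commute)

lemma power_mem: "a \<in> A \<Longrightarrow> a ^ n \<in> A"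
  by (induction n) (auto simp: one_mem mult_mem)

lemma sum_mem: "(\<And>i. i \<in> I \<Longrightarrow> f i \<in> A) \<Longrightarrow> sum f I \<in> A"
  by (induction I rule: infinite_finite_induct) (auto simp: zero_mem add_mem)

lemma cancel: "c \<in> A \<Longrightarrow> a \<in> A \<Longrightarrow> b \<in> A \<Longrightarrow> c \<noteq> 0 \<Longrightarrow> c * a = c * b \<Longrightarrow> a = b"
  using no_zero_divisors[of c "a - b"] diff_mem[of a b] by (auto simp: algebra_simps)

end

text \<open>The cofactor must lie in \<open>A\<close>, because the ambient type is too large for its
  own divisibility to be useful. In the group algebra of a real vector space, \<open>X m - 1\<close>
  splits as \<open>(X (m/2) - 1) * (X (m/2) + 1)\<close>, although \<open>m/2\<close> need not be in
  the lattice.\<close>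

definition dvd_in :: "'a::comm_ring_1 set \<Rightarrow> 'a \<Rightarrow> 'a \<Rightarrow> bool" where
  "dvd_in A a b \<longleftrightarrow> (\<exists>c\<in>A. b = a * c)"

definition prime_in :: "'a::comm_ring_1 set \<Rightarrow> 'a \<Rightarrow> bool" where
  "prime_in A p \<longleftrightarrow> p \<in> A \<and> p \<noteq> 0 \<and> \<not> dvd_in A p 1 \<and>
     (\<forall>a\<in>A. \<forall>b\<in>A. dvd_in A p (a * b) \<longrightarrow> dvd_in A p a \<or> dvd_in A p b)"

text \<open>The index counts prime factors with multiplicity and is the measure on which later
  inductions descend. The base case admits every unit of \<open>A\<close>.\<close>

inductive prime_product :: "'a::comm_ring_1 set \<Rightarrow> nat \<Rightarrow> 'a \<Rightarrow> bool" for A where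
  unit: "u \<in> A \<Longrightarrow> dvd_in A u 1 \<Longrightarrow> prime_product A 0 u"
| mult: "prime_in A p \<Longrightarrow> prime_product A n a \<Longrightarrow> prime_product A (Suc n) (p * a)"

text \<open>Existence of prime factorizations characterizes factorial domains. Asking for primes
  instead of irreducibles makes uniqueness automatic and leaves one property to carry over to
  polynomials and localizations.\<close>

locale factorial_set = set_domain +
  assumes factorization: "a \<in> A \<Longrightarrow> a \<noteq> 0 \<Longrightarrow> \<exists>n. prime_product A n a"

lemma prime_inD:
  assumes "prime_in A p"
  shows "p \<in> A" "p \<noteq> 0" "\<not> dvd_in A p 1"
    "\<And>a b. a \<in> A \<Longrightarrow> b \<in> A \<Longrightarrow> dvd_in A p (a * b) \<Longrightarrow> dvd_in A p a \<or> dvd_in A p b"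
  using assms unfolding prime_in_def by auto

context set_domain
begin

lemma dvd_in_refl: "dvd_in A a a"
  unfolding dvd_in_def using one_mem by (intro bexI[of _ 1]) auto

lemma dvd_in_trans: "dvd_in A a b \<Longrightarrow> dvd_in A b c \<Longrightarrow> dvd_in A a c"
  unfolding dvd_in_def using mult_mem by (metis mult.assoc)

lemma dvd_in_mult: "dvd_in A a b \<Longrightarrow> c \<in> A \<Longrightarrow> dvd_in A a (b * c)"
  unfolding dvd_in_def using mult_mem by (metis mult.assoc)

lemma dvd_in_mult2: "dvd_in A a b \<Longrightarrow> c \<in> A \<Longrightarrow> dvd_in A a (c * b)"
  using dvd_in_mult by (metis mult.commute)

lemma dvd_in_add: "dvd_in A a b \<Longrightarrow> dvd_in A a c \<Longrightarrow> dvd_in A a (b + c)"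
  unfolding dvd_in_def using add_mem by (metis distrib_left)

lemma dvd_in_diff: "dvd_in A a b \<Longrightarrow> dvd_in A a c \<Longrightarrow> dvd_in A a (b - c)"
  unfolding dvd_in_def using diff_mem by (metis right_diff_distrib)

lemma dvd_in_zero: "dvd_in A a 0"
  unfolding dvd_in_def using zero_mem by (intro bexI[of _ 0]) auto

lemma dvd_in_sum: "(\<And>i. i \<in> I \<Longrightarrow> dvd_in A a (f i)) \<Longrightarrow> dvd_in A a (sum f I)"
  by (induction I rule: infinite_finite_induct) (auto simp: dvd_in_zero dvd_in_add)

lemma dvd_in_cancel:
  assumes "c \<in> A" "c \<noteq> 0" "a \<in> A" "b \<in> A" "dvd_in A (c * a) (c * b)"
  shows "dvd_in A a b"
proof -
  obtain x where x: "x \<in> A" "c * b = c * a * x" using assms(5) by (auto simp: dvd_in_def)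
  hence "c * b = c * (a * x)" by (simp add: mult.assoc)
  from cancel[OF assms(1,4) _ assms(2) this] x assms mult_mem show ?thesis
    by (auto simp: dvd_in_def)
qed

lemma prime_product_mem: "prime_product A n a \<Longrightarrow> a \<in> A"
  by (induction rule: prime_product.induct) (auto simp: prime_in_def mult_mem)

lemma prime_product_nonzero: "prime_product A n a \<Longrightarrow> (0::'a) \<noteq> 1 \<Longrightarrow> a \<noteq> 0"
proof (induction rule: prime_product.induct)
  case (unit u)
  then show ?case by (auto simp: dvd_in_def)
next
  case (mult p n a)
  then show ?case using no_zero_divisors prime_product_mem prime_inD by metis
qed

lemma unit_mult:
  assumes "u \<in> A" "dvd_in A u 1" "v \<in> A" "dvd_in A v 1"
  shows "dvd_in A (u * v) 1"
proof -
  obtain a b where "a \<in> A" "1 = u * a" "b \<in> A" "1 = v * b" using assms by (auto simp: dvd_in_def)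
  hence "1 = (u * v) * (a * b)" by (metis mult.assoc mult.left_commute mult_1)
  thus ?thesis unfolding dvd_in_def using \<open>a \<in> A\<close> \<open>b \<in> A\<close> mult_mem by blast
qed

lemma prime_product_unit_mult:
  assumes "prime_product A n a" "u \<in> A" "dvd_in A u 1"
  shows "prime_product A n (u * a)"
  using assms
proof (induction rule: prime_product.induct)
  case (unit v)
  thus ?case by (intro prime_product.unit) (auto simp: mult_mem unit_mult)
next
  case (mult p n a)
  hence "prime_product A (Suc n) (p * (u * a))" by (intro prime_product.mult) auto
  thus ?case by (simp add: mult.left_commute)
qed

lemma prime_product_mult:
  assumes "prime_product A n a" "prime_product A m b"
  shows "prime_product A (n + m) (a * b)"
  using assms
proof (induction rule: prime_product.induct)
  case (unit v)
  thus ?case by (simp add: prime_product_unit_mult)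
next
  case (mult p n a)
  thus ?case using prime_product.mult[of A p "n + m" "a * b"] by (simp add: mult.assoc)
qed

text \<open>From \<open>p = q * c\<close> the prime \<open>p\<close> divides \<open>q\<close> or
  \<open>c\<close>; in the second case cancelling \<open>p\<close> would make \<open>q\<close> a
  unit.\<close>

lemma prime_dvd_prime:
  assumes "prime_in A p" "prime_in A q" "dvd_in A q p"
  shows "dvd_in A p q"
proof -
  obtain c where c: "c \<in> A" "p = q * c" using assms by (auto simp: dvd_in_def)
  have "dvd_in A p (q * c)" using c dvd_in_refl by simp
  then consider "dvd_in A p q" | "dvd_in A p c" using prime_inD(4)[OF assms(1)] c prime_inD(1)[OF assms(2)] by blast
  thus ?thesis
  proof cases
    case 2
    then obtain e where e: "e \<in> A" "c = p * e" by (auto simp: dvd_in_def)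
    hence "q * (p * e) = p" using c by simp
    moreover have "q * (p * e) = p * (q * e)" by (simp add: ac_simps)
    ultimately have "p * 1 = p * (q * e)" by (metis mult_1_right)
    from cancel[OF _ _ _ _ this] have "1 = q * e"
      using prime_inD[OF assms(1)] prime_inD[OF assms(2)] e(1) one_mem mult_mem by auto
    thus ?thesis using prime_inD(3)[OF assms(2)] e by (auto simp: dvd_in_def)
  qed
qed

text \<open>The prime \<open>q\<close> divides one of the listed factors, hence is associated to it,
  and the unit between them is absorbed by the remaining product. So the count drops by exactly
  one.\<close>

lemma prime_product_extract:
  assumes "prime_product A n a" "prime_in A q" "dvd_in A q a"
  shows "\<exists>b m. n = Suc m \<and> a = q * b \<and> prime_product A m b"
  using assms
proof (induction rule: prime_product.induct)
  case (unit v)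
  thus ?case using dvd_in_trans prime_inD by blast
next
  case (mult p n a)
  note pD = prime_inD[OF mult.hyps(1)] and qD = prime_inD[OF mult.prems(1)]
  have "dvd_in A q p \<or> dvd_in A q a"
    using qD(4)[OF pD(1) prime_product_mem[OF mult.hyps(2)] mult.prems(2)] .
  thus ?case
  proof
    assume qp: "dvd_in A q p"
    then obtain c where c: "c \<in> A" "p = q * c" by (auto simp: dvd_in_def)
    from prime_dvd_prime[OF mult.hyps(1) mult.prems(1) qp]
    obtain e where e: "e \<in> A" "q = p * e" by (auto simp: dvd_in_def)
    have "(p * e) * c = p" using c e by simp
    moreover have "(p * e) * c = p * (c * e)" by (simp add: ac_simps)
    ultimately have "p * 1 = p * (c * e)" by (metis mult_1_right)
    from cancel[OF _ _ _ _ this] have "1 = c * e" using pD c(1) e(1) one_mem mult_mem by auto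
    hence "prime_product A n (c * a)"
      using c(1) e(1) mult.hyps by (intro prime_product_unit_mult) (auto simp: dvd_in_def)
    thus ?thesis using c by (metis mult.assoc)
  next
    assume "dvd_in A q a"
    from mult.IH[OF mult.prems(1) this] obtain b m where
      b: "n = Suc m" "a = q * b" "prime_product A m b" by blast
    have "prime_product A (Suc m) (p * b)" using mult.hyps b by (intro prime_product.mult)
    thus ?thesis using b by (metis mult.left_commute)
  qed
qed

end

section \<open>Multiplicities of a prime element\<close>

context set_domain
begin

lemma power_nonzero: "p \<in> A \<Longrightarrow> p \<noteq> 0 \<Longrightarrow> p ^ n \<noteq> 0"
proof (induction n)
  case 0
  show ?case
  proof
    assume "p ^ 0 = 0"
    hence "p * 1 = p * 0" by simp
    thus False using 0 by simp
  qed
next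
  case (Suc n)
  thus ?case using no_zero_divisors[of p "p ^ n"] power_mem by auto
qed

text \<open>The exponent \<open>n\<close> in \<open>p ^ n * g\<close>, with \<open>p\<close> not
  dividing \<open>g\<close>, plays the role of the \<open>p\<close>-adic valuation on
  \<open>A\<close>; no separate valuation function is introduced for it.\<close>

lemma power_dvd_in_iff:
  assumes p: "prime_in A p" and g: "g \<in> A" "\<not> dvd_in A p g"
  shows "dvd_in A (p ^ k) (p ^ n * g) \<longleftrightarrow> k \<le> n"
proof
  note pD = prime_inD[OF p]
  assume "k \<le> n"
  hence "p ^ n * g = p ^ k * (p ^ (n - k) * g)" by (simp flip: mult.assoc power_add)
  thus "dvd_in A (p ^ k) (p ^ n * g)"
    unfolding dvd_in_def using mult_mem power_mem pD(1) g(1) by blast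
next
  note pD = prime_inD[OF p]
  assume dvd: "dvd_in A (p ^ k) (p ^ n * g)"
  show "k \<le> n"
  proof (rule ccontr)
    assume "\<not> k \<le> n"
    then obtain j where "k = n + Suc j" by (metis not_le less_imp_Suc_add add_Suc_right)
    hence "p ^ k = p ^ n * (p * p ^ j)" by (simp add: power_add)
    hence "dvd_in A (p * p ^ j) g"
      using dvd_in_cancel[OF power_mem[OF pD(1)] power_nonzero[OF pD(1,2)], of "p * p ^ j" g n]
        dvd mult_mem power_mem pD(1) g(1) by simp
    moreover have "dvd_in A p (p * p ^ j)" using dvd_in_mult[OF dvd_in_refl] power_mem pD(1) by blast
    ultimately show False using dvd_in_trans g(2) by blast
  qed
qed

end

lemma (in factorial_set) prime_power_split:
  assumes p: "prime_in A p" and f: "f \<in> A" "f \<noteq> 0"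
  obtains n g where "g \<in> A" "f = p ^ n * g" "\<not> dvd_in A p g"
proof -
  obtain m where "prime_product A m f" using factorization f by blast
  hence "\<exists>n g. g \<in> A \<and> f = p ^ n * g \<and> \<not> dvd_in A p g"
  proof (induction m arbitrary: f rule: less_induct)
    case (less m)
    show ?case
    proof (cases "dvd_in A p f")
      case False
      thus ?thesis using prime_product_mem[OF less.prems] by (intro exI[of _ 0] exI[of _ f]) auto
    next
      case True
      then obtain b k where b: "m = Suc k" "f = p * b" "prime_product A k b"
        using prime_product_extract[OF less.prems p] by blast
      then obtain n g where "g \<in> A" "b = p ^ n * g" "\<not> dvd_in A p g"
        using less.IH[of k b] by auto
      thus ?thesis using b by (intro exI[of _ "Suc n"] exI[of _ g]) (simp add: mult.assoc)
    qed
  qed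
  thus ?thesis using that by blast
qed

text \<open>Divisibility is a local condition. A prime factor \<open>p\<close> of the divisor is
  cancelled from both sides; for each prime \<open>q\<close> this lowers both multiplicities by the
  same amount, so the hypothesis passes to the quotients.\<close>

lemma (in factorial_set) dvd_in_by_prime_powers:
  assumes g: "prime_product A m g" and f: "f \<in> A" "f \<noteq> 0"
    and le: "\<And>q n. prime_in A q \<Longrightarrow> dvd_in A (q ^ n) g \<Longrightarrow> dvd_in A (q ^ n) f"
  shows "dvd_in A g f"
  using assms
proof (induction arbitrary: f rule: prime_product.induct)
  case (unit u)
  hence "dvd_in A u (1 * f)" using dvd_in_mult by blast
  thus ?case by simp
next
  case (mult p n a)
  note pD = prime_inD[OF mult.hyps(1)]
  have aA: "a \<in> A" by (rule prime_product_mem[OF mult.hyps(2)])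
  have "dvd_in A (p ^ 1) (p * a)" using dvd_in_mult[OF dvd_in_refl aA] by simp
  hence "dvd_in A p f" using mult.prems(3)[OF mult.hyps(1)] by fastforce
  then obtain f' where f': "f' \<in> A" "f = p * f'" by (auto simp: dvd_in_def)
  have f'0: "f' \<noteq> 0" using f'(2) mult.prems(2) by auto
  have one: "(0::'a) \<noteq> 1" using pD(2) by (metis mult_1 mult_zero_left)
  have a0: "a \<noteq> 0" using prime_product_nonzero[OF mult.hyps(2) one] .
  have "dvd_in A a f'"
  proof (rule mult.IH[OF f'(1) f'0])
    fix q k assume q: "prime_in A q" and qa: "dvd_in A (q ^ k) a"
    \<comment> \<open>\<open>e\<close> is 1 if \<open>q\<close> is associated to \<open>p\<close>
      and 0 otherwise. It is added to the multiplicities of both \<open>a\<close> and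
      \<open>f'\<close>, so the two cases need no separation.\<close>
    obtain e p' where p': "p' \<in> A" "p = q ^ e * p'" "\<not> dvd_in A q p'"
      using prime_power_split[OF q pD(1,2)] .
    obtain s a' where a': "a' \<in> A" "a = q ^ s * a'" "\<not> dvd_in A q a'"
      using prime_power_split[OF q aA a0] .
    obtain t f'' where f'': "f'' \<in> A" "f' = q ^ t * f''" "\<not> dvd_in A q f''"
      using prime_power_split[OF q f'(1) f'0] .
    have pa: "p * a = q ^ (e + s) * (p' * a')" unfolding p'(2) a'(2) power_add by (simp only: ac_simps)
    have pf: "f = q ^ (e + t) * (p' * f'')"
      unfolding f'(2) f''(2) power_add by (subst p'(2)) (simp only: ac_simps)
    have nd: "\<not> dvd_in A q (p' * a')" "\<not> dvd_in A q (p' * f'')"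
      using prime_inD(4)[OF q] p' a' f'' by blast+
    have "k \<le> s" using qa power_dvd_in_iff[OF q a'(1,3)] a'(2) by simp
    hence "dvd_in A (q ^ (e + k)) (p * a)"
      unfolding pa using power_dvd_in_iff[OF q mult_mem[OF p'(1) a'(1)] nd(1)] by simp
    hence "dvd_in A (q ^ (e + k)) f" by (rule mult.prems(3)[OF q])
    hence "e + k \<le> e + t"
      unfolding pf using power_dvd_in_iff[OF q mult_mem[OF p'(1) f''(1)] nd(2)] by blast
    thus "dvd_in A (q ^ k) f'" using power_dvd_in_iff[OF q f''(1,3)] f''(2) by simp
  qed
  thus ?case using f' by (auto simp: dvd_in_def mult.assoc)
qed

subsection \<open>Polynomials with coefficients in a subring\<close>

definition polys_over :: "'a::comm_ring_1 set \<Rightarrow> 'a poly set" where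
  "polys_over A = {p. \<forall>i. coeff p i \<in> A}"

text \<open>Content one, tested prime by prime in place of a gcd of the coefficients. If
  \<open>A\<close> has no primes, as for a field, every polynomial is primitive, even 0.\<close>

definition primitive_over :: "'a::comm_ring_1 set \<Rightarrow> 'a poly \<Rightarrow> bool" where
  "primitive_over A f \<longleftrightarrow> (\<forall>p. prime_in A p \<longrightarrow> (\<exists>i. \<not> dvd_in A p (coeff f i)))"

context set_domain
begin

lemma const_polys_over: "a \<in> A \<Longrightarrow> [:a:] \<in> polys_over A"
  by (auto simp: polys_over_def coeff_pCons zero_mem split: nat.split)

lemma monom_polys_over: "a \<in> A \<Longrightarrow> monom a n \<in> polys_over A"
  by (auto simp: polys_over_def zero_mem)

text \<open>The ambient type may have zero divisors, so additivity of degrees is recovered from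
  \<open>A\<close>, to which both leading coefficients belong.\<close>

lemma coeff_mult_top:
  assumes "f \<in> polys_over A" "g \<in> polys_over A" "f \<noteq> 0" "g \<noteq> 0"
  shows "coeff (f * g) (degree f + degree g) \<noteq> 0"
proof -
  have "coeff (f * g) (degree f + degree g) = lead_coeff f * lead_coeff g"
    by (rule coeff_mult_degree_sum)
  moreover have "lead_coeff f * lead_coeff g \<noteq> 0"
    using assms no_zero_divisors[of "lead_coeff f" "lead_coeff g"]
    by (auto simp: polys_over_def)
  ultimately show ?thesis by simp
qed

lemma degree_mult_over:
  assumes "f \<in> polys_over A" "g \<in> polys_over A" "f \<noteq> 0" "g \<noteq> 0"
  shows "degree (f * g) = degree f + degree g"
  using coeff_mult_top[OF assms] le_degree degree_mult_le by (metis le_antisym)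

lemma polys_over_domain: "set_domain (polys_over A)"
proof
  fix a b assume ab: "a \<in> polys_over A" "b \<in> polys_over A"
  show "a + b \<in> polys_over A" using ab by (auto simp: polys_over_def add_mem)
  show "a * b \<in> polys_over A" using ab
    by (auto simp: polys_over_def coeff_mult intro!: sum_mem mult_mem)
  show "- a \<in> polys_over A" using ab by (auto simp: polys_over_def minus_mem)
  assume "a * b = 0"
  thus "a = 0 \<or> b = 0" using coeff_mult_top[OF ab] by auto
next
  show "0 \<in> polys_over A" by (auto simp: polys_over_def zero_mem)
  show "1 \<in> polys_over A" using const_polys_over[OF one_mem] by (simp add: pCons_one)
qed

lemma dvd_in_const_iff:
  assumes "f \<in> polys_over A"
  shows "dvd_in (polys_over A) [:p:] f \<longleftrightarrow> (\<forall>i. dvd_in A p (coeff f i))"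
proof
  assume "dvd_in (polys_over A) [:p:] f"
  then obtain g where g: "g \<in> polys_over A" "f = [:p:] * g" by (auto simp: dvd_in_def)
  thus "\<forall>i. dvd_in A p (coeff f i)" by (auto simp: polys_over_def dvd_in_def)
next
  assume "\<forall>i. dvd_in A p (coeff f i)"
  then obtain c where c: "\<And>i. c i \<in> A" "\<And>i. coeff f i = p * c i"
    unfolding dvd_in_def by metis
  define g where "g = (\<Sum>i\<le>degree f. monom (c i) i)"
  interpret P: set_domain "polys_over A" by (rule polys_over_domain)
  have "g \<in> polys_over A" unfolding g_def using c by (intro P.sum_mem monom_polys_over)
  moreover have "f = [:p:] * g"
  proof (rule poly_eqI)
    fix i
    have "coeff g i = (if i \<le> degree f then c i else 0)" by (simp add: g_def coeff_sum)
    thus "coeff f i = coeff ([:p:] * g) i" using c(2)[of i] coeff_eq_0[of f i] by auto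
  qed
  ultimately show "dvd_in (polys_over A) [:p:] f" by (auto simp: dvd_in_def)
qed

text \<open>Gauss's lemma. At the least indices \<open>i\<close>, \<open>j\<close> whose
  coefficients \<open>p\<close> does not divide, coefficient \<open>i + j\<close> of the product is
  congruent to \<open>coeff f i * coeff g j\<close> modulo \<open>p\<close>: every other term has a
  factor of index below \<open>i\<close> or below \<open>j\<close>.\<close>

lemma prime_in_polys_over:
  assumes p: "prime_in A p"
  shows "prime_in (polys_over A) [:p:]"
proof -
  note pD = prime_inD[OF p]
  have "\<not> dvd_in (polys_over A) [:p:] 1"
    using dvd_in_const_iff[of 1 p] pD(3) const_polys_over[OF one_mem]
    by (metis coeff_pCons_0 pCons_one)
  moreover have "dvd_in (polys_over A) [:p:] f \<or> dvd_in (polys_over A) [:p:] g"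
    if fg: "f \<in> polys_over A" "g \<in> polys_over A" "dvd_in (polys_over A) [:p:] (f * g)" for f g
  proof (rule ccontr)
    assume "\<not> ?thesis"
    hence ex: "\<exists>i. \<not> dvd_in A p (coeff f i)" "\<exists>j. \<not> dvd_in A p (coeff g j)"
      using fg dvd_in_const_iff by auto
    define i where "i = (LEAST i. \<not> dvd_in A p (coeff f i))"
    define j where "j = (LEAST j. \<not> dvd_in A p (coeff g j))"
    have i: "\<not> dvd_in A p (coeff f i)" "\<And>k. k < i \<Longrightarrow> dvd_in A p (coeff f k)"
      using LeastI_ex[OF ex(1)] not_less_Least unfolding i_def by blast+
    have j: "\<not> dvd_in A p (coeff g j)" "\<And>k. k < j \<Longrightarrow> dvd_in A p (coeff g k)"
      using LeastI_ex[OF ex(2)] not_less_Least unfolding j_def by blast+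
    have mem: "coeff f k \<in> A" "coeff g k \<in> A" for k using fg by (auto simp: polys_over_def)
    let ?h = "\<lambda>k. coeff f k * coeff g (i + j - k)"
    have "f * g \<in> polys_over A" using fg set_domain.mult_mem[OF polys_over_domain] by blast
    hence "dvd_in A p (coeff (f * g) (i + j))"
      using fg(3) dvd_in_const_iff by blast
    hence "dvd_in A p (\<Sum>k\<le>i + j. ?h k)" by (simp add: coeff_mult)
    moreover have "(\<Sum>k\<le>i + j. ?h k) = ?h i + (\<Sum>k\<in>{..i + j} - {i}. ?h k)"
      by (rule sum.remove) auto
    moreover have "dvd_in A p (\<Sum>k\<in>{..i + j} - {i}. ?h k)"
    proof (rule dvd_in_sum)
      fix k assume k: "k \<in> {..i + j} - {i}"
      show "dvd_in A p (?h k)"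
      proof (cases "k < i")
        case True
        thus ?thesis using i(2) mem dvd_in_mult by blast
      next
        case False
        hence "i + j - k < j" using k by auto
        thus ?thesis using j(2) mem dvd_in_mult2 by blast
      qed
    qed
    ultimately have "dvd_in A p (?h i)" using dvd_in_diff by fastforce
    hence "dvd_in A p (coeff f i * coeff g j)" by simp
    thus False using pD(4) mem i(1) j(1) by blast
  qed
  ultimately show ?thesis
    using pD const_polys_over[of p] by (auto simp: prime_in_def)
qed

lemma unit_const:
  assumes "u \<in> A" "dvd_in A u 1"
  shows "dvd_in (polys_over A) [:u:] 1"
proof -
  obtain v where "v \<in> A" "1 = u * v" using assms by (auto simp: dvd_in_def)
  hence "1 = [:u:] * [:v:]" by (simp add: one_pCons mult.commute)
  thus ?thesis unfolding dvd_in_def using const_polys_over[OF \<open>v \<in> A\<close>] by blast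
qed

lemma prime_product_const:
  assumes "prime_product A n a"
  shows "prime_product (polys_over A) n [:a:]"
  using assms
proof (induction rule: prime_product.induct)
  case (unit u)
  thus ?case by (intro prime_product.unit const_polys_over unit_const)
next
  case (mult p n a)
  have "prime_product (polys_over A) (Suc n) ([:p:] * [:a:])"
    using mult by (intro prime_product.mult prime_in_polys_over)
  thus ?case by (simp add: mult.commute)
qed

text \<open>Replaces Euclidean division over the fraction field: multiplying by the leading
  coefficient of \<open>d\<close> at each step keeps all coefficients in \<open>A\<close>, and
  \<open>c\<close> collects these multipliers.\<close>

lemma pseudo_division_over:
  assumes d: "d \<in> polys_over A" "d \<noteq> 0" and f: "f \<in> polys_over A"
  shows "\<exists>c q r. c \<in> A \<and> c \<noteq> 0 \<and> q \<in> polys_over A \<and> r \<in> polys_over A \<and>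
           [:c:] * f = q * d + r \<and> (r = 0 \<or> degree r < degree d)"
  using f
proof (induction "degree f" arbitrary: f rule: less_induct)
  case less
  interpret P: set_domain "polys_over A" by (rule polys_over_domain)
  have one: "(1::'a) \<noteq> 0" using d(2) by (metis smult_1_left smult_0_left)
  show ?case
  proof (cases "f = 0 \<or> degree f < degree d")
    case True
    thus ?thesis using less.prems one one_mem P.zero_mem
      by (intro exI[of _ 1] exI[of _ 0] exI[of _ f]) (auto simp: pCons_one)
  next
    case False
    define k where "k = degree f - degree d"
    let ?a = "lead_coeff d" and ?b = "lead_coeff f"
    have ab: "?a \<in> A" "?b \<in> A" using d less.prems by (auto simp: polys_over_def)
    define g where "g = [:?a:] * f - monom ?b k * d"
    have gP: "g \<in> polys_over A" unfolding g_def
      using ab d less.prems by (intro P.diff_mem P.mult_mem const_polys_over monom_polys_over)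
    have mq: "monom ?b k \<in> polys_over A" using ab by (intro monom_polys_over)
    have "degree g \<le> degree f" unfolding g_def
    proof (rule degree_diff_le)
      show "degree ([:?a:] * f) \<le> degree f" by (simp add: degree_smult_le)
      have "degree (monom ?b k * d) \<le> k + degree d"
        using degree_mult_le[of "monom ?b k" d] degree_monom_le[of ?b k] by linarith
      thus "degree (monom ?b k * d) \<le> degree f" using False by (simp add: k_def)
    qed
    moreover have "coeff g (degree f) = 0"
      using False by (simp add: g_def coeff_monom_mult k_def)
    ultimately have g: "g = 0 \<or> degree g < degree f"
      by (metis leading_coeff_0_iff le_neq_implies_less)
    show ?thesis
    proof (cases "degree g < degree f")
      case True
      from less.hyps[OF this gP] obtain c q r where IH: "c \<in> A" "c \<noteq> 0" "q \<in> polys_over A"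
        "r \<in> polys_over A" "[:c:] * g = q * d + r" "r = 0 \<or> degree r < degree d" by blast
      have "[:c * ?a:] * f = [:c:] * g + [:c:] * (monom ?b k * d)"
        by (simp add: g_def algebra_simps)
      also have "\<dots> = (q + [:c:] * monom ?b k) * d + r" using IH by (simp add: algebra_simps)
      finally have eq: "[:c * ?a:] * f = (q + [:c:] * monom ?b k) * d + r" .
      have "c * ?a \<noteq> 0" using no_zero_divisors[of c ?a] IH ab d by auto
      thus ?thesis using IH eq ab mq
        by (intro exI[of _ "c * ?a"] exI[of _ "q + [:c:] * monom ?b k"] exI[of _ r])
          (auto intro!: mult_mem P.add_mem P.mult_mem const_polys_over simp del: mult_pCons_left)
    next
      case False
      hence "[:?a:] * f = monom ?b k * d + 0" using g by (auto simp: g_def)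
      thus ?thesis using ab mq d P.zero_mem
        by (intro exI[of _ ?a] exI[of _ "monom ?b k"] exI[of _ 0]) auto
    qed
  qed
qed

lemma primitive_over_dvd:
  assumes "primitive_over A f" "f = g * h" "g \<in> polys_over A" "h \<in> polys_over A"
  shows "primitive_over A g"
  unfolding primitive_over_def
proof (intro allI impI)
  fix p assume p: "prime_in A p"
  interpret P: set_domain "polys_over A" by (rule polys_over_domain)
  have f: "f \<in> polys_over A" using assms P.mult_mem by auto
  show "\<exists>i. \<not> dvd_in A p (coeff g i)"
  proof (rule ccontr)
    assume "\<not> ?thesis"
    hence "dvd_in (polys_over A) [:p:] g" using dvd_in_const_iff[OF assms(3)] by blast
    hence "dvd_in (polys_over A) [:p:] f" using assms P.dvd_in_mult by blast
    thus False using dvd_in_const_iff[OF f] assms(1) p by (auto simp: primitive_over_def)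
  qed
qed

end

section \<open>Primitive polynomials over a factorial subring\<close>

context factorial_set
begin

lemma nonunit_prime_dvd:
  assumes "a \<in> A" "a \<noteq> 0" "\<not> dvd_in A a 1"
  shows "\<exists>p. prime_in A p \<and> dvd_in A p a"
proof -
  obtain n where "prime_product A n a" using factorization assms by blast
  thus ?thesis using assms(3)
  proof (cases rule: prime_product.cases)
    case (mult p n b)
    thus ?thesis using prime_product_mem[OF mult(4)] by (auto simp: dvd_in_def)
  qed auto
qed

text \<open>Dividing by a prime common to all coefficients also removes it from the leading
  coefficient, so the number of prime factors there bounds the number of divisions.\<close>

lemma content_removal:
  assumes "f \<in> polys_over A" "prime_product A n (lead_coeff f)"
  shows "\<exists>m c g. prime_product A m c \<and> g \<in> polys_over A \<and> primitive_over A g \<and> f = [:c:] * g"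
  using assms
proof (induction n arbitrary: f)
  case (0 f)
  have "primitive_over A f" unfolding primitive_over_def
    using prime_product_extract[OF 0(2)] by blast
  moreover have "prime_product A 0 1" by (intro prime_product.unit one_mem dvd_in_refl)
  ultimately show ?case using 0
    by (intro exI[of _ 0] exI[of _ 1] exI[of _ f]) (auto simp: pCons_one)
next
  case (Suc n f)
  show ?case
  proof (cases "primitive_over A f")
    case True
    moreover have "prime_product A 0 1" by (intro prime_product.unit one_mem dvd_in_refl)
    ultimately show ?thesis using Suc
      by (intro exI[of _ 0] exI[of _ 1] exI[of _ f]) (auto simp: pCons_one)
  next
    case False
    then obtain p where p: "prime_in A p" "\<And>i. dvd_in A p (coeff f i)"
      by (auto simp: primitive_over_def)
    then obtain g where g: "g \<in> polys_over A" "f = [:p:] * g"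
      using dvd_in_const_iff[OF Suc.prems(1), of p] unfolding dvd_in_def by blast
    have "(1::'a) \<noteq> 0" using prime_inD[OF p(1)] by (metis mult_1 mult_zero_left)
    hence "f \<noteq> 0" using prime_product_nonzero[OF Suc.prems(2)] by auto
    hence "g \<noteq> 0" using g by auto
    have pc: "[:p:] \<noteq> 0" "[:p:] \<in> polys_over A" using prime_inD[OF p(1)] by (auto intro: const_polys_over)
    have "degree f = degree g" using degree_mult_over[OF pc(2) g(1) pc(1) \<open>g \<noteq> 0\<close>] g by simp
    hence "lead_coeff f = p * lead_coeff g" using g by simp
    obtain b where b: "lead_coeff f = p * b" "prime_product A n b"
      using prime_product_extract[OF Suc.prems(2) p(1) p(2)] by blast
    have "p * b = p * lead_coeff g"
      by (rule trans[OF b(1)[symmetric] \<open>lead_coeff f = p * lead_coeff g\<close>])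
    moreover have "lead_coeff g \<in> A" using g(1) by (auto simp: polys_over_def)
    ultimately have "b = lead_coeff g"
      using cancel prime_inD(1,2)[OF p(1)] prime_product_mem[OF b(2)] by blast
    then obtain m c h where IH: "prime_product A m c" "h \<in> polys_over A" "primitive_over A h"
      "g = [:c:] * h" using Suc.IH[OF g(1)] b by blast
    hence "f = [:p * c:] * h" using g by (simp add: mult.commute)
    thus ?thesis using IH prime_product.mult[OF p(1) IH(1)] by blast
  qed
qed

text \<open>This is the descent from the fraction field to \<open>A\<close>. A prime
  \<open>p\<close> of the constant divides \<open>d * q\<close> but not the primitive
  \<open>d\<close>, hence divides \<open>q\<close> by Gauss's lemma and can be cancelled; the primes
  of \<open>c\<close> disappear one by one.\<close>

lemma primitive_dvd_const_mult:
  assumes "prime_product A n c" "primitive_over A d" "d \<in> polys_over A" "f \<in> polys_over A"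
    and "dvd_in (polys_over A) d ([:c:] * f)"
  shows "dvd_in (polys_over A) d f"
  using assms
proof (induction rule: prime_product.induct)
  case (unit u)
  interpret P: set_domain "polys_over A" by (rule polys_over_domain)
  obtain v where v: "v \<in> A" "1 = u * v" using unit by (auto simp: dvd_in_def)
  have "[:v:] * ([:u:] * f) = f" using v by (simp add: mult.commute)
  thus ?case using P.dvd_in_mult2[OF unit(6) const_polys_over[OF v(1)]] by metis
next
  case (mult p n a)
  interpret P: set_domain "polys_over A" by (rule polys_over_domain)
  have pP: "prime_in (polys_over A) [:p:]" by (rule prime_in_polys_over[OF mult.hyps(1)])
  obtain q where q: "q \<in> polys_over A" "[:p * a:] * f = d * q"
    using mult.prems by (auto simp: dvd_in_def)
  have eq: "[:p:] * ([:a:] * f) = d * q" using q by (simp add: mult.commute)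
  have af: "[:a:] * f \<in> polys_over A"
    using const_polys_over[OF prime_product_mem[OF mult.hyps(2)]] mult.prems P.mult_mem by blast
  have "dvd_in (polys_over A) [:p:] (d * q)" using af eq by (metis dvd_in_def)
  hence "dvd_in (polys_over A) [:p:] d \<or> dvd_in (polys_over A) [:p:] q"
    using prime_inD(4)[OF pP] mult.prems q by blast
  moreover have "\<not> dvd_in (polys_over A) [:p:] d"
    using mult.prems mult.hyps dvd_in_const_iff by (auto simp: primitive_over_def)
  ultimately obtain s where s: "s \<in> polys_over A" "q = [:p:] * s" by (auto simp: dvd_in_def)
  have "[:p:] * ([:a:] * f) = [:p:] * (d * s)" using eq s by (metis mult.left_commute)
  hence "[:a:] * f = d * s"
    using P.cancel[OF prime_inD(1)[OF pP] af _ prime_inD(2)[OF pP]] P.mult_mem s mult.prems by blast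
  thus ?case using mult.IH mult.prems s by (auto simp: dvd_in_def)
qed

text \<open>The hypothesis \<open>irr\<close> is irreducibility over the fraction field. The
  argument is Bezout's, with denominators cleared: the gcd of \<open>f\<close> and \<open>g\<close>
  is either \<open>f\<close> up to a unit, and then \<open>f\<close> divides \<open>g\<close>, or a
  constant, and then \<open>f\<close> divides \<open>h\<close>.\<close>

lemma primitive_irreducible_prime:
  assumes f: "f \<in> polys_over A" "primitive_over A f" "degree f > 0"
    and irr: "\<And>g h. g \<in> polys_over A \<Longrightarrow> h \<in> polys_over A \<Longrightarrow> f = g * h \<Longrightarrow>
                degree g = degree f \<or> degree h = degree f"
  shows "prime_in (polys_over A) f"
proof -
  interpret P: set_domain "polys_over A" by (rule polys_over_domain)
  have f0: "f \<noteq> 0" using f by auto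
  have "\<not> dvd_in (polys_over A) f 1"
  proof
    assume "dvd_in (polys_over A) f 1"
    then obtain g where g: "g \<in> polys_over A" "1 = f * g" by (auto simp: dvd_in_def)
    have "g \<noteq> 0" using g f0 by (metis mult_zero_right mult_1_right)
    thus False using degree_mult_over[OF f(1) g(1) f0] g f by (metis degree_1 add_is_0 less_numeral_extra(3))
  qed
  moreover have "dvd_in (polys_over A) f g \<or> dvd_in (polys_over A) f h"
    if gh: "g \<in> polys_over A" "h \<in> polys_over A" "dvd_in (polys_over A) f (g * h)" for g h
  proof -
    \<comment> \<open>The nonzero elements of the ideal generated by \<open>f\<close> and
      \<open>g\<close>; one of least degree serves as the gcd over the fraction field.\<close>
    define I where "I = {a * f + b * g | a b. a \<in> polys_over A \<and> b \<in> polys_over A} - {0}"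
    have "f = 1 * f + 0 * g" by simp
    hence "f \<in> I" unfolding I_def using P.one_mem P.zero_mem f0 by blast
    then obtain d where d: "d \<in> I" "\<And>e. e \<in> I \<Longrightarrow> degree d \<le> degree e"
      using exists_least_lemma ex_has_least_nat[of "\<lambda>x. x \<in> I" f degree] by blast
    then obtain a b where ab: "a \<in> polys_over A" "b \<in> polys_over A" "d = a * f + b * g" "d \<noteq> 0"
      by (auto simp: I_def)
    have dP: "d \<in> polys_over A" using ab f gh P.add_mem P.mult_mem by auto
    obtain n where "prime_product A n (lead_coeff d)"
      using factorization[of "lead_coeff d"] dP ab(4) by (auto simp: polys_over_def)
    then obtain m e d' where d': "prime_product A m e" "d' \<in> polys_over A" "primitive_over A d'"
      "d = [:e:] * d'" using content_removal[OF dP] by blast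
    \<comment> \<open>Pseudo-division of \<open>x\<close> by \<open>d\<close> leaves a remainder in
      the ideal, and minimality of the degree makes it 0. So \<open>d\<close> divides a constant
      multiple of \<open>x\<close>, and its primitive part \<open>d'\<close> divides
      \<open>x\<close> itself.\<close>
    have div: "dvd_in (polys_over A) d' x"
      if x: "x \<in> polys_over A" "\<And>y. y \<in> polys_over A \<Longrightarrow> \<exists>a\<in>polys_over A. \<exists>b\<in>polys_over A. y * x = a * f + b * g" for x
    proof -
      obtain c q r where pd: "c \<in> A" "c \<noteq> 0" "q \<in> polys_over A" "r \<in> polys_over A"
        "[:c:] * x = q * d + r" "r = 0 \<or> degree r < degree d"
        using pseudo_division_over[OF dP ab(4) x(1)] by blast
      obtain a' b' where ab': "a' \<in> polys_over A" "b' \<in> polys_over A" "[:c:] * x = a' * f + b' * g"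
        using x(2)[OF const_polys_over[OF pd(1)]] by blast
      have "r = (a' - q * a) * f + (b' - q * b) * g"
        using pd(5) ab'(3) ab(3) by (simp add: algebra_simps)
      moreover have "a' - q * a \<in> polys_over A" "b' - q * b \<in> polys_over A"
        using ab ab' pd P.diff_mem P.mult_mem by auto
      ultimately have "r \<noteq> 0 \<Longrightarrow> r \<in> I" unfolding I_def by blast
      hence "r = 0" using d(2) pd(6) by fastforce
      hence "[:c:] * x = d' * ([:e:] * q)" using pd(5) d'(4) by (metis add_0_right mult.assoc mult.commute)
      moreover have "[:e:] * q \<in> polys_over A"
        using pd P.mult_mem const_polys_over prime_product_mem[OF d'(1)] by blast
      ultimately have "dvd_in (polys_over A) d' ([:c:] * x)" unfolding dvd_in_def by blast
      moreover obtain n where "prime_product A n c" using factorization pd by blast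
      ultimately show ?thesis using primitive_dvd_const_mult d' x(1) by blast
    qed
    have "dvd_in (polys_over A) d' f"
    proof (rule div[OF f(1)])
      fix y assume "y \<in> polys_over A"
      thus "\<exists>a\<in>polys_over A. \<exists>b\<in>polys_over A. y * f = a * f + b * g"
        using P.zero_mem by (intro bexI[of _ y] bexI[of _ 0]) auto
    qed
    then obtain k where k: "k \<in> polys_over A" "f = d' * k" by (auto simp: dvd_in_def)
    have dg: "dvd_in (polys_over A) d' g"
    proof (rule div[OF gh(1)])
      fix y assume "y \<in> polys_over A"
      thus "\<exists>a\<in>polys_over A. \<exists>b\<in>polys_over A. y * g = a * f + b * g"
        using P.zero_mem by (intro bexI[of _ 0] bexI[of _ y]) auto
    qed
    have nz: "d' \<noteq> 0" "k \<noteq> 0" using k f0 by auto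
    have deg: "degree f = degree d' + degree k" using degree_mult_over[OF d'(2) k(1) nz] k by simp
    show ?thesis
    proof (cases "degree d' = degree f")
      case True
      then obtain k0 where k0: "k = [:k0:]" using deg degree_eq_zeroE by (metis add_cancel_left_right)
      have k0A: "k0 \<in> A" "k0 \<noteq> 0" using k k0 nz by (auto simp: polys_over_def split: nat.splits)
        (metis coeff_pCons_0)
      have "dvd_in A k0 1"
      proof (rule ccontr)
        assume "\<not> dvd_in A k0 1"
        then obtain p where p: "prime_in A p" "dvd_in A p k0" using nonunit_prime_dvd k0A by blast
        have "dvd_in A p (coeff f i)" for i
          using k k0 p d'(2) dvd_in_mult[OF p(2)] by (auto simp: polys_over_def)
        thus False using f(2) p(1) by (auto simp: primitive_over_def)
      qed
      then obtain v where v: "v \<in> A" "1 = k0 * v" by (auto simp: dvd_in_def)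
      have "f * [:v:] = d' * [:k0 * v:]" using k k0 by (simp add: mult.commute)
      hence "d' = f * [:v:]" using v by (simp add: pCons_one)
      hence "dvd_in (polys_over A) f d'" using const_polys_over[OF v(1)] unfolding dvd_in_def by blast
      thus ?thesis using dg P.dvd_in_trans by blast
    next
      case False
      hence "degree k = degree f" using irr[OF d'(2) k(1) k(2)] by simp
      hence "degree d' = 0" using deg by simp
      moreover have e: "e \<noteq> 0" "e \<in> A" using d' ab prime_product_mem by auto
      ultimately have "degree d = 0" using d'(4) degree_smult_le[of e d'] by simp
      then obtain e0 where e0: "d = [:e0:]" using degree_eq_zeroE by blast
      have e0A: "e0 \<in> A" "e0 \<noteq> 0" using dP e0 ab(4) by (auto simp: polys_over_def)
        (metis coeff_pCons_0)
      \<comment> \<open>Here \<open>d\<close> is the constant \<open>e0\<close>, so the Bezout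
        relation multiplied by \<open>h\<close> shows that \<open>f\<close> divides
        \<open>e0 * h\<close>.\<close>
      have "d * h = (a * h) * f + b * (g * h)" using ab by (simp add: algebra_simps)
      moreover have "dvd_in (polys_over A) f ((a * h) * f)" 
        using ab gh P.mult_mem P.dvd_in_mult2[OF P.dvd_in_refl] by blast
      ultimately have "dvd_in (polys_over A) f ([:e0:] * h)"
        using P.dvd_in_add P.dvd_in_mult2[OF gh(3) ab(2)] e0 by metis
      moreover obtain n where "prime_product A n e0" using factorization e0A by blast
      ultimately show ?thesis using primitive_dvd_const_mult f gh by blast
    qed
  qed
  ultimately show ?thesis using f f0 by (auto simp: prime_in_def)
qed

text \<open>Induction on the degree. In degree 0 primitivity makes \<open>f\<close> a unit; if
  \<open>f\<close> splits into factors of smaller degree, these are again primitive; otherwise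
  \<open>f\<close> is prime.\<close>

lemma primitive_factorization:
  assumes "f \<in> polys_over A" "f \<noteq> 0" "primitive_over A f"
  shows "\<exists>n. prime_product (polys_over A) n f"
  using assms
proof (induction "degree f" arbitrary: f rule: less_induct)
  case less
  interpret P: set_domain "polys_over A" by (rule polys_over_domain)
  consider "degree f = 0"
    | "degree f > 0" "\<exists>g\<in>polys_over A. \<exists>h\<in>polys_over A. f = g * h \<and> degree g \<noteq> degree f \<and> degree h \<noteq> degree f"
    | "degree f > 0" "\<And>g h. g \<in> polys_over A \<Longrightarrow> h \<in> polys_over A \<Longrightarrow> f = g * h \<Longrightarrow>
                degree g = degree f \<or> degree h = degree f" by blast
  thus ?case
  proof cases
    case 1
    then obtain a where a: "f = [:a:]" using degree_eq_zeroE by blast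
    hence aA: "a \<in> A" "a \<noteq> 0" using less.prems by (auto simp: polys_over_def) (metis coeff_pCons_0)
    have "dvd_in A a 1"
    proof (rule ccontr)
      assume "\<not> dvd_in A a 1"
      then obtain p where p: "prime_in A p" "dvd_in A p a" using nonunit_prime_dvd aA by blast
      have "dvd_in A p (coeff f i)" for i
        using a p dvd_in_zero by (auto simp: coeff_pCons split: nat.split)
      thus False using less.prems p(1) by (auto simp: primitive_over_def)
    qed
    thus ?thesis using a prime_product.unit unit_const aA less.prems by blast
  next
    case 2
    then obtain g h where gh: "g \<in> polys_over A" "h \<in> polys_over A" "f = g * h"
      "degree g \<noteq> degree f" "degree h \<noteq> degree f" by blast
    have nz: "g \<noteq> 0" "h \<noteq> 0" using gh less.prems by auto
    have "degree f = degree g + degree h" using degree_mult_over gh nz by auto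
    hence lt: "degree g < degree f" "degree h < degree f" using gh by auto
    have prim: "primitive_over A g" "primitive_over A h"
      using primitive_over_dvd[OF less.prems(3)] gh by (blast, metis mult.commute)
    obtain n m where "prime_product (polys_over A) n g" "prime_product (polys_over A) m h"
      using less.hyps[OF lt(1)] less.hyps[OF lt(2)] gh nz prim by blast
    thus ?thesis using P.prime_product_mult gh by blast
  next
    case 3
    hence "prime_in (polys_over A) f" using primitive_irreducible_prime less.prems by blast
    moreover have "prime_product (polys_over A) 0 1"
      by (intro prime_product.unit P.one_mem P.dvd_in_refl)
    ultimately show ?thesis using prime_product.mult by (metis mult_1_right)
  qed
qed

theorem polys_over_factorial: "factorial_set (polys_over A)"
proof -
  interpret P: set_domain "polys_over A" by (rule polys_over_domain)
  show ?thesis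
  proof
    fix f assume f: "f \<in> polys_over A" "f \<noteq> 0"
    obtain n where "prime_product A n (lead_coeff f)"
      using factorization[of "lead_coeff f"] f by (auto simp: polys_over_def)
    then obtain m c g where cg: "prime_product A m c" "g \<in> polys_over A" "primitive_over A g" "f = [:c:] * g"
      using content_removal[OF f(1)] by blast
    moreover have "g \<noteq> 0" using cg f by auto
    ultimately show "\<exists>n. prime_product (polys_over A) n f"
      using primitive_factorization P.prime_product_mult prime_product_const by metis
  qed
qed

end

subsection \<open>Isomorphic images and localizations\<close>

text \<open>Meant for evaluation of polynomials at a monomial, which respects the ring structure
  everywhere but is injective only when the coefficients are restricted to \<open>A\<close>.\<close>

lemma (in factorial_set) image_factorial:
  fixes h :: "'a \<Rightarrow> 'b::comm_ring_1"
  assumes add: "\<And>a b. a \<in> A \<Longrightarrow> b \<in> A \<Longrightarrow> h (a + b) = h a + h b"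
    and times: "\<And>a b. a \<in> A \<Longrightarrow> b \<in> A \<Longrightarrow> h (a * b) = h a * h b"
    and one: "h 1 = 1" and inj: "\<And>a. a \<in> A \<Longrightarrow> h a = 0 \<Longrightarrow> a = 0"
  shows "factorial_set (h ` A)"
proof -
  have h0: "h 0 = 0" using add[OF zero_mem zero_mem] by simp
  have hm: "h (- a) = - h a" if "a \<in> A" for a
    using add[OF that minus_mem[OF that]] h0 by (simp add: minus_unique)
  have hinj: "a = b" if "a \<in> A" "b \<in> A" "h a = h b" for a b
    using inj[of "a - b"] that add[OF that(1) minus_mem[OF that(2)]] hm[of b] diff_mem by simp
  have dvd: "dvd_in (h ` A) (h a) (h b) \<longleftrightarrow> dvd_in A a b" if "a \<in> A" "b \<in> A" for a b
  proof
    assume "dvd_in (h ` A) (h a) (h b)"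
    then obtain c where "c \<in> A" "h b = h a * h c" by (auto simp: dvd_in_def)
    thus "dvd_in A a b" unfolding dvd_in_def using hinj times that mult_mem by metis
  qed (use times that in \<open>auto simp: dvd_in_def\<close>)
  have dom: "set_domain (h ` A)"
  proof
    show "0 \<in> h ` A" using h0 zero_mem by (intro image_eqI[of _ _ 0]) auto
    show "1 \<in> h ` A" using one one_mem by (intro image_eqI[of _ _ 1]) auto
    fix x y assume xy: "x \<in> h ` A" "y \<in> h ` A"
    then obtain a b where ab: "a \<in> A" "b \<in> A" "x = h a" "y = h b" by blast
    show "x + y \<in> h ` A" using ab add add_mem by (intro image_eqI[of _ _ "a + b"]) auto
    show "x * y \<in> h ` A" using ab times mult_mem by (intro image_eqI[of _ _ "a * b"]) auto
    show "- x \<in> h ` A" using ab hm minus_mem by (intro image_eqI[of _ _ "- a"]) auto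
    assume "x * y = 0"
    hence "h (a * b) = 0" using times ab by simp
    hence "a = 0 \<or> b = 0" using inj no_zero_divisors mult_mem ab by blast
    thus "x = 0 \<or> y = 0" using ab h0 by auto
  qed
  have prime: "prime_in (h ` A) (h p)" if "prime_in A p" for p
  proof -
    note pD = prime_inD[OF that]
    have "\<not> dvd_in (h ` A) (h p) 1" using dvd[OF pD(1) one_mem] one pD(3) by simp
    moreover have "h p \<noteq> 0" using inj pD by auto
    moreover have "dvd_in (h ` A) (h p) (h a) \<or> dvd_in (h ` A) (h p) (h b)"
      if "a \<in> A" "b \<in> A" "dvd_in (h ` A) (h p) (h a * h b)" for a b
      using that pD dvd times mult_mem by metis
    ultimately show ?thesis using pD(1) by (auto simp: prime_in_def)
  qed
  have pp: "prime_product (h ` A) n (h a)" if "prime_product A n a" for n a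
    using that
  proof (induction rule: prime_product.induct)
    case (unit u)
    thus ?case using dvd[OF unit(1) one_mem] one by (intro prime_product.unit) auto
  next
    case (mult p n a)
    thus ?case using prime_product.mult[OF prime[OF mult(1)] mult(3)] times
        prime_inD[OF mult(1)] prime_product_mem[OF mult(2)] by simp
  qed
  interpret H: set_domain "h ` A" by (rule dom)
  show ?thesis
  proof
    fix x assume x: "x \<in> h ` A" "x \<noteq> 0"
    then obtain a where "a \<in> A" "x = h a" by blast
    thus "\<exists>n. prime_product (h ` A) n x" using factorization[of a] pp h0 x by auto
  qed
qed

text \<open>A prime of \<open>A\<close> either becomes a unit or stays prime, so factorizations
  survive, possibly with fewer primes. As \<open>t\<close> is already invertible in the ambient
  type, the localization is a subset of that same type.\<close>

lemma (in factorial_set) localization_factorial: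
  fixes t s :: 'a
  assumes t: "t \<in> A" and s: "s * t = 1"
  shows "factorial_set {a. \<exists>k. t ^ k * a \<in> A}"
proof -
  define L where "L = {a. \<exists>k. t ^ k * a \<in> A}"
  have st: "s ^ k * t ^ k = 1" for k using s by (metis power_mult_distrib power_one)
  have up: "t ^ j * a \<in> A" if "t ^ k * a \<in> A" "k \<le> j" for a j k
    using mult_mem[OF power_mem[OF t, of "j - k"] that(1)] that(2)
    by (metis le_add_diff_inverse2 mult.assoc power_add)
  have AL: "A \<subseteq> L" unfolding L_def by (auto intro!: exI[of _ 0])
  have unscale: "a = s ^ k * (t ^ k * a)" for a k by (metis st mult.assoc mult_1)
  have nz: "t ^ k * a \<noteq> 0" if "a \<noteq> 0" for a k using that by (metis unscale mult_zero_right)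
  have dom: "set_domain L"
  proof
    show "0 \<in> L" using AL zero_mem by blast
    show "1 \<in> L" using AL one_mem by blast
    fix a b assume "a \<in> L" "b \<in> L"
    then obtain i j where ij: "t ^ i * a \<in> A" "t ^ j * b \<in> A" by (auto simp: L_def)
    have "t ^ (i + j) * (a * b) = (t ^ i * a) * (t ^ j * b)" by (simp add: power_add algebra_simps)
    thus "a * b \<in> L" using mult_mem[OF ij] unfolding L_def by (metis (mono_tags) mem_Collect_eq)
    have "t ^ max i j * (a + b) = t ^ max i j * a + t ^ max i j * b" by (simp add: algebra_simps)
    thus "a + b \<in> L" using add_mem[OF up[OF ij(1), of "max i j"] up[OF ij(2), of "max i j"]]
      unfolding L_def by (metis (mono_tags) mem_Collect_eq max.cobounded1 max.cobounded2)
    have "t ^ i * (- a) \<in> A" using minus_mem[OF ij(1)] by simp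
    thus "- a \<in> L" unfolding L_def by blast
    assume "a * b = 0"
    hence "(t ^ i * a) * (t ^ j * b) = 0" by (metis mult.commute mult.left_commute mult_zero_left)
    hence "t ^ i * a = 0 \<or> t ^ j * b = 0" using no_zero_divisors ij by blast
    thus "a = 0 \<or> b = 0" using nz by blast
  qed
  interpret L: set_domain L by (rule dom)
  have ts: "t ^ k * s ^ k = 1" for k by (metis st mult.commute)
  have sL: "s ^ k \<in> L" for k unfolding L_def using ts one_mem by (intro CollectI exI[of _ k]) simp
  have dvdL: "dvd_in L p a" if d: "dvd_in A p (t ^ k * a)" for p a k
  proof -
    obtain c where c: "c \<in> A" "t ^ k * a = p * c" using d by (auto simp: dvd_in_def)
    have "a = s ^ k * (p * c)" by (metis unscale c(2))
    also have "\<dots> = p * (s ^ k * c)" by (rule mult.left_commute)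
    finally have "a = p * (s ^ k * c)" .
    moreover have "s ^ k * c \<in> L" using c AL sL L.mult_mem by blast
    ultimately show ?thesis unfolding dvd_in_def by blast
  qed
  have prime: "prime_in L p" if p: "prime_in A p" "\<not> dvd_in L p 1" for p
  proof -
    note pD = prime_inD[OF p(1)]
    have pt: "\<not> dvd_in A p (t ^ k)" for k using dvdL[of p k 1] p(2) by auto
    have "dvd_in L p a \<or> dvd_in L p b" if ab: "a \<in> L" "b \<in> L" "dvd_in L p (a * b)" for a b
    proof -
      obtain c where c: "c \<in> L" "a * b = p * c" using ab by (auto simp: dvd_in_def)
      obtain i j k where ijk: "t ^ i * a \<in> A" "t ^ j * b \<in> A" "t ^ k * c \<in> A"
        using ab c by (auto simp: L_def)
      have "t ^ k * ((t ^ i * a) * (t ^ j * b)) = t ^ k * t ^ i * t ^ j * (a * b)" by (simp add: algebra_simps)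
      also have "\<dots> = p * (t ^ i * t ^ j * (t ^ k * c))" using c(2) by (simp add: algebra_simps)
      finally have "dvd_in A p (t ^ k * ((t ^ i * a) * (t ^ j * b)))"
        using ijk mult_mem power_mem[OF t] unfolding dvd_in_def by blast
      hence "dvd_in A p (t ^ i * a) \<or> dvd_in A p (t ^ j * b)"
        using pD(4) pt ijk mult_mem power_mem[OF t] by metis
      thus ?thesis using dvdL by blast
    qed
    thus ?thesis using pD AL p(2) by (auto simp: prime_in_def)
  qed
  have pp: "\<exists>m. prime_product L m a" if "prime_product A n a" for n a
    using that
  proof (induction rule: prime_product.induct)
    case (unit u)
    hence "u \<in> L" "dvd_in L u 1" using AL by (auto simp: dvd_in_def)
    thus ?case using prime_product.unit by blast
  next
    case (mult p n a)
    then obtain m where m: "prime_product L m a" by blast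
    show ?case
    proof (cases "dvd_in L p 1")
      case True
      thus ?thesis using L.prime_product_unit_mult[OF m] prime_inD[OF mult(1)] AL by blast
    next
      case False
      thus ?thesis using prime[OF mult(1)] m prime_product.mult by blast
    qed
  qed
  have "factorial_set L"
  proof
    fix a assume a: "a \<in> L" "a \<noteq> 0"
    then obtain k where k: "t ^ k * a \<in> A" by (auto simp: L_def)
    then obtain m where m: "prime_product L m (t ^ k * a)" using factorization nz[OF a(2)] pp by metis
    have tL: "t ^ k \<in> L" using power_mem[OF t] AL by blast
    have "dvd_in L (s ^ k) 1" unfolding dvd_in_def using tL st by metis
    from L.prime_product_unit_mult[OF m sL this] show "\<exists>n. prime_product L n a" by (metis unscale)
  qed
  thus ?thesis by (simp add: L_def)
qed

section \<open>Group algebras of lattices\<close>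

definition supported_in :: "'m set \<Rightarrow> ('m \<Rightarrow>\<^sub>0 'f::zero) set" where
  "supported_in S = {p. Poly_Mapping.keys p \<subseteq> S}"

definition integer_span :: "'v::real_vector set \<Rightarrow> 'v set" where
  "integer_span E = {\<Sum>e\<in>E. of_int (c e) *\<^sub>R e | c. True}"

lemma poly_mapping_sum_singles:
  "p = (\<Sum>k\<in>Poly_Mapping.keys p. Poly_Mapping.single k (Poly_Mapping.lookup p k))"
  by (rule poly_mapping_eqI)
    (simp add: lookup_sum lookup_single when_def in_keys_iff)

lemma lookup_single_mult:
  fixes p :: "'m::ab_group_add \<Rightarrow>\<^sub>0 'f::comm_semiring_1"
  shows "Poly_Mapping.lookup (p * Poly_Mapping.single m c) k = Poly_Mapping.lookup p (k - m) * c"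
proof -
  have "p * Poly_Mapping.single m c =
      (\<Sum>l\<in>Poly_Mapping.keys p. Poly_Mapping.single (l + m) (Poly_Mapping.lookup p l * c))"
    by (subst (1) poly_mapping_sum_singles[of p]) (simp only: sum_distrib_right mult_single)
  also have "Poly_Mapping.lookup \<dots> k = (\<Sum>l\<in>Poly_Mapping.keys p.
      if l = k - m then Poly_Mapping.lookup p l * c else 0)"
    unfolding lookup_sum lookup_single when_def by (intro sum.cong refl) (auto simp: algebra_simps)
  also have "\<dots> = Poly_Mapping.lookup p (k - m) * c"
    by (simp add: in_keys_iff)
  finally show ?thesis .
qed

lemma keys_single_mult:
  fixes p :: "'m::ab_group_add \<Rightarrow>\<^sub>0 'f::comm_semiring_1"
  shows "k \<in> Poly_Mapping.keys (p * Poly_Mapping.single m 1) \<longleftrightarrow> k - m \<in> Poly_Mapping.keys p"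
  by (simp add: in_keys_iff lookup_single_mult)

lemma single_power:
  "Poly_Mapping.single (m::'v::real_vector) (1::'f::comm_semiring_1) ^ n = Poly_Mapping.single (of_nat n *\<^sub>R m) 1"
  by (induction n) (simp_all add: mult_single algebra_simps)

lemma zero_in_integer_span: "0 \<in> integer_span E"
  unfolding integer_span_def by (auto intro!: exI[of _ "\<lambda>_. 0"])

lemma add_in_integer_span: "a \<in> integer_span E \<Longrightarrow> b \<in> integer_span E \<Longrightarrow> a + b \<in> integer_span E"
proof -
  assume "a \<in> integer_span E" "b \<in> integer_span E"
  then obtain c d where "a = (\<Sum>e\<in>E. of_int (c e) *\<^sub>R e)" "b = (\<Sum>e\<in>E. of_int (d e) *\<^sub>R e)"
    by (auto simp: integer_span_def)
  hence "a + b = (\<Sum>e\<in>E. of_int (c e + d e) *\<^sub>R e)"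
    by (simp add: scaleR_left_distrib sum.distrib)
  thus ?thesis unfolding integer_span_def by (intro CollectI exI[of _ "\<lambda>e. c e + d e"]) simp
qed

lemma minus_in_integer_span: "a \<in> integer_span E \<Longrightarrow> - a \<in> integer_span E"
proof -
  assume "a \<in> integer_span E"
  then obtain c where "a = (\<Sum>e\<in>E. of_int (c e) *\<^sub>R e)" by (auto simp: integer_span_def)
  hence "- a = (\<Sum>e\<in>E. of_int (- c e) *\<^sub>R e)" by (simp add: sum_negf)
  thus ?thesis unfolding integer_span_def by (intro CollectI exI[of _ "\<lambda>e. - c e"]) simp
qed

lemma diff_in_integer_span: "a \<in> integer_span E \<Longrightarrow> b \<in> integer_span E \<Longrightarrow> a - b \<in> integer_span E"
  using add_in_integer_span minus_in_integer_span by (metis uminus_add_conv_diff add.commute)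

lemma integer_span_subset_span: "integer_span E \<subseteq> span E"
  unfolding integer_span_def by (auto intro!: span_sum intro: span_scale span_base)

lemma integer_span_insert:
  assumes "finite E" "e \<notin> E"
  shows "integer_span (insert e E) = {g + of_int n *\<^sub>R e | g n. g \<in> integer_span E}"
proof (intro equalityI subsetI)
  fix x assume "x \<in> integer_span (insert e E)"
  then obtain c where "x = (\<Sum>a\<in>insert e E. of_int (c a) *\<^sub>R a)" by (auto simp: integer_span_def)
  hence "x = (\<Sum>a\<in>E. of_int (c a) *\<^sub>R a) + of_int (c e) *\<^sub>R e" using assms by (simp add: add.commute)
  thus "x \<in> {g + of_int n *\<^sub>R e | g n. g \<in> integer_span E}" unfolding integer_span_def by blast
next
  fix x assume "x \<in> {g + of_int n *\<^sub>R e | g n. g \<in> integer_span E}"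
  then obtain c n where "x = (\<Sum>a\<in>E. of_int (c a) *\<^sub>R a) + of_int n *\<^sub>R e"
    by (auto simp: integer_span_def)
  also have "(\<Sum>a\<in>E. of_int (c a) *\<^sub>R a) = (\<Sum>a\<in>E. of_int ((c(e := n)) a) *\<^sub>R a)"
    using assms by (intro sum.cong) auto
  finally have "x = (\<Sum>a\<in>insert e E. of_int ((c(e := n)) a) *\<^sub>R a)"
    using assms by (simp add: add.commute)
  thus "x \<in> integer_span (insert e E)" unfolding integer_span_def by blast
qed

lemma supported_in_add: "p \<in> supported_in S \<Longrightarrow> q \<in> supported_in S \<Longrightarrow> p + q \<in> supported_in S"
  unfolding supported_in_def using keys_add[of p q] by blast

lemma supported_in_minus:
  fixes p :: "'m \<Rightarrow>\<^sub>0 'f::ab_group_add"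
  shows "p \<in> supported_in S \<Longrightarrow> - p \<in> supported_in S"
  unfolding supported_in_def by (auto simp: in_keys_iff)

lemma supported_in_zero: "0 \<in> supported_in S"
  by (simp add: supported_in_def)

lemma supported_in_mult:
  fixes p q :: "'m::comm_monoid_add \<Rightarrow>\<^sub>0 'f::comm_semiring_1"
  assumes "p \<in> supported_in S" "q \<in> supported_in S"
    and "\<And>a b. a \<in> S \<Longrightarrow> b \<in> S \<Longrightarrow> a + b \<in> S"
  shows "p * q \<in> supported_in S"
  unfolding supported_in_def
proof (intro CollectI subsetI)
  fix k assume "k \<in> Poly_Mapping.keys (p * q)"
  then obtain a b where "k = a + b" "a \<in> Poly_Mapping.keys p" "b \<in> Poly_Mapping.keys q"
    using keys_mult[of p q] by blast
  thus "k \<in> S" using assms by (auto simp: supported_in_def)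
qed

lemma supported_in_single: "m \<in> S \<Longrightarrow> Poly_Mapping.single m c \<in> supported_in S"
  by (simp add: supported_in_def)

lemma constants_factorial:
  "factorial_set (supported_in {0} :: ('m::comm_monoid_add \<Rightarrow>\<^sub>0 'f::field) set)"
proof -
  let ?A = "supported_in {0} :: ('m \<Rightarrow>\<^sub>0 'f) set"
  have A: "p \<in> ?A \<longleftrightarrow> (\<exists>c. p = Poly_Mapping.single 0 c)" for p
  proof
    assume p: "p \<in> ?A"
    have "p = Poly_Mapping.single 0 (Poly_Mapping.lookup p 0)"
      by (rule poly_mapping_eqI) (use p in \<open>auto simp: lookup_single when_def supported_in_def in_keys_iff subset_iff\<close>)
    thus "\<exists>c. p = Poly_Mapping.single 0 c" by blast
  qed (auto simp: supported_in_def split: if_splits)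
  have dom: "set_domain ?A"
  proof
    show "1 \<in> ?A" by (simp add: supported_in_def)
    fix a b assume ab: "a \<in> ?A" "b \<in> ?A"
    show "a * b \<in> ?A" by (rule supported_in_mult[OF ab]) simp
    obtain c d where "a = Poly_Mapping.single 0 c" "b = Poly_Mapping.single 0 d" using ab A by blast
    moreover assume "a * b = 0"
    ultimately show "a = 0 \<or> b = 0"
      by (metis mult_single no_zero_divisors lookup_single_eq lookup_zero single_zero add_0)
  qed (auto simp: supported_in_zero supported_in_add supported_in_minus)
  interpret set_domain ?A by (rule dom)
  show ?thesis
  proof
    fix a assume a: "a \<in> ?A" "a \<noteq> 0"
    then obtain c where c: "a = Poly_Mapping.single 0 c" using A by blast
    have "c \<noteq> 0" using a(2) c by auto
    with c have "1 = a * Poly_Mapping.single 0 (inverse c)" by (simp add: mult_single)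
    hence "dvd_in ?A a 1" unfolding dvd_in_def using A by blast
    thus "\<exists>n. prime_product ?A n a" using prime_product.unit a by blast
  qed
qed

text \<open>One basis vector at a time: with \<open>A\<close> the algebra of
  \<open>integer_span E\<close> and \<open>x\<close> the monomial of \<open>e\<close>, the enlarged
  lattice has the Laurent polynomial ring over \<open>A\<close> in \<open>x\<close>, which is the
  image of the polynomials under evaluation at \<open>x\<close>, localized at
  \<open>x\<close>.\<close>

theorem integer_span_algebra_factorial:
  fixes E :: "'m::real_vector set"
  assumes "finite E" "independent E"
  shows "factorial_set (supported_in (integer_span E) :: ('m \<Rightarrow>\<^sub>0 'f::field) set)"
  using assms
proof (induction E rule: finite_induct)
  case empty
  have "integer_span {} = {0::'m}" by (auto simp: integer_span_def)
  thus ?case using constants_factorial by simp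
next
  case (insert e E)
  let ?G = "integer_span E" and ?G' = "integer_span (insert e E)"
  let ?A = "supported_in ?G :: ('m \<Rightarrow>\<^sub>0 'f) set"
  have "independent E" using insert.prems by (simp add: independent_insert split: if_splits)
  then interpret A: factorial_set ?A using insert.IH by blast
  interpret P: factorial_set "polys_over ?A" by (rule A.polys_over_factorial)
  define x where "x = Poly_Mapping.single e (1::'f)"
  define s where "s = Poly_Mapping.single (- e) (1::'f)"
  define h where "h = (\<lambda>p. poly p x)"
  have e: "e \<notin> span E" using insert by (simp add: independent_insert)
  have G': "?G' = {g + of_int n *\<^sub>R e | g n. g \<in> ?G}" by (rule integer_span_insert) fact+
  have look: "Poly_Mapping.lookup (h p) k =
      (\<Sum>i\<le>degree p. Poly_Mapping.lookup (coeff p i) (k - of_nat i *\<^sub>R e))" for p k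
    unfolding h_def poly_altdef lookup_sum by (simp add: x_def single_power lookup_single_mult)
  have inj: "p = 0" if p: "p \<in> polys_over ?A" "h p = 0" for p
  proof (rule poly_eqI)
    fix j
    show "coeff p j = coeff 0 j"
    proof (cases "j \<le> degree p")
      case True
      have "coeff p j = 0"
      proof (rule poly_mapping_eqI)
        fix g
        show "Poly_Mapping.lookup (coeff p j) g = Poly_Mapping.lookup 0 g"
        proof (cases "g \<in> ?G")
          case gG: True
          \<comment> \<open>Coefficients of different powers of \<open>x\<close> contribute disjoint
            sets of exponents: a common one would put a nonzero multiple of \<open>e\<close> into
            \<open>span E\<close>.\<close>
          have "Poly_Mapping.lookup (coeff p i) (g + of_nat j *\<^sub>R e - of_nat i *\<^sub>R e) = 0"
            if "i \<noteq> j" for i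
          proof (rule ccontr)
            assume "\<not> ?thesis"
            hence "g + of_nat j *\<^sub>R e - of_nat i *\<^sub>R e \<in> ?G"
              using p(1) by (auto simp: polys_over_def supported_in_def in_keys_iff subset_iff)
            hence "g + of_nat j *\<^sub>R e - of_nat i *\<^sub>R e - g \<in> span E"
              using gG integer_span_subset_span span_diff by blast
            hence "(real j - real i) *\<^sub>R e \<in> span E" by (simp add: algebra_simps)
            hence "(1 / (real j - real i)) *\<^sub>R ((real j - real i) *\<^sub>R e) \<in> span E" by (rule span_scale)
            thus False using e that by simp
          qed
          hence "(\<Sum>i\<le>degree p. Poly_Mapping.lookup (coeff p i) (g + of_nat j *\<^sub>R e - of_nat i *\<^sub>R e))
              = (\<Sum>i\<in>{j}. Poly_Mapping.lookup (coeff p i) (g + of_nat j *\<^sub>R e - of_nat i *\<^sub>R e))"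
            using True by (intro sum.mono_neutral_right) auto
          thus ?thesis using look[of p "g + of_nat j *\<^sub>R e"] p(2) by simp
        next
          case False
          thus ?thesis using p(1) by (auto simp: polys_over_def supported_in_def in_keys_iff subset_iff)
        qed
      qed
      thus ?thesis by simp
    qed (simp add: coeff_eq_0)
  qed
  have fact: "factorial_set (h ` polys_over ?A)"
    by (rule P.image_factorial) (use inj in \<open>auto simp: h_def\<close>)
  interpret B: factorial_set "h ` polys_over ?A" by (rule fact)
  have xB: "x \<in> h ` polys_over ?A"
    using A.monom_polys_over[OF A.one_mem, of 1]
    by (intro image_eqI[of _ _ "monom 1 1"]) (auto simp: h_def poly_monom)
  have "s * x = 1" by (simp add: s_def x_def mult_single)
  note loc = B.localization_factorial[OF xB this]
  have "{a. \<exists>k. x ^ k * a \<in> h ` polys_over ?A} = supported_in ?G'"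
  proof (intro equalityI subsetI)
    fix a assume "a \<in> {a. \<exists>k. x ^ k * a \<in> h ` polys_over ?A}"
    then obtain k p where p: "p \<in> polys_over ?A" "x ^ k * a = h p" by auto
    show "a \<in> supported_in ?G'" unfolding supported_in_def
    proof (intro CollectI subsetI)
      fix l assume "l \<in> Poly_Mapping.keys a"
      hence "l + of_nat k *\<^sub>R e \<in> Poly_Mapping.keys (a * x ^ k)"
        by (simp add: x_def single_power keys_single_mult)
      hence "Poly_Mapping.lookup (h p) (l + of_nat k *\<^sub>R e) \<noteq> 0"
        using p(2) by (simp add: mult.commute in_keys_iff)
      then obtain i where "Poly_Mapping.lookup (coeff p i) (l + of_nat k *\<^sub>R e - of_nat i *\<^sub>R e) \<noteq> 0"
        unfolding look by (meson sum.neutral)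
      hence g: "l + of_nat k *\<^sub>R e - of_nat i *\<^sub>R e \<in> ?G"
        using p(1) by (auto simp: polys_over_def supported_in_def in_keys_iff subset_iff)
      have "l = (l + of_nat k *\<^sub>R e - of_nat i *\<^sub>R e) + of_int (int i - int k) *\<^sub>R e"
        by (simp add: algebra_simps)
      thus "l \<in> ?G'" using g unfolding G' by blast
    qed
  next
    fix a :: "'m \<Rightarrow>\<^sub>0 'f" assume a: "a \<in> supported_in ?G'"
    have "\<exists>g n. l = g + of_int n *\<^sub>R e \<and> g \<in> ?G" if "l \<in> Poly_Mapping.keys a" for l
      using a that unfolding supported_in_def G' by blast
    then obtain g n where gn: "\<And>l. l \<in> Poly_Mapping.keys a \<Longrightarrow> l = g l + of_int (n l) *\<^sub>R e \<and> g l \<in> ?G"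
      by metis
    \<comment> \<open>Large enough that no exponent of \<open>x ^ k * a\<close> has a negative
      coefficient at \<open>e\<close>.\<close>
    define k where "k = (\<Sum>l\<in>Poly_Mapping.keys a. nat \<bar>n l\<bar>)"
    have "x ^ k * a = (\<Sum>l\<in>Poly_Mapping.keys a.
        Poly_Mapping.single (of_nat k *\<^sub>R e + l) (Poly_Mapping.lookup a l))"
      by (subst (1) poly_mapping_sum_singles[of a])
        (simp add: sum_distrib_left x_def single_power mult_single)
    also have "\<dots> \<in> h ` polys_over ?A"
    proof (rule B.sum_mem)
      fix l assume l: "l \<in> Poly_Mapping.keys a"
      have "nat \<bar>n l\<bar> \<le> k" unfolding k_def by (rule member_le_sum) (use l in auto)
      hence "0 \<le> int k + n l" by linarith
      then obtain j where j: "int j = int k + n l" by (metis nonneg_int_cases)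
      let ?c = "Poly_Mapping.single (g l) (Poly_Mapping.lookup a l)"
      have "h (monom ?c j) = Poly_Mapping.single (g l + of_nat j *\<^sub>R e) (Poly_Mapping.lookup a l)"
        by (simp add: h_def poly_monom x_def single_power mult_single)
      also have "g l + of_nat j *\<^sub>R e = of_nat k *\<^sub>R e + l"
      proof -
        have "real j = real k + of_int (n l)" using j by (metis of_int_add of_int_of_nat_eq)
        hence "g l + of_nat j *\<^sub>R e = of_nat k *\<^sub>R e + (g l + of_int (n l) *\<^sub>R e)"
          by (simp add: algebra_simps)
        thus ?thesis using gn[OF l] by simp
      qed
      finally have "h (monom ?c j) = Poly_Mapping.single (of_nat k *\<^sub>R e + l) (Poly_Mapping.lookup a l)" .
      moreover have "monom ?c j \<in> polys_over ?A"
        using gn[OF l] by (intro A.monom_polys_over supported_in_single) auto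
      ultimately show "Poly_Mapping.single (of_nat k *\<^sub>R e + l) (Poly_Mapping.lookup a l) \<in> h ` polys_over ?A"
        by (metis imageI)
    qed
    finally show "a \<in> {a. \<exists>k. x ^ k * a \<in> h ` polys_over ?A}" by blast
  qed
  thus ?case using loc by simp
qed

section \<open>Orders of vanishing along additive functions\<close>

text \<open>For \<open>f = 0\<close> this is \<open>Min {}\<close>, about which nothing is claimed;
  statements about the order assume a nonzero element or an exponent of it.\<close>

definition order_along :: "('m \<Rightarrow> int) \<Rightarrow> ('m \<Rightarrow>\<^sub>0 'f::zero) \<Rightarrow> int" where
  "order_along lam f = Min (lam ` Poly_Mapping.keys f)"

lemma order_along_le: "k \<in> Poly_Mapping.keys f \<Longrightarrow> order_along lam f \<le> lam k"
  unfolding order_along_def by (intro Min_le) auto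

lemma order_along_attained:
  assumes "f \<noteq> 0"
  obtains k where "k \<in> Poly_Mapping.keys f" "lam k = order_along lam f"
proof -
  have "order_along lam f \<in> lam ` Poly_Mapping.keys f"
    unfolding order_along_def using assms by (intro Min_in) auto
  thus ?thesis using that by auto
qed

lemma order_along_ge_iff:
  assumes "f \<noteq> 0"
  shows "n \<le> order_along lam f \<longleftrightarrow> (\<forall>k\<in>Poly_Mapping.keys f. n \<le> lam k)"
  using order_along_le order_along_attained[OF assms] by (metis order_trans)

lemma order_along_single: "c \<noteq> 0 \<Longrightarrow> order_along lam (Poly_Mapping.single m c) = lam m"
  by (simp add: order_along_def)

definition part_of :: "('m \<Rightarrow> bool) \<Rightarrow> ('m \<Rightarrow>\<^sub>0 'f::comm_monoid_add) \<Rightarrow> ('m \<Rightarrow>\<^sub>0 'f)" where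
  "part_of Q f = (\<Sum>k\<in>{k \<in> Poly_Mapping.keys f. Q k}. Poly_Mapping.single k (Poly_Mapping.lookup f k))"

lemma lookup_part_of: "Poly_Mapping.lookup (part_of Q f) k = (if Q k then Poly_Mapping.lookup f k else 0)"
  unfolding part_of_def lookup_sum lookup_single when_def
  by (auto simp: in_keys_iff)

lemma keys_part_of: "Poly_Mapping.keys (part_of Q f) = {k \<in> Poly_Mapping.keys f. Q k}"
  by (auto simp: in_keys_iff lookup_part_of split: if_splits)

lemma part_of_split: "f = part_of Q f + part_of (\<lambda>k. \<not> Q k) f"
  by (rule poly_mapping_eqI) (simp add: lookup_add lookup_part_of)

text \<open>The product of the lowest homogeneous parts is the lowest homogeneous part of the product;
  it does not vanish because the group algebra is a domain.\<close>

lemma order_along_mult: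
  fixes f g :: "'m::real_vector \<Rightarrow>\<^sub>0 'f::field"
  assumes dom: "set_domain (supported_in M :: ('m \<Rightarrow>\<^sub>0 'f) set)"
    and add: "\<And>a b. a \<in> M \<Longrightarrow> b \<in> M \<Longrightarrow> lam (a + b) = lam a + lam b"
    and fg: "f \<in> supported_in M" "g \<in> supported_in M" "f \<noteq> 0" "g \<noteq> 0"
  shows "order_along lam (f * g) = order_along lam f + order_along lam g"
proof -
  interpret set_domain "supported_in M :: ('m \<Rightarrow>\<^sub>0 'f) set" by (rule dom)
  define a b where "a = order_along lam f" and "b = order_along lam g"
  define f0 f1 where "f0 = part_of (\<lambda>k. lam k = a) f" and "f1 = part_of (\<lambda>k. lam k \<noteq> a) f"
  define g0 g1 where "g0 = part_of (\<lambda>k. lam k = b) g" and "g1 = part_of (\<lambda>k. lam k \<noteq> b) g"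
  have f: "f = f0 + f1" and g: "g = g0 + g1"
    unfolding f0_def f1_def g0_def g1_def by (rule part_of_split)+
  have kf: "k \<in> M" "a \<le> lam k" if "k \<in> Poly_Mapping.keys f" for k
    using that fg order_along_le[OF that] by (auto simp: supported_in_def a_def)
  have kg: "k \<in> M" "b \<le> lam k" if "k \<in> Poly_Mapping.keys g" for k
    using that fg order_along_le[OF that] by (auto simp: supported_in_def b_def)
  have nz: "f * g \<noteq> 0" using no_zero_divisors fg by blast
  obtain kf0 where "kf0 \<in> Poly_Mapping.keys f" "lam kf0 = a" using order_along_attained[OF fg(3)] a_def by metis
  hence "kf0 \<in> Poly_Mapping.keys f0" by (simp add: f0_def keys_part_of)
  hence f0: "f0 \<noteq> 0" by auto
  obtain kg0 where "kg0 \<in> Poly_Mapping.keys g" "lam kg0 = b" using order_along_attained[OF fg(4)] b_def by metis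
  hence "kg0 \<in> Poly_Mapping.keys g0" by (simp add: g0_def keys_part_of)
  hence g0: "g0 \<noteq> 0" by auto
  have "f0 \<in> supported_in M" "g0 \<in> supported_in M"
    using fg by (auto simp: supported_in_def f0_def g0_def keys_part_of)
  hence "f0 * g0 \<noteq> 0" using no_zero_divisors f0 g0 by blast
  then obtain k where k: "k \<in> Poly_Mapping.keys (f0 * g0)" by (metis keys_eq_empty ex_in_conv)
  then obtain x y where xy: "k = x + y" "x \<in> Poly_Mapping.keys f0" "y \<in> Poly_Mapping.keys g0"
    using keys_mult[of f0 g0] by blast
  hence "x \<in> M" "y \<in> M" "lam x = a" "lam y = b"
    using kf kg by (auto simp: f0_def g0_def keys_part_of)
  hence lk: "lam k = a + b" using add xy by simp
  have "k \<notin> Poly_Mapping.keys (f1 * g)"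
  proof
    assume "k \<in> Poly_Mapping.keys (f1 * g)"
    then obtain x y where "k = x + y" "x \<in> Poly_Mapping.keys f1" "y \<in> Poly_Mapping.keys g"
      using keys_mult[of f1 g] by blast
    thus False using lk kf[of x] kg[of y] add[of x y] by (force simp: f1_def keys_part_of)
  qed
  moreover have "k \<notin> Poly_Mapping.keys (f0 * g1)"
  proof
    assume "k \<in> Poly_Mapping.keys (f0 * g1)"
    then obtain x y where "k = x + y" "x \<in> Poly_Mapping.keys f0" "y \<in> Poly_Mapping.keys g1"
      using keys_mult[of f0 g1] by blast
    thus False using lk kf[of x] kg[of y] add[of x y] by (force simp: f0_def g1_def keys_part_of)
  qed
  moreover have "f * g = f0 * g0 + f0 * g1 + f1 * g"     by (metis f g distrib_left distrib_right)
  ultimately have "k \<in> Poly_Mapping.keys (f * g)"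
    using k by (simp add: in_keys_iff lookup_add)
  hence le: "order_along lam (f * g) \<le> a + b" using order_along_le lk by metis
  have "a + b \<le> lam k" if kfg: "k \<in> Poly_Mapping.keys (f * g)" for k
  proof -
    obtain x y where "k = x + y" "x \<in> Poly_Mapping.keys f" "y \<in> Poly_Mapping.keys g"
      using kfg keys_mult[of f g] by blast
    thus ?thesis using kf[of x] kg[of y] add[of x y] by simp
  qed
  hence "a + b \<le> order_along lam (f * g)" using order_along_ge_iff[OF nz] by blast
  thus ?thesis using le by (simp add: a_def b_def)
qed

section \<open>Semigroup algebras and powers of ideals\<close>

lemma semigroup_generated_add:
  "x \<in> semigroup_generated G \<Longrightarrow> y \<in> semigroup_generated G \<Longrightarrow> x + y \<in> semigroup_generated G"
proof -
  assume "x \<in> semigroup_generated G" "y \<in> semigroup_generated G"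
  then obtain xs ys where "x = sum_list xs" "y = sum_list ys" "set xs \<subseteq> G" "set ys \<subseteq> G"
    by (auto simp: semigroup_generated_def)
  thus ?thesis unfolding semigroup_generated_def by (intro CollectI exI[of _ "xs @ ys"]) simp
qed

lemma semigroup_generated_base: "g \<in> G \<Longrightarrow> g \<in> semigroup_generated G"
  unfolding semigroup_generated_def by (intro CollectI exI[of _ "[g]"]) simp

lemma semigroup_generated_subset:
  assumes "G \<subseteq> semigroup_generated H"
  shows "semigroup_generated G \<subseteq> semigroup_generated H"
proof
  fix x assume "x \<in> semigroup_generated G"
  then obtain xs where xs: "x = sum_list xs" "set xs \<subseteq> G" by (auto simp: semigroup_generated_def)
  have "sum_list xs \<in> semigroup_generated H" using xs(2)
  proof (induction xs)
    case Nil
    show ?case unfolding semigroup_generated_def by (intro CollectI exI[of _ "[]"]) simp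
  next
    case (Cons a xs)
    thus ?case using assms semigroup_generated_add[of a H "sum_list xs"] by auto
  qed
  thus "x \<in> semigroup_generated H" using xs(1) by simp
qed

abbreviation X :: "'m \<Rightarrow> ('m \<Rightarrow>\<^sub>0 'f::field)" where
  "X m \<equiv> Poly_Mapping.single m 1"

text \<open>\<open>A\<close> repeats the carrier of \<open>R\<close> as a plain set: calculations
  use the ring operations of the type, and the record \<open>R\<close> appears only for notions
  stated for ring records, such as ideals and symbolic powers.\<close>

locale affine_semigroup =
  fixes S :: "'m::real_vector set" and R :: "('m \<Rightarrow>\<^sub>0 'f::field) ring" and A :: "('m \<Rightarrow>\<^sub>0 'f) set"
  assumes R_eq: "R = semigroup_algebra S" and A_eq: "A = supported_in S"
    and S_zero: "0 \<in> S" and S_add: "a \<in> S \<Longrightarrow> b \<in> S \<Longrightarrow> a + b \<in> S"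
begin

lemma R_simps [simp]: "carrier R = A" "x \<otimes>\<^bsub>R\<^esub> y = x * y" "x \<oplus>\<^bsub>R\<^esub> y = x + y" "\<one>\<^bsub>R\<^esub> = 1" "\<zero>\<^bsub>R\<^esub> = 0"
  by (auto simp: R_eq A_eq semigroup_algebra_def supported_in_def)

lemma A_closed [intro]:
  "0 \<in> A" "1 \<in> A" "p \<in> A \<Longrightarrow> q \<in> A \<Longrightarrow> p + q \<in> A" "p \<in> A \<Longrightarrow> - p \<in> A"
  "p \<in> A \<Longrightarrow> q \<in> A \<Longrightarrow> p * q \<in> A" "m \<in> S \<Longrightarrow> Poly_Mapping.single m c \<in> A"
proof -
  show "1 \<in> A" using S_zero by (simp add: A_eq supported_in_def)
qed (auto simp: A_eq supported_in_zero supported_in_add supported_in_minus supported_in_single S_add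
    intro!: supported_in_mult)

lemma A_power: "p \<in> A \<Longrightarrow> p ^ n \<in> A"
  by (induction n) auto

lemma A_keys: "p \<in> A \<Longrightarrow> k \<in> Poly_Mapping.keys p \<Longrightarrow> k \<in> S"
  by (auto simp: A_eq supported_in_def)

lemma cring_R: "cring R"
proof (rule cringI)
  show "abelian_group R"
  proof (rule abelian_groupI)
    fix x assume x: "x \<in> carrier R"
    show "\<exists>y\<in>carrier R. y \<oplus>\<^bsub>R\<^esub> x = \<zero>\<^bsub>R\<^esub>" using x by (intro bexI[of _ "- x"]) auto
  qed (auto simp: algebra_simps)
  show "comm_monoid R" by (rule comm_monoidI) (auto simp: algebra_simps)
qed (auto simp: algebra_simps)

lemma ideal_iff:
  "ideal P R \<longleftrightarrow> P \<subseteq> A \<and> 0 \<in> P \<and> (\<forall>x\<in>P. \<forall>y\<in>P. x + y \<in> P) \<and> (\<forall>a\<in>A. \<forall>x\<in>P. a * x \<in> P)"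
  (is "_ \<longleftrightarrow> ?rhs")
proof
  assume "ideal P R"
  then interpret ideal P R .
  show ?rhs
    using a_subset additive_subgroup.zero_closed[OF is_additive_subgroup]
      additive_subgroup.a_closed[OF is_additive_subgroup] I_l_closed by auto
next
  assume r: ?rhs
  interpret cring R by (rule cring_R)
  show "ideal P R"
  proof (rule idealI)
    show "ring R" by (rule ring_axioms)
    have minus: "- x \<in> P" if "x \<in> P" for x
    proof -
      have "(- 1) * x \<in> P" using r that A_closed by blast
      thus ?thesis by simp
    qed
    show "subgroup P (add_monoid R)"
    proof (rule add.subgroupI)
      fix x assume x: "x \<in> P"
      have "\<ominus>\<^bsub>R\<^esub> x = - x" using r x by (intro minus_equality) auto
      thus "\<ominus>\<^bsub>R\<^esub> x \<in> P" using minus x by simp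
    qed (use r in auto)
    fix a x assume ax: "a \<in> P" "x \<in> carrier R"
    show "x \<otimes>\<^bsub>R\<^esub> a \<in> P" using r ax by simp
    thus "a \<otimes>\<^bsub>R\<^esub> x \<in> P" by (simp add: mult.commute)
  qed
qed

lemma primeideal_iff:
  "primeideal P R \<longleftrightarrow> ideal P R \<and> 1 \<notin> P \<and> (\<forall>a\<in>A. \<forall>b\<in>A. a * b \<in> P \<longrightarrow> a \<in> P \<or> b \<in> P)"
  (is "_ \<longleftrightarrow> ?rhs")
proof
  assume "primeideal P R"
  then interpret primeideal P R .
  have "1 \<notin> P" using one_imp_carrier I_notcarr by auto
  thus ?rhs using is_ideal I_prime by auto
next
  assume r: ?rhs
  show "primeideal P R"
    by (rule primeidealI[OF _ cring_R]) (use r A_closed in auto)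
qed

lemma idealD:
  assumes "ideal P R"
  shows "P \<subseteq> A" "0 \<in> P" "\<And>x y. x \<in> P \<Longrightarrow> y \<in> P \<Longrightarrow> x + y \<in> P"
    "\<And>a x. a \<in> A \<Longrightarrow> x \<in> P \<Longrightarrow> a * x \<in> P"
  using assms by (auto simp: ideal_iff)

lemma ideal_sum:
  "ideal P R \<Longrightarrow> (\<And>i. i \<in> I \<Longrightarrow> f i \<in> P) \<Longrightarrow> sum f I \<in> P"
  by (induction I rule: infinite_finite_induct) (auto simp: ideal_iff)

text \<open>Constants belong to \<open>A\<close> because \<open>0 \<in> S\<close>, so each
  coefficient can be put back on its monomial inside the ideal.\<close>

lemma ideal_contains_by_keys:
  assumes "ideal P R" "\<And>k. k \<in> Poly_Mapping.keys f \<Longrightarrow> X k \<in> P"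
  shows "f \<in> P"
proof -
  have "Poly_Mapping.single k (Poly_Mapping.lookup f k) \<in> P" if "k \<in> Poly_Mapping.keys f" for k
  proof -
    have "Poly_Mapping.single 0 (Poly_Mapping.lookup f k) * X k \<in> P"
      using idealD(4)[OF assms(1)] assms(2)[OF that] S_zero by blast
    thus ?thesis by (simp add: mult_single)
  qed
  hence "(\<Sum>k\<in>Poly_Mapping.keys f. Poly_Mapping.single k (Poly_Mapping.lookup f k)) \<in> P"
    by (rule ideal_sum[OF assms(1)])
  thus ?thesis unfolding poly_mapping_sum_singles[of f, symmetric] .
qed

abbreviation ideal_pow :: "('m \<Rightarrow>\<^sub>0 'f) set \<Rightarrow> nat \<Rightarrow> ('m \<Rightarrow>\<^sub>0 'f) set" where
  "ideal_pow P n \<equiv> P [^]\<^bsub>ideals_set R\<^esub> n"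

lemma ideals_set_one [simp]: "\<one>\<^bsub>ideals_set R\<^esub> = A"
  by (simp add: ideals_set_def)

lemma ideals_set_mult [simp]: "I \<otimes>\<^bsub>ideals_set R\<^esub> J = ideal_prod R I J"
  by (simp add: ideals_set_def)

lemma ideal_pow_Suc: "ideal_pow P (Suc n) = ideal_prod R (ideal_pow P n) P"
  by (simp add: ideals_set_def nat_pow_def)

lemma ideal_pow_ideal: "ideal P R \<Longrightarrow> ideal (ideal_pow P n) R"
proof (induction n)
  case 0
  show ?case using ring.oneideal[of R] cring_R by (simp add: cring_def)
next
  case (Suc n)
  thus ?case unfolding ideal_pow_Suc using ring.ideal_prod_is_ideal cring_R by (metis cring_def)
qed

lemma ideal_pow_mult: "x \<in> ideal_pow P n \<Longrightarrow> y \<in> P \<Longrightarrow> x * y \<in> ideal_pow P (Suc n)"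
  unfolding ideal_pow_Suc using ideal_prod.prod[of x "ideal_pow P n" y P R] by simp

lemma power_in_ideal_pow: "y \<in> P \<Longrightarrow> y ^ n \<in> ideal_pow P n"
proof (induction n)
  case 0
  show ?case by auto
next
  case (Suc n)
  thus ?case using ideal_pow_mult[of "y ^ n" P n y] by (simp add: mult.commute)
qed

lemma ideal_pow_antimono:
  assumes "ideal P R" "m \<le> n"
  shows "ideal_pow P n \<subseteq> ideal_pow P m"
  using assms(2)
proof (induction n rule: dec_induct)
  case (step n)
  have "ideal_pow P (Suc n) \<subseteq> ideal_pow P n"
    unfolding ideal_pow_Suc
    using ring.ideal_prod_inter[OF _ ideal_pow_ideal[OF assms(1)] assms(1)] cring_R
    by (auto simp: cring_def)
  thus ?case using step by blast
qed auto

text \<open>Upper bounds for powers of \<open>P\<close> come from a filtration \<open>K\<close>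
  whose level rises by one under multiplication by an element of \<open>P\<close>. It is applied to
  the orders along additive functions and to the powers of a prime element.\<close>

lemma ideal_pow_subset:
  assumes "A \<subseteq> K 0" "\<And>n x y. x \<in> K n \<Longrightarrow> y \<in> P \<Longrightarrow> x * y \<in> K (Suc n)"
    and "\<And>n x y. x \<in> K n \<Longrightarrow> y \<in> K n \<Longrightarrow> x + y \<in> K n"
  shows "ideal_pow P n \<subseteq> K n"
proof (induction n)
  case 0
  show ?case using assms(1) by simp
next
  case (Suc n)
  show ?case
  proof
    fix x assume "x \<in> ideal_pow P (Suc n)"
    hence "x \<in> ideal_prod R (ideal_pow P n) P" by (simp add: ideal_pow_Suc)
    thus "x \<in> K (Suc n)"
    proof (induction rule: ideal_prod.induct)
      case (prod i j)
      hence "i * j \<in> K (Suc n)" using Suc by (intro assms(2)) auto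
      thus ?case by simp
    next
      case (sum x y)
      hence "x + y \<in> K (Suc n)" by (intro assms(3))
      thus ?case by simp
    qed
  qed
qed

lemma symbolic_power_eq: "symbolic_power R P n = {f \<in> A. \<exists>u\<in>A - P. u * f \<in> ideal_pow P n}"
  by (simp add: symbolic_power_def)

end

section \<open>Simplicial affine semigroups\<close>

text \<open>For a simplicial cone, \<open>I\<close> is the set of primitive generators, \<open>l u = pair _ u\<close>, and the family
  \<open>w\<close> is \<open>d\<close> times the basis dual to \<open>I\<close>.\<close>

locale simplicial_semigroup = affine_semigroup S R A
  for S :: "'m::real_vector set" and R :: "('m \<Rightarrow>\<^sub>0 'f::field) ring" and A +
  fixes M :: "'m set" and L :: "('m \<Rightarrow>\<^sub>0 'f) set"
    and I :: "'i set" and l :: "'i \<Rightarrow> 'm \<Rightarrow> int" and w :: "'i \<Rightarrow> 'm" and d :: int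
  assumes L_eq: "L = supported_in M" and L_factorial: "factorial_set L"
    and M_zero: "0 \<in> M" and M_add: "a \<in> M \<Longrightarrow> b \<in> M \<Longrightarrow> a + b \<in> M"
    and M_minus: "a \<in> M \<Longrightarrow> - a \<in> M"
    and S_eq: "S = {m \<in> M. \<forall>i\<in>I. 0 \<le> l i m}"
    and I_finite: "finite I"
    and l_add: "i \<in> I \<Longrightarrow> a \<in> M \<Longrightarrow> b \<in> M \<Longrightarrow> l i (a + b) = l i a + l i b"
    and l_inj: "m \<in> M \<Longrightarrow> (\<And>i. i \<in> I \<Longrightarrow> l i m = 0) \<Longrightarrow> m = 0"
    and w_mem: "i \<in> I \<Longrightarrow> w i \<in> M"
    and l_w: "i \<in> I \<Longrightarrow> j \<in> I \<Longrightarrow> l j (w i) = (if i = j then d else 0)"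
    and d_pos: "d > 0"
    and l_one: "i \<in> I \<Longrightarrow> \<exists>m\<in>M. l i m = 1"
begin

sublocale L: factorial_set L
  by (rule L_factorial)

lemma S_subset: "S \<subseteq> M"
  by (auto simp: S_eq)

lemma A_subset: "A \<subseteq> L"
  using S_subset by (auto simp: A_eq L_eq supported_in_def)

lemma X_mem_L: "m \<in> M \<Longrightarrow> Poly_Mapping.single m c \<in> L"
  by (simp add: L_eq supported_in_def)

lemma l_zero: "i \<in> I \<Longrightarrow> l i 0 = 0"
  using l_add[of i 0 0] M_zero by simp

lemma l_uminus: "i \<in> I \<Longrightarrow> a \<in> M \<Longrightarrow> l i (- a) = - l i a"
  using l_add[of i a "- a"] M_minus l_zero by simp

lemma M_diff: "a \<in> M \<Longrightarrow> b \<in> M \<Longrightarrow> a - b \<in> M"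
  using M_add[of a "- b"] M_minus by simp

lemma l_diff: "i \<in> I \<Longrightarrow> a \<in> M \<Longrightarrow> b \<in> M \<Longrightarrow> l i (a - b) = l i a - l i b"
  using l_add[of i a "- b"] M_minus l_uminus by simp

lemma S_sum: "(\<And>j. j \<in> J \<Longrightarrow> f j \<in> S) \<Longrightarrow> sum f J \<in> S"
  by (induction J rule: infinite_finite_induct) (auto simp: S_zero S_add)

lemma M_sum: "(\<And>j. j \<in> J \<Longrightarrow> f j \<in> M) \<Longrightarrow> sum f J \<in> M"
  by (induction J rule: infinite_finite_induct) (auto simp: M_zero M_add)

lemma l_sum: "i \<in> I \<Longrightarrow> (\<And>j. j \<in> J \<Longrightarrow> f j \<in> M) \<Longrightarrow> l i (sum f J) = (\<Sum>j\<in>J. l i (f j))"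
  by (induction J rule: infinite_finite_induct) (auto simp: l_zero l_add M_sum)

lemma nat_scale:
  assumes "m \<in> M"
  shows "of_nat n *\<^sub>R m \<in> M" "i \<in> I \<Longrightarrow> l i (of_nat n *\<^sub>R m) = int n * l i m"
proof -
  have "of_nat n *\<^sub>R m \<in> M \<and> (i \<in> I \<longrightarrow> l i (of_nat n *\<^sub>R m) = int n * l i m)"
    by (induction n) (use assms in \<open>auto simp: M_zero l_zero M_add l_add algebra_simps\<close>)
  thus "of_nat n *\<^sub>R m \<in> M" "i \<in> I \<Longrightarrow> l i (of_nat n *\<^sub>R m) = int n * l i m" by auto
qed

lemma int_scale:
  assumes "m \<in> M"
  shows "of_int n *\<^sub>R m \<in> M" "i \<in> I \<Longrightarrow> l i (of_int n *\<^sub>R m) = n * l i m"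
proof -
  have "of_int n *\<^sub>R m \<in> M \<and> (i \<in> I \<longrightarrow> l i (of_int n *\<^sub>R m) = n * l i m)"
  proof (cases n rule: int_cases2)
    case (nonneg k)
    thus ?thesis using nat_scale[OF assms, where n = k] by simp
  next
    case (nonpos k)
    have "of_int n *\<^sub>R m = - (of_nat k *\<^sub>R m)" using nonpos by simp
    thus ?thesis using nat_scale[OF assms, where n = k] M_minus l_uminus nonpos by simp
  qed
  thus "of_int n *\<^sub>R m \<in> M" "i \<in> I \<Longrightarrow> l i (of_int n *\<^sub>R m) = n * l i m" by auto
qed

lemma w_in_S: "i \<in> I \<Longrightarrow> w i \<in> S"
  using w_mem l_w d_pos by (auto simp: S_eq)

text \<open>Both sides have the same values under every \<open>l j\<close>, and these separate the
  points of \<open>M\<close>. Thus the monomial of \<open>d\<close> times \<open>m\<close> is a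
  product of powers of the \<open>X (w i)\<close>.\<close>

lemma scaled_decomposition:
  assumes "m \<in> M"
  shows "of_int d *\<^sub>R m = (\<Sum>i\<in>I. of_int (l i m) *\<^sub>R w i)"
proof -
  let ?s = "\<Sum>i\<in>I. of_int (l i m) *\<^sub>R w i"
  have s: "?s \<in> M" by (intro M_sum int_scale w_mem)
  have "of_int d *\<^sub>R m - ?s = 0"
  proof (rule l_inj)
    show "of_int d *\<^sub>R m - ?s \<in> M" using s assms int_scale M_diff by blast
    fix j assume j: "j \<in> I"
    have "l j ?s = (\<Sum>i\<in>I. l j (of_int (l i m) *\<^sub>R w i))"
      by (rule l_sum[OF j]) (intro int_scale w_mem)
    also have "\<dots> = (\<Sum>i\<in>I. if i = j then l i m * d else 0)"
      by (intro sum.cong refl) (simp add: int_scale w_mem j l_w)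
    also have "\<dots> = l j m * d" using j I_finite by simp
    finally show "l j (of_int d *\<^sub>R m - ?s) = 0"
      using j s assms int_scale l_diff by simp
  qed
  thus ?thesis by simp
qed

lemma prime_power_mem: "primeideal P R \<Longrightarrow> a \<in> A \<Longrightarrow> a ^ n \<in> P \<Longrightarrow> a \<in> P"
proof (induction n)
  case (Suc n)
  hence "a \<in> P \<or> a ^ n \<in> P" using A_power unfolding primeideal_iff by (metis power_Suc)
  thus ?case using Suc by blast
qed (simp add: primeideal_iff)

lemma X_mult_mem:
  assumes "ideal P R" "X a \<in> P" "b \<in> S"
  shows "X (a + b) \<in> P"
proof -
  have "X b * X a \<in> P" using idealD(4)[OF assms(1)] assms(2,3) by blast
  thus ?thesis by (simp add: mult_single add.commute)
qed

text \<open>By primality some factor \<open>X (w i) ^ nat (n i)\<close> lies in \<open>P\<close>. An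
  exponent 0 would give the factor 1, which is not in \<open>P\<close>; hence
  \<open>n i > 0\<close>.\<close>

lemma monomial_product_in_prime:
  assumes P: "primeideal P R" and n: "\<And>i. i \<in> J \<Longrightarrow> 0 \<le> n i" and J: "finite J" "J \<subseteq> I"
    and mem: "X (\<Sum>i\<in>J. of_int (n i) *\<^sub>R w i) \<in> P"
  shows "\<exists>i\<in>J. n i > 0 \<and> X (w i) \<in> P"
  using J n mem
proof (induction J rule: finite_induct)
  case empty
  thus ?case using P by (simp add: primeideal_iff)
next
  case (insert i J)
  have i: "i \<in> I" "0 \<le> n i" using insert.prems by auto
  let ?k = "nat (n i)"
  have inS: "of_int (n j) *\<^sub>R w j \<in> S" if "j \<in> insert i J" for j
    using that insert.prems w_in_S[of j] int_scale[of "w j"] by (auto simp: S_eq)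
  have sS: "(\<Sum>j\<in>J. of_int (n j) *\<^sub>R w j) \<in> S"
    using inS by (intro S_sum) auto
  have "X (w i) ^ ?k * X (\<Sum>j\<in>J. of_int (n j) *\<^sub>R w j) \<in> P"
    using insert i by (simp add: single_power mult_single)
  hence "X (w i) ^ ?k \<in> P \<or> X (\<Sum>j\<in>J. of_int (n j) *\<^sub>R w j) \<in> P"
    using P A_closed(6)[OF w_in_S[OF i(1)]] A_power A_closed(6)[OF sS] unfolding primeideal_iff by blast
  thus ?case
  proof
    assume k: "X (w i) ^ ?k \<in> P"
    hence "?k \<noteq> 0" using P by (auto simp: primeideal_iff intro!: gr0I)
    moreover have "X (w i) \<in> P" using prime_power_mem[OF P _ k] w_in_S[OF i(1)] by blast
    ultimately show ?thesis by auto
  next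
    assume "X (\<Sum>j\<in>J. of_int (n j) *\<^sub>R w j) \<in> P"
    thus ?thesis using insert.IH insert.prems by auto
  qed
qed

text \<open>A prime contains \<open>X m\<close> exactly if it contains \<open>X m ^ nat d\<close>,
  which is a product of the \<open>X (w i)\<close>. So the monomials of any prime, monomial or not,
  are determined by the set of \<open>i\<close> with \<open>X (w i) \<in> P\<close>.\<close>

lemma monomial_in_prime_iff:
  assumes P: "primeideal P R" and m: "m \<in> S"
  shows "X m \<in> P \<longleftrightarrow> (\<exists>i\<in>I. l i m > 0 \<and> X (w i) \<in> P)"
proof
  have mM: "m \<in> M" and nn: "\<And>i. i \<in> I \<Longrightarrow> 0 \<le> l i m" using m by (auto simp: S_eq)
  have id: "ideal P R" using P by (simp add: primeideal_iff)
  {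
    assume "X m \<in> P"
    \<comment> \<open>The remaining \<open>d - 1\<close> copies of \<open>m\<close> turn
      \<open>X m\<close> into a monomial to which the decomposition applies.\<close>
    moreover have "of_int (d - 1) *\<^sub>R m \<in> S"
      using mM nn d_pos int_scale[OF mM, where n = "d - 1"] by (simp add: S_eq)
    ultimately have "X (m + of_int (d - 1) *\<^sub>R m) \<in> P" by (rule X_mult_mem[OF id])
    hence "X (of_int d *\<^sub>R m) \<in> P" by (simp add: algebra_simps)
    thus "\<exists>i\<in>I. l i m > 0 \<and> X (w i) \<in> P"
      using monomial_product_in_prime[OF P _ I_finite subset_refl, of "\<lambda>i. l i m"] nn
        scaled_decomposition[OF mM] by auto
  }
  assume "\<exists>i\<in>I. l i m > 0 \<and> X (w i) \<in> P"
  then obtain i where i: "i \<in> I" "l i m > 0" "X (w i) \<in> P" by blast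
  \<comment> \<open>\<open>w i\<close> is positive only along \<open>i\<close>, where it has value
    \<open>d\<close>, and there \<open>d \<le> d * l i m\<close>.\<close>
  have "of_int d *\<^sub>R m - w i \<in> S" unfolding S_eq
  proof (intro CollectI conjI ballI)
    show "of_int d *\<^sub>R m - w i \<in> M" using mM i w_mem int_scale M_diff by blast
    fix j assume j: "j \<in> I"
    have "l j (of_int d *\<^sub>R m - w i) = d * l j m - (if i = j then d else 0)"
      using j i mM w_mem int_scale l_diff l_w by simp
    moreover have "d \<le> d * l i m" using i d_pos by simp
    ultimately show "0 \<le> l j (of_int d *\<^sub>R m - w i)" using nn[OF j] d_pos by auto
  qed
  hence "X (w i + (of_int d *\<^sub>R m - w i)) \<in> P" by (rule X_mult_mem[OF id i(3)])
  hence "X m ^ nat d \<in> P" using d_pos by (simp add: single_power)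
  thus "X m \<in> P" using prime_power_mem[OF P] m by blast
qed

subsection \<open>Monomial primes\<close>

text \<open>The elements of \<open>A\<close> all of whose monomials lie in \<open>P\<close> form an
  ideal containing the generators of \<open>P\<close>, hence all of \<open>P\<close>.\<close>

lemma monomial_ideal_keys:
  fixes P :: "('m \<Rightarrow>\<^sub>0 'f) set"
  assumes "monomial_ideal S P" "f \<in> P" "k \<in> Poly_Mapping.keys f"
  shows "X k \<in> P"
proof -
  interpret cring R by (rule cring_R)
  obtain Z where Z: "Z \<subseteq> S" "P = genideal R (X ` Z)"
    using assms(1) unfolding monomial_ideal_def R_eq by blast
  have ZA: "X ` Z \<subseteq> carrier R" using Z by auto
  have id: "ideal P R" using genideal_ideal[OF ZA] Z by simp
  define K where "K = {f \<in> A. \<forall>k\<in>Poly_Mapping.keys f. X k \<in> P}"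
  have "ideal K R" unfolding ideal_iff
  proof (intro conjI ballI)
    show "K \<subseteq> A" "0 \<in> K" using A_closed by (auto simp: K_def)
    fix x y assume "x \<in> K" "y \<in> K"
    thus "x + y \<in> K" using keys_add[of x y] A_closed by (fastforce simp: K_def)
  next
    fix a x assume a: "a \<in> A" and x: "x \<in> K"
    have "X k \<in> P" if k: "k \<in> Poly_Mapping.keys (a * x)" for k
    proof -
      obtain s t where st: "k = s + t" "s \<in> Poly_Mapping.keys a" "t \<in> Poly_Mapping.keys x"
        using k keys_mult[of a x] by blast
      thus ?thesis using X_mult_mem[OF id, of t s] x A_keys[OF a] by (simp add: K_def add.commute)
    qed
    thus "a * x \<in> K" using a x A_closed by (auto simp: K_def)
  qed
  moreover have "X ` Z \<subseteq> K" using genideal_self[OF ZA] ZA Z by (auto simp: K_def)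
  ultimately have "P \<subseteq> K" using genideal_minimal Z by blast
  thus ?thesis using assms by (auto simp: K_def)
qed

text \<open>A monomial prime is cut out by the sum of the functions \<open>l j\<close> with \<open>X (w j) \<in> P\<close>. This sum
  vanishes on some exponent of each \<open>u \<notin> P\<close>, so symbolic powers are bounded by its order; on each
  generator of \<open>S\<close> it is at most \<open>T\<close>, so an exponent on which it exceeds \<open>T (r - 1)\<close> involves at
  least \<open>r\<close> generators lying in \<open>P\<close>.\<close>

theorem monomial_prime_containment:
  assumes P: "primeideal P R" "monomial_ideal S P"
    and B: "semigroup_generated B = S" and T: "\<And>b. b \<in> B \<Longrightarrow> (\<Sum>i\<in>I. l i b) \<le> int T"
    and r: "r > 0"
  shows "symbolic_power R P (T * (r - 1) + 1) \<subseteq> ideal_pow P r"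
proof
  define J where "J = {i \<in> I. X (w i) \<in> P}"
  define lam where "lam = (\<lambda>m. \<Sum>j\<in>J. l j m)"
  have JI: "J \<subseteq> I" "finite J" using I_finite by (auto simp: J_def)
  have id: "ideal P R" using P by (simp add: primeideal_iff)
  have lam_add: "lam (a + b) = lam a + lam b" if "a \<in> M" "b \<in> M" for a b
    unfolding lam_def sum.distrib[symmetric] using JI that by (intro sum.cong l_add) auto
  have lam_nn: "0 \<le> lam m" if "m \<in> S" for m
    unfolding lam_def using that JI by (intro sum_nonneg) (auto simp: S_eq)
  have in_P: "X m \<in> P \<longleftrightarrow> 0 < lam m" if m: "m \<in> S" for m
  proof -
    have nn: "\<forall>j\<in>J. 0 \<le> l j m" using m JI by (auto simp: S_eq)
    have "X m \<in> P \<longleftrightarrow> (\<exists>j\<in>J. l j m \<noteq> 0)"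
      using monomial_in_prime_iff[OF P(1) m] nn by (force simp: J_def)
    also have "\<dots> \<longleftrightarrow> lam m \<noteq> 0"
      unfolding lam_def using nn sum_nonneg_eq_0_iff[OF JI(2), of "\<lambda>j. l j m"] by simp
    finally show ?thesis using lam_nn[OF m] by auto
  qed
  have BS: "B \<subseteq> S"
  proof
    fix b assume "b \<in> B"
    hence "sum_list [b] \<in> semigroup_generated B" unfolding semigroup_generated_def by fastforce
    thus "b \<in> S" using B by simp
  qed
  have lamB: "lam b \<le> int T" if "b \<in> B" for b
  proof -
    have "lam b \<le> (\<Sum>i\<in>I. l i b)"
      unfolding lam_def using BS that JI I_finite by (intro sum_mono2) (auto simp: S_eq)
    thus ?thesis using T[OF that] by simp
  qed
  \<comment> \<open>\<open>n\<close> counts the entries of \<open>bs\<close> with positive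
    \<open>lam\<close>. Such an entry adds a factor from \<open>P\<close> and at most
    \<open>T\<close> to \<open>lam\<close>; any other entry adds nothing to
    \<open>lam\<close>.\<close>
  have gens: "\<exists>n. sum_list bs \<in> S \<and> X (sum_list bs) \<in> ideal_pow P n \<and> lam (sum_list bs) \<le> int T * int n"
    if "set bs \<subseteq> B" for bs
    using that
  proof (induction bs)
    case Nil
    have "lam 0 = 0" using lam_add[of 0 0] M_zero by simp
    thus ?case using S_zero A_closed by (intro exI[of _ 0]) auto
  next
    case (Cons b bs)
    then obtain n where n: "sum_list bs \<in> S" "X (sum_list bs) \<in> ideal_pow P n"
      "lam (sum_list bs) \<le> int T * int n" by auto
    have b: "b \<in> B" "b \<in> S" using Cons.prems BS by auto
    have s: "sum_list (b # bs) \<in> S" using b n S_add by simp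
    have le: "lam (sum_list (b # bs)) = lam b + lam (sum_list bs)"
      using b n S_subset lam_add by auto
    have eq: "X (sum_list (b # bs)) = X (sum_list bs) * (X b :: 'm \<Rightarrow>\<^sub>0 'f)"
      by (simp add: mult_single add.commute)
    show ?case
    proof (cases "0 < lam b")
      case True
      hence "X b \<in> P" using in_P b by blast
      hence "X (sum_list (b # bs)) \<in> ideal_pow P (Suc n)"
        using ideal_pow_mult[OF n(2)] eq by metis
      moreover have "lam (sum_list (b # bs)) \<le> int T * int (Suc n)"
        using le lamB[OF b(1)] n(3) by (simp add: algebra_simps)
      ultimately show ?thesis using s by blast
    next
      case False
      have "X b * X (sum_list bs) \<in> ideal_pow P n"
        using idealD(4)[OF ideal_pow_ideal[OF id]] n(2) b by blast
      hence "X (sum_list (b # bs)) \<in> ideal_pow P n" using eq by (metis mult.commute)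
      moreover have "lam (sum_list (b # bs)) \<le> int T * int n" using le False n(3) by simp
      ultimately show ?thesis using s by blast
    qed
  qed
  have mono: "X m \<in> ideal_pow P r" if m: "m \<in> S" "int (T * (r - 1) + 1) \<le> lam m" for m
  proof -
    obtain bs where "set bs \<subseteq> B" "m = sum_list bs"
      using m(1) B unfolding semigroup_generated_def by blast
    then obtain n where n: "X m \<in> ideal_pow P n" "lam m \<le> int T * int n" using gens by blast
    \<comment> \<open>Here the summand 1 of the exponent decides: with \<open>n < r\<close> the
      value of \<open>lam\<close> would be at most \<open>T * (r - 1)\<close>.\<close>
    have "r \<le> n"
    proof (rule ccontr)
      assume "\<not> r \<le> n"
      hence "T * n \<le> T * (r - 1)" by (intro mult_le_mono2) simp
      hence "int T * int n \<le> int (T * (r - 1))" by (simp flip: of_nat_mult)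
      thus False using n(2) m(2) by simp
    qed
    thus ?thesis using ideal_pow_antimono[OF id] n(1) by blast
  qed
  have pow: "ideal_pow P n \<subseteq> {f \<in> A. \<forall>k\<in>Poly_Mapping.keys f. int n \<le> lam k}" for n
  proof (rule ideal_pow_subset)
    show "A \<subseteq> {f \<in> A. \<forall>k\<in>Poly_Mapping.keys f. int 0 \<le> lam k}" using A_keys lam_nn by auto
    fix n x y assume x: "x \<in> {f \<in> A. \<forall>k\<in>Poly_Mapping.keys f. int n \<le> lam k}"
    {
      assume y: "y \<in> P"
      hence yA: "y \<in> A" using idealD(1)[OF id] by blast
      have "int (Suc n) \<le> lam k" if k: "k \<in> Poly_Mapping.keys (x * y)" for k
      proof -
        obtain s t where st: "k = s + t" "s \<in> Poly_Mapping.keys x" "t \<in> Poly_Mapping.keys y"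
          using k keys_mult[of x y] by blast
        have S: "s \<in> S" "t \<in> S" using A_keys x yA st by auto
        have "0 < lam t" using monomial_ideal_keys[OF P(2) y st(3)] in_P S by blast
        moreover have "int n \<le> lam s" using x st by auto
        moreover have "lam k = lam s + lam t" using st S S_subset lam_add by blast
        ultimately show ?thesis by simp
      qed
      thus "x * y \<in> {f \<in> A. \<forall>k\<in>Poly_Mapping.keys f. int (Suc n) \<le> lam k}"
        using x yA A_closed by auto
    }
    assume y: "y \<in> {f \<in> A. \<forall>k\<in>Poly_Mapping.keys f. int n \<le> lam k}"
    show "x + y \<in> {f \<in> A. \<forall>k\<in>Poly_Mapping.keys f. int n \<le> lam k}"
      using x y keys_add[of x y] A_closed by blast
  qed
  fix f assume "f \<in> symbolic_power R P (T * (r - 1) + 1)"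
  then obtain u where f: "f \<in> A" and u: "u \<in> A" "u \<notin> P" "u * f \<in> ideal_pow P (T * (r - 1) + 1)"
    by (auto simp: symbolic_power_eq)
  have bound: "int (T * (r - 1) + 1) \<le> lam k" if k: "k \<in> Poly_Mapping.keys f" for k
  proof -
    have f0: "f \<noteq> 0" using k by auto
    have u0: "u \<noteq> 0" using u idealD(2)[OF id] by auto
    have uf0: "u * f \<noteq> 0" using L.no_zero_divisors f u A_subset f0 u0 by blast
    obtain k0 where k0: "k0 \<in> Poly_Mapping.keys u" "X k0 \<notin> P"
      using ideal_contains_by_keys[OF id, of u] u by blast
    hence "lam k0 = 0" using in_P[of k0] lam_nn[of k0] A_keys[OF u(1)] by force
    hence "order_along lam u \<le> 0" using order_along_le k0 by metis
    moreover have "int (T * (r - 1) + 1) \<le> order_along lam (u * f)"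
      using pow u(3) order_along_ge_iff[OF uf0] by blast
    moreover have "order_along lam (u * f) = order_along lam u + order_along lam f"
      by (rule order_along_mult[of M])
        (use L.set_domain_axioms L_eq lam_add A_subset u f f0 u0 in auto)
    ultimately show ?thesis using order_along_le[OF k, of lam] by linarith
  qed
  show "f \<in> ideal_pow P r"
    by (rule ideal_contains_by_keys[OF ideal_pow_ideal[OF id]]) (use mono bound A_keys[OF f] in blast)
qed

subsection \<open>Height one primes\<close>

definition PI :: "'i \<Rightarrow> ('m \<Rightarrow>\<^sub>0 'f) set" where
  "PI i = {f \<in> A. \<forall>k\<in>Poly_Mapping.keys f. 1 \<le> l i k}"

text \<open>The contraction to \<open>A\<close> of the ideal generated by \<open>p\<close> in
  \<open>L\<close>; \<open>p\<close> itself need not lie in \<open>A\<close>.\<close>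

definition QI :: "('m \<Rightarrow>\<^sub>0 'f) \<Rightarrow> ('m \<Rightarrow>\<^sub>0 'f) set" where
  "QI p = {f \<in> A. dvd_in L p f}"

lemma X_nonzero: "X m \<noteq> (0 :: 'm \<Rightarrow>\<^sub>0 'f)"
  by (metis lookup_single_eq lookup_zero zero_neq_one)

lemma X_unit: "X (- m) * X m = (1 :: 'm \<Rightarrow>\<^sub>0 'f)" "X m * X (- m) = (1 :: 'm \<Rightarrow>\<^sub>0 'f)"
  by (simp_all add: mult_single)

lemma dvd_X_mult: "dvd_in L p (X m * f) \<Longrightarrow> m \<in> M \<Longrightarrow> dvd_in L p f"
proof -
  assume "dvd_in L p (X m * f)" "m \<in> M"
  hence "dvd_in L p (X (- m) * (X m * f))" using L.dvd_in_mult2 X_mem_L M_minus by blast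
  moreover have "X (- m) * (X m * f) = f" by (metis X_unit(1) mult.assoc mult_1)
  ultimately show ?thesis by simp
qed

lemma ord_mult:
  assumes "i \<in> I" "f \<in> L" "g \<in> L" "f \<noteq> 0" "g \<noteq> 0"
  shows "order_along (l i) (f * g) = order_along (l i) f + order_along (l i) g"
  by (rule order_along_mult[of M]) (use assms L.set_domain_axioms L_eq l_add in auto)

lemma ord_X: "order_along (l i) (X m :: 'm \<Rightarrow>\<^sub>0 'f) = l i m"
  by (simp add: order_along_single)

lemma ord_nonneg: "i \<in> I \<Longrightarrow> f \<in> A \<Longrightarrow> f \<noteq> 0 \<Longrightarrow> 0 \<le> order_along (l i) f"
  using A_keys by (subst order_along_ge_iff) (auto simp: S_eq)

lemma mem_A_iff: "f \<in> L \<Longrightarrow> f \<noteq> 0 \<Longrightarrow> f \<in> A \<longleftrightarrow> (\<forall>i\<in>I. 0 \<le> order_along (l i) f)"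
proof
  assume f: "f \<in> L" "f \<noteq> 0" and "\<forall>i\<in>I. 0 \<le> order_along (l i) f"
  hence "0 \<le> l i k" if "i \<in> I" "k \<in> Poly_Mapping.keys f" for i k
    using that order_along_ge_iff[OF f(2)] by blast
  thus "f \<in> A" using f by (auto simp: A_eq L_eq supported_in_def S_eq)
qed (use ord_nonneg in blast)

lemma PI_iff: "i \<in> I \<Longrightarrow> f \<in> PI i \<longleftrightarrow> f \<in> A \<and> (f = 0 \<or> 1 \<le> order_along (l i) f)"
  by (cases "f = 0") (auto simp: PI_def order_along_ge_iff)

section \<open>Monomials that clear denominators\<close>

definition W :: "'i set \<Rightarrow> 'm" where "W J = (\<Sum>j\<in>J. w j)"

lemma W_mem: "J \<subseteq> I \<Longrightarrow> W J \<in> M"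
  unfolding W_def by (intro M_sum w_mem) auto

lemma l_W: "J \<subseteq> I \<Longrightarrow> i \<in> I \<Longrightarrow> l i (W J) = (if i \<in> J then d else 0)"
proof -
  assume J: "J \<subseteq> I" and i: "i \<in> I"
  have "l i (W J) = (\<Sum>j\<in>J. l i (w j))" unfolding W_def using J w_mem by (intro l_sum[OF i]) auto
  also have "\<dots> = (\<Sum>j\<in>J. if j = i then d else 0)" using J i by (intro sum.cong refl) (auto simp: l_w)
  also have "\<dots> = (if i \<in> J then d else 0)" using finite_subset[OF J I_finite] by simp
  finally show ?thesis .
qed

text \<open>A large multiple of \<open>W J\<close> raises the \<open>l i\<close> with
  \<open>i \<in> J\<close> and leaves the others fixed. With \<open>J = I\<close> it moves elements
  of \<open>L\<close> into \<open>A\<close>; with \<open>J = I - {i}\<close> it does so without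
  changing the order along \<open>l i\<close>.\<close>

lemma shift_exists:
  assumes "finite K" "K \<subseteq> M" "J \<subseteq> I"
  obtains c where "c \<in> S" "\<And>i. i \<in> I - J \<Longrightarrow> l i c = 0"
    "\<And>k i. k \<in> K \<Longrightarrow> i \<in> J \<Longrightarrow> 0 \<le> l i (k + c)"
proof -
  define n where "n = (\<Sum>k\<in>K. \<Sum>i\<in>J. nat \<bar>l i k\<bar>)"
  have fJ: "finite J" using assms I_finite finite_subset by blast
  have n: "- l i k \<le> int n" if "k \<in> K" "i \<in> J" for i k
  proof -
    have "nat \<bar>l i k\<bar> \<le> (\<Sum>i\<in>J. nat \<bar>l i k\<bar>)" using that fJ by (intro member_le_sum) auto
    also have "\<dots> \<le> n" unfolding n_def
      by (rule member_le_sum[of k K "\<lambda>k. \<Sum>i\<in>J. nat \<bar>l i k\<bar>"]) (use that assms in auto)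
    finally show ?thesis by linarith
  qed
  define c where "c = of_nat n *\<^sub>R W J"
  have cM: "c \<in> M" unfolding c_def using W_mem assms nat_scale by blast
  have lc: "l i c = (if i \<in> J then int n * d else 0)" if "i \<in> I" for i
    using that nat_scale(2)[OF W_mem[OF assms(3)] that, of n] l_W[OF assms(3) that] by (simp add: c_def)
  have nd: "int n \<le> int n * d" using d_pos by (simp add: mult_le_cancel_left1)
  have cS: "c \<in> S" using cM lc d_pos by (auto simp: S_eq)
  show ?thesis
  proof (rule that[OF cS])
    fix k i assume ki: "k \<in> K" "i \<in> J"
    hence "l i (k + c) = l i k + int n * d" using l_add[of i k c] lc[of i] cM assms by auto
    thus "0 \<le> l i (k + c)" using n[OF ki] nd by linarith
  qed (use lc in auto)
qed

lemma keys_X_mult: "Poly_Mapping.keys (X c * (f :: 'm \<Rightarrow>\<^sub>0 'f)) = (\<lambda>k. k + c) ` Poly_Mapping.keys f"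
proof (intro equalityI subsetI)
  fix k assume "k \<in> Poly_Mapping.keys (X c * f)"
  hence "k - c \<in> Poly_Mapping.keys f" using keys_single_mult[of k f c] by (simp add: mult.commute)
  thus "k \<in> (\<lambda>k. k + c) ` Poly_Mapping.keys f" by (intro image_eqI[of _ _ "k - c"]) auto
next
  fix k assume "k \<in> (\<lambda>k. k + c) ` Poly_Mapping.keys f"
  thus "k \<in> Poly_Mapping.keys (X c * f)" using keys_single_mult[of k f c] by (auto simp: mult.commute)
qed

lemma X_mult_in_A_iff: "X c * f \<in> A \<longleftrightarrow> (\<forall>k\<in>Poly_Mapping.keys f. k + c \<in> S)"
  by (auto simp: A_eq supported_in_def keys_X_mult)

lemma L_keys: "f \<in> L \<Longrightarrow> Poly_Mapping.keys f \<subseteq> M"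
  by (simp add: L_eq supported_in_def)

text \<open>This is the concrete form of \<open>L\<close> being the localization of \<open>A\<close>
  at the monomials.\<close>

lemma shift_into_A:
  assumes "f \<in> L"
  obtains c where "c \<in> S" "X c * f \<in> A"
proof -
  obtain c where c: "c \<in> S" "\<And>k i. k \<in> Poly_Mapping.keys f \<Longrightarrow> i \<in> I \<Longrightarrow> 0 \<le> l i (k + c)"
    using shift_exists[OF finite_keys L_keys[OF assms] subset_refl] by metis
  have "X c * f \<in> A"
    unfolding X_mult_in_A_iff using c L_keys[OF assms] S_subset M_add by (auto simp: S_eq)
  thus ?thesis using that c by blast
qed

lemma PI_prime:
  assumes i: "i \<in> I"
  shows "primeideal (PI i) R"
proof -
  have "ideal (PI i) R" unfolding ideal_iff
  proof (intro conjI ballI)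
    fix x y assume "x \<in> PI i" "y \<in> PI i"
    thus "x + y \<in> PI i" using keys_add[of x y] A_closed by (fastforce simp: PI_def)
  next
    fix a x assume a: "a \<in> A" and x: "x \<in> PI i"
    have "a * x = 0 \<or> 1 \<le> order_along (l i) (a * x)"
    proof (cases "a = 0 \<or> x = 0")
      case False
      moreover have "x \<in> A" "1 \<le> order_along (l i) x" using x False PI_iff[OF i] by auto
      ultimately have "order_along (l i) (a * x) = order_along (l i) a + order_along (l i) x"
        using ord_mult[OF i] a A_subset by blast
      thus ?thesis using \<open>1 \<le> order_along (l i) x\<close> ord_nonneg[OF i a] False by auto
    qed auto
    moreover have "a * x \<in> A" using a x by (auto simp: PI_def)
    ultimately show "a * x \<in> PI i" by (simp add: PI_iff[OF i])
  qed (auto simp: PI_def)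
  moreover have "1 \<notin> PI i" using l_zero[OF i] by (simp add: PI_def)
  moreover have "a \<in> PI i \<or> b \<in> PI i" if ab: "a \<in> A" "b \<in> A" "a * b \<in> PI i" for a b
  proof (cases "a = 0 \<or> b = 0")
    case True
    thus ?thesis using A_closed by (auto simp: PI_def)
  next
    case False
    hence "a * b \<noteq> 0" using L.no_zero_divisors ab A_subset by blast
    hence "1 \<le> order_along (l i) a + order_along (l i) b"
      using False PI_iff[OF i] ab(3) ord_mult[OF i subsetD[OF A_subset ab(1)] subsetD[OF A_subset ab(2)]]
      by auto
    hence "1 \<le> order_along (l i) a \<or> 1 \<le> order_along (l i) b" by linarith
    thus ?thesis using ab PI_iff[OF i] by blast
  qed
  ultimately show ?thesis unfolding primeideal_iff by blast
qed

lemma QI_prime: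
  assumes p: "prime_in L p"
  shows "primeideal (QI p) R"
proof -
  note pD = prime_inD[OF p]
  have "ideal (QI p) R" unfolding ideal_iff
  proof (intro conjI ballI)
    fix a x assume "a \<in> A" "x \<in> QI p"
    thus "a * x \<in> QI p" using L.dvd_in_mult2[of p x a] A_subset by (auto simp: QI_def)
  qed (auto simp: QI_def L.dvd_in_zero L.dvd_in_add)
  moreover have "1 \<notin> QI p" using pD by (simp add: QI_def)
  moreover have "a \<in> QI p \<or> b \<in> QI p" if "a \<in> A" "b \<in> A" "a * b \<in> QI p" for a b
    using that pD(4)[of a b] A_subset by (auto simp: QI_def)
  ultimately show ?thesis unfolding primeideal_iff by blast
qed

lemma zero_prime: "primeideal {0} R"
  unfolding primeideal_iff ideal_iff
proof (intro conjI ballI impI)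
  show "1 \<notin> {0::'m \<Rightarrow>\<^sub>0 'f}" by simp
  fix a b assume "a \<in> A" "b \<in> A" "a * b \<in> {0}"
  thus "a \<in> {0} \<or> b \<in> {0}" using L.no_zero_divisors[of a b] A_subset by auto
qed auto

text \<open>A nonzero prime containing no monomial survives in the group algebra, which is factorial.\<close>

lemma nonzero_prime_contains:
  assumes Q: "primeideal Q R" "Q \<noteq> {0}"
  shows "(\<exists>i\<in>I. PI i \<subseteq> Q) \<or> (\<exists>p. prime_in L p \<and> QI p \<subseteq> Q)"
proof (cases "\<exists>m\<in>S. X m \<in> Q")
  case True
  then obtain i where i: "i \<in> I" "X (w i) \<in> Q" using monomial_in_prime_iff[OF Q(1)] by blast
  have "f \<in> Q" if f: "f \<in> PI i" for f
  proof (rule ideal_contains_by_keys)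
    show "ideal Q R" using Q by (simp add: primeideal_iff)
    fix k assume k: "k \<in> Poly_Mapping.keys f"
    have "k \<in> S" "0 < l i k" using f k A_keys by (auto simp: PI_def)
    thus "X k \<in> Q" using monomial_in_prime_iff[OF Q(1)] i by blast
  qed
  thus ?thesis using i by blast
next
  case False
  have id: "ideal Q R" using Q by (simp add: primeideal_iff)
  note idQ = idealD[OF id]
  have Qprime: "a \<in> Q \<or> b \<in> Q" if "a \<in> A" "b \<in> A" "a * b \<in> Q" for a b
    using that Q by (simp add: primeideal_iff)
  \<comment> \<open>Each factor of \<open>g\<close> is moved into \<open>A\<close> by a monomial, so
    primality of \<open>Q\<close> can be applied; the monomial in front is arbitrary because these
    shifts interact with it. A unit of \<open>L\<close> would leave a monomial in \<open>Q\<close>,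
    which is excluded, so a prime factor must be met.\<close>
  have step: "\<exists>p. prime_in L p \<and> (\<exists>c\<in>S. X c * p \<in> Q)"
    if "prime_product L n g" "c \<in> S" "X c * g \<in> Q" for n g c
    using that
  proof (induction arbitrary: c rule: prime_product.induct)
    case (unit u)
    then obtain v where v: "v \<in> L" "1 = u * v" by (auto simp: dvd_in_def)
    obtain c' where c': "c' \<in> S" "X c' * v \<in> A" using shift_into_A[OF v(1)] .
    have "(X c' * v) * (X c * u) \<in> Q" using idQ(4) c' unit by blast
    also have "(X c' * v) * (X c * u) = X c' * X c * (u * v)" by (simp only: ac_simps)
    also have "\<dots> = X (c' + c)" by (simp add: v(2)[symmetric] mult_single)
    finally show ?case using False c' unit S_add by blast
  next
    case (mult p n a)
    obtain c1 where c1: "c1 \<in> S" "X c1 * p \<in> A" using shift_into_A[OF prime_inD(1)[OF mult(1)]] .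
    obtain c2 where c2: "c2 \<in> S" "X c2 * a \<in> A"
      using shift_into_A[OF L.prime_product_mem[OF mult(2)]] .
    have "X (c1 + c2) * (X c * (p * a)) \<in> Q"
      using idQ(4)[of "X (c1 + c2)"] c1 c2 S_add mult.prems by blast
    also have "X (c1 + c2) * (X c * (p * a)) = (X c1 * X c2) * (X c * (p * a))"
      by (simp add: mult_single)
    also have "\<dots> = (X c1 * p) * ((X c2 * a) * X c)" by (simp only: ac_simps)
    finally have "X c1 * p \<in> Q \<or> X c2 * a \<in> Q \<or> X c \<in> Q"
      using Qprime c1 c2 mult.prems A_closed by (meson A_closed(5,6))
    thus ?case using False mult c1 c2 by blast
  qed
  obtain f where f: "f \<in> Q" "f \<noteq> 0" using Q(2) idQ(2) by blast
  then obtain n where n: "prime_product L n f" using L.factorization idQ(1) A_subset by blast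
  have "X 0 * f \<in> Q" using f by simp
  then obtain p c where p: "prime_in L p" "c \<in> S" "X c * p \<in> Q" using step[OF n S_zero] by blast
  \<comment> \<open>The cofactor of \<open>f\<close> in \<open>L\<close> is moved into
    \<open>A\<close> as well; this puts a monomial multiple of \<open>f\<close> into
    \<open>Q\<close>, and \<open>Q\<close> contains no monomial.\<close>
  have "f \<in> Q" if f: "f \<in> QI p" for f
  proof -
    obtain g where g: "g \<in> L" "f = p * g" using f by (auto simp: QI_def dvd_in_def)
    obtain c1 where c1: "c1 \<in> S" "X c1 * g \<in> A" using shift_into_A[OF g(1)] .
    have "(X c1 * g) * (X c * p) \<in> Q" using idQ(4) c1 p by blast
    also have "(X c1 * g) * (X c * p) = (X c1 * X c) * f" unfolding g by (simp only: ac_simps)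
    also have "\<dots> = X (c1 + c) * f" by (simp add: mult_single)
    finally have "X (c1 + c) \<in> Q \<or> f \<in> Q"
      using Qprime f S_add[OF c1(1) p(2)] by (auto simp: QI_def)
    thus ?thesis using False S_add[OF c1(1) p(2)] by blast
  qed
  thus ?thesis using p by blast
qed

lemma X_w_in_PI: "i \<in> I \<Longrightarrow> X (w i) \<in> PI i"
  using w_in_S l_w d_pos by (auto simp: PI_def)

lemma X_not_in_QI: "prime_in L p \<Longrightarrow> m \<in> M \<Longrightarrow> X m \<notin> QI p"
proof
  assume p: "prime_in L p" and m: "m \<in> M" and "X m \<in> QI p"
  hence "dvd_in L p (X m * 1)" by (simp add: QI_def)
  thus False using dvd_X_mult m prime_inD(3)[OF p] by blast
qed

lemma PI_subset_PI: "i \<in> I \<Longrightarrow> j \<in> I \<Longrightarrow> PI j \<subseteq> PI i \<Longrightarrow> i = j"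
proof -
  assume ij: "i \<in> I" "j \<in> I" "PI j \<subseteq> PI i"
  hence "X (w j) \<in> PI i" using X_w_in_PI by blast
  hence "1 \<le> l i (w j)" by (simp add: PI_def)
  thus ?thesis using l_w[of j i] ij by (simp split: if_splits)
qed

lemma PI_not_subset_QI: "prime_in L p \<Longrightarrow> i \<in> I \<Longrightarrow> \<not> PI i \<subseteq> QI p"
  using X_w_in_PI X_not_in_QI w_mem by blast

text \<open>A monomial normalizes the order of \<open>p\<close> along \<open>l i\<close> to 0, which
  is possible because \<open>l i\<close> takes the value 1. A shift along the other facets then
  gives a multiple of \<open>p\<close> in \<open>A\<close> that still has order 0.\<close>

lemma QI_not_subset_PI:
  assumes p: "prime_in L p" and i: "i \<in> I"
  shows "\<not> QI p \<subseteq> PI i"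
proof -
  note pD = prime_inD[OF p]
  obtain m0 where m0: "m0 \<in> M" "l i m0 = 1" using l_one[OF i] by blast
  define c0 where "c0 = of_int (- order_along (l i) p) *\<^sub>R m0"
  have c0: "c0 \<in> M" "l i c0 = - order_along (l i) p"
    by (simp_all only: c0_def int_scale[OF m0(1)] i m0(2) mult_1_right)
  define f where "f = X c0 * p"
  have f: "f \<in> L" "f \<noteq> 0"
    unfolding f_def using X_mem_L[OF c0(1)] pD L.mult_mem L.no_zero_divisors X_nonzero by blast+
  have of: "order_along (l i) f = 0"
    unfolding f_def using ord_mult[OF i X_mem_L[OF c0(1)] pD(1) X_nonzero pD(2)] c0 ord_X by simp
  obtain c where c: "c \<in> S" "\<And>j. j \<in> I - (I - {i}) \<Longrightarrow> l j c = 0"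
    "\<And>k j. k \<in> Poly_Mapping.keys f \<Longrightarrow> j \<in> I - {i} \<Longrightarrow> 0 \<le> l j (k + c)"
    using shift_exists[OF finite_keys L_keys[OF f(1)], of "I - {i}"] by (metis Diff_subset)
  have lic: "l i c = 0" using c(2) i by blast
  have cM: "c \<in> M" using c S_subset by blast
  have fkeys: "k \<in> M" "0 \<le> l i k" if "k \<in> Poly_Mapping.keys f" for k
    using L_keys[OF f(1)] that order_along_le[OF that, of "l i"] of by auto
  have "X c * f \<in> A" unfolding X_mult_in_A_iff S_eq
  proof (intro CollectI conjI ballI)
    fix k assume k: "k \<in> Poly_Mapping.keys f"
    show "k + c \<in> M" using fkeys[OF k] cM M_add by blast
    fix j assume j: "j \<in> I"
    show "0 \<le> l j (k + c)"
    proof (cases "j = i")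
      case True
      thus ?thesis using fkeys[OF k] l_add[OF i _ cM] lic by simp
    next
      case False
      thus ?thesis using c(3) k j by blast
    qed
  qed
  moreover have "dvd_in L p (X c * f)" unfolding f_def
    by (rule L.dvd_in_mult2[OF L.dvd_in_mult2[OF L.dvd_in_refl X_mem_L[OF c0(1)]] X_mem_L[OF cM]])
  ultimately have "X c * f \<in> QI p" by (simp add: QI_def)
  moreover have "X c * f \<notin> PI i"
  proof -
    have "order_along (l i) (X c * f) = 0"
      using ord_mult[OF i X_mem_L[OF cM] f(1) X_nonzero f(2)] of lic ord_X by simp
    moreover have "X c * f \<noteq> 0" using L.no_zero_divisors X_mem_L[OF cM] f X_nonzero by blast
    ultimately show ?thesis using PI_iff[OF i] by simp
  qed
  ultimately show ?thesis by blast
qed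

lemma QI_subset_QI:
  assumes p: "prime_in L p" and q: "prime_in L q" and sub: "QI q \<subseteq> QI p"
  shows "QI q = QI p"
proof -
  obtain c where c: "c \<in> S" "X c * q \<in> A" using shift_into_A[OF prime_inD(1)[OF q]] .
  have cM: "c \<in> M" using c S_subset by blast
  have "X c * q \<in> QI q" using c L.dvd_in_mult2[OF L.dvd_in_refl X_mem_L[OF cM]] by (simp add: QI_def)
  hence "dvd_in L p (X c * q)" using sub by (auto simp: QI_def)
  hence "dvd_in L p q" using dvd_X_mult cM by blast
  hence "dvd_in L q p" by (rule L.prime_dvd_prime[OF q p])
  thus ?thesis using sub L.dvd_in_trans by (auto simp: QI_def)
qed

lemma nonzero_PI: "i \<in> I \<Longrightarrow> PI i \<noteq> {0}"
  using X_w_in_PI X_nonzero by blast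

lemma nonzero_QI: "prime_in L p \<Longrightarrow> QI p \<noteq> {0}"
proof
  assume p: "prime_in L p" and "QI p = {0}"
  moreover obtain c where c: "c \<in> S" "X c * p \<in> A" using shift_into_A[OF prime_inD(1)[OF p]] .
  moreover have "X c * p \<in> QI p"
    using c L.dvd_in_mult2[OF L.dvd_in_refl X_mem_L] S_subset by (auto simp: QI_def)
  moreover have "X c * p \<noteq> 0"
    using L.no_zero_divisors[of "X c" p] X_mem_L c S_subset prime_inD[OF p] X_nonzero by blast
  ultimately show False by simp
qed

text \<open>A nonzero prime \<open>Q\<close> inside \<open>P\<close> contains a member of the same
  list, and distinct members of the list are incomparable.\<close>

lemma minimal_prime:
  assumes P: "P \<in> PI ` I \<union> QI ` {p. prime_in L p}" and Q: "primeideal Q R" "Q \<noteq> {0}" "Q \<subseteq> P"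
  shows "Q = P"
  using nonzero_prime_contains[OF Q(1,2)]
proof
  assume "\<exists>i\<in>I. PI i \<subseteq> Q"
  then obtain i where i: "i \<in> I" "PI i \<subseteq> Q" by blast
  show ?thesis using P
  proof
    assume "P \<in> PI ` I"
    then obtain j where j: "j \<in> I" "P = PI j" by blast
    hence "j = i" using PI_subset_PI[of j i] i Q by blast
    thus ?thesis using i j Q by blast
  next
    assume "P \<in> QI ` {p. prime_in L p}"
    thus ?thesis using PI_not_subset_QI i Q by blast
  qed
next
  assume "\<exists>p. prime_in L p \<and> QI p \<subseteq> Q"
  then obtain p where p: "prime_in L p" "QI p \<subseteq> Q" by blast
  show ?thesis using P
  proof
    assume "P \<in> PI ` I"
    thus ?thesis using QI_not_subset_PI p Q by blast
  next
    assume "P \<in> QI ` {p. prime_in L p}"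
    then obtain q where q: "prime_in L q" "P = QI q" by blast
    have "QI p = QI q" using QI_subset_QI[OF q(1) p(1)] p q Q by blast
    thus ?thesis using p q Q by blast
  qed
qed

text \<open>Since \<open>{0}\<close> is prime, a smaller nonzero prime yields a chain of length 2;
  conversely, in a chain of length at least 2 the next to last member is such a prime.\<close>

lemma ideal_height_one_iff:
  assumes P: "primeideal P R"
  shows "ideal_height R P = 1 \<longleftrightarrow>
    P \<noteq> {0} \<and> (\<forall>Q. primeideal Q R \<and> Q \<noteq> {0} \<and> Q \<subseteq> P \<longrightarrow> Q = P)"
    (is "_ \<longleftrightarrow> ?rhs")
proof -
  define chain where "chain = (\<lambda>n (Q :: nat \<Rightarrow> ('m \<Rightarrow>\<^sub>0 'f) set).
    (\<forall>i\<le>n. primeideal (Q i) R) \<and> (\<forall>i<n. Q i \<subset> Q (Suc i)) \<and> Q n = P)"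
  have ht: "ideal_height R P = Sup {enat n | n. \<exists>Q. chain n Q}"
    by (simp add: ideal_height_def chain_def)
  have zero: "0 \<in> Q" if "primeideal Q R" for Q using that by (simp add: primeideal_iff ideal_iff)
  show ?thesis
  proof
    assume h: "ideal_height R P = 1"
    have le: "n \<le> 1" if "chain n Q" for n Q
    proof -
      have "enat n \<le> ideal_height R P" unfolding ht using that by (intro Sup_upper) blast
      thus ?thesis using h by (simp add: one_enat_def)
    qed
    show ?rhs
    proof (intro conjI allI impI)
      show "P \<noteq> {0}"
      proof
        assume P0: "P = {0}"
        have "n = 0" if "chain n Q" for n Q
        proof (rule ccontr)
          assume "n \<noteq> 0"
          then obtain k where k: "n = Suc k" using not0_implies_Suc by blast
          hence "Q k \<subset> {0}" "primeideal (Q k) R" using that P0 by (auto simp: chain_def)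
          thus False using zero by blast
        qed
        hence "ideal_height R P \<le> 0" unfolding ht by (intro Sup_least) (auto simp: zero_enat_def)
        thus False using h by simp
      qed
      fix Q assume Q: "primeideal Q R \<and> Q \<noteq> {0} \<and> Q \<subseteq> P"
      show "Q = P"
      proof (rule ccontr)
        assume ne: "Q \<noteq> P"
        have "chain 2 (\<lambda>i. if i = 0 then {0} else if i = 1 then Q else P)"
          unfolding chain_def using Q ne P zero_prime zero by (auto simp: less_2_cases_iff)
        thus False using le by fastforce
      qed
    qed
  next
    assume r: ?rhs
    have "chain 1 (\<lambda>i. if i = 0 then {0} else P)"
      unfolding chain_def using r P zero_prime zero by auto
    hence "enat 1 \<le> ideal_height R P" unfolding ht by (intro Sup_upper) blast
    moreover have "ideal_height R P \<le> enat 1" unfolding ht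
    proof (rule Sup_least)
      fix x assume "x \<in> {enat n | n. \<exists>Q. chain n Q}"
      then obtain n Q where x: "x = enat n" "chain n Q" by blast
      have "n \<le> 1"
      proof (rule ccontr)
        assume "\<not> n \<le> 1"
        then obtain k where k: "n = Suc (Suc k)" by (metis One_nat_def le_SucI le_zero_eq not0_implies_Suc nle_le)
        have c: "Q k \<subset> Q (Suc k)" "Q (Suc k) \<subset> P" "primeideal (Q k) R" "primeideal (Q (Suc k)) R"
          using x(2) k by (auto simp: chain_def)
        have "Q (Suc k) \<noteq> {0}" using c(1) zero[OF c(3)] by auto
        hence "Q (Suc k) = P" using r c(2,4) by (simp add: psubset_imp_subset)
        thus False using c(2) by simp
      qed
      thus "x \<le> enat 1" using x by simp
    qed
    ultimately show "ideal_height R P = 1" by (simp add: one_enat_def)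
  qed
qed

theorem height_one_primes_eq: "height_one_primes R = PI ` I \<union> QI ` {p. prime_in L p}"
proof (intro equalityI subsetI)
  fix P assume "P \<in> height_one_primes R"
  hence P: "primeideal P R" "ideal_height R P = 1" by (auto simp: height_one_primes_def)
  hence r: "P \<noteq> {0}" "\<And>Q. primeideal Q R \<Longrightarrow> Q \<noteq> {0} \<Longrightarrow> Q \<subseteq> P \<Longrightarrow> Q = P"
    using ideal_height_one_iff by auto
  from nonzero_prime_contains[OF P(1) r(1)] show "P \<in> PI ` I \<union> QI ` {p. prime_in L p}"
  proof
    assume "\<exists>i\<in>I. PI i \<subseteq> P"
    then obtain i where i: "i \<in> I" "PI i \<subseteq> P" by blast
    hence "PI i = P" by (intro r(2) PI_prime nonzero_PI)
    thus ?thesis using i by blast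
  next
    assume "\<exists>p. prime_in L p \<and> QI p \<subseteq> P"
    then obtain p where p: "prime_in L p" "QI p \<subseteq> P" by blast
    hence "QI p = P" by (intro r(2) QI_prime nonzero_QI)
    thus ?thesis using p by blast
  qed
next
  fix P assume P: "P \<in> PI ` I \<union> QI ` {p. prime_in L p}"
  have pr: "primeideal P R" using P PI_prime QI_prime by auto
  have "P \<noteq> {0}" using P nonzero_PI nonzero_QI by (metis (no_types) UnE imageE mem_Collect_eq)
  thus "P \<in> height_one_primes R"
    using pr minimal_prime[OF P] ideal_height_one_iff[OF pr] by (simp add: height_one_primes_def)
qed

subsection \<open>Symbolic powers and valuations of height one primes\<close>

text \<open>The monomial of \<open>m\<close> is a uniformizer of the valuation belonging to
  \<open>PI i\<close>.\<close>

lemma unit_in_S: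
  assumes i: "i \<in> I"
  obtains m where "m \<in> S" "l i m = 1"
proof -
  obtain m0 where m0: "m0 \<in> M" "l i m0 = 1" using l_one[OF i] by blast
  obtain c where c: "c \<in> S" "\<And>j. j \<in> I - (I - {i}) \<Longrightarrow> l j c = 0"
    "\<And>k j. k \<in> {m0} \<Longrightarrow> j \<in> I - {i} \<Longrightarrow> 0 \<le> l j (k + c)"
    using shift_exists[of "{m0}" "I - {i}"] m0(1) by (metis Diff_subset empty_subsetI finite.emptyI finite_insert insert_subset)
  have cM: "c \<in> M" using c S_subset by blast
  have li: "l i (m0 + c) = 1" using l_add[OF i m0(1) cM] c(2)[of i] i m0(2) by simp
  have "0 \<le> l j (m0 + c)" if "j \<in> I" for j using c(3)[of m0 j] li that by (cases "j = i") auto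
  hence "m0 + c \<in> S" using m0(1) cM M_add by (simp add: S_eq)
  thus ?thesis using li that by blast
qed

lemma PI_ideal: "i \<in> I \<Longrightarrow> ideal (PI i) R"
  using PI_prime primeideal_iff by blast

lemma QI_ideal: "prime_in L p \<Longrightarrow> ideal (QI p) R"
  using QI_prime primeideal_iff by blast

text \<open>The order along \<open>l i\<close> is additive, and a multiplier outside
  \<open>PI i\<close> has order 0. Conversely, a monomial \<open>X c\<close> with
  \<open>l i c = 0\<close> shifts each exponent of \<open>f\<close> to \<open>n\<close> times
  \<open>m\<close> plus an element of \<open>S\<close>, where \<open>l i m = 1\<close>; so
  \<open>X c * f\<close> is a combination of multiples of \<open>X m ^ n\<close>.\<close>

lemma symbolic_PI:
  assumes i: "i \<in> I" and f: "f \<in> A" "f \<noteq> 0"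
  shows "f \<in> symbolic_power R (PI i) n \<longleftrightarrow> int n \<le> order_along (l i) f"
proof
  have pow: "ideal_pow (PI i) n \<subseteq> {f \<in> A. \<forall>k\<in>Poly_Mapping.keys f. int n \<le> l i k}"
  proof (rule ideal_pow_subset)
    show "A \<subseteq> {f \<in> A. \<forall>k\<in>Poly_Mapping.keys f. int 0 \<le> l i k}" using A_keys i by (auto simp: S_eq)
    fix n x y assume x: "x \<in> {f \<in> A. \<forall>k\<in>Poly_Mapping.keys f. int n \<le> l i k}"
    {
      assume y: "y \<in> PI i"
      have yA: "y \<in> A" using y by (simp add: PI_def)
      have "int (Suc n) \<le> l i k" if k: "k \<in> Poly_Mapping.keys (x * y)" for k
      proof -
        obtain s t where st: "k = s + t" "s \<in> Poly_Mapping.keys x" "t \<in> Poly_Mapping.keys y"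
          using k keys_mult[of x y] by blast
        have "s \<in> M" "t \<in> M" using A_keys x yA st S_subset by blast+
        hence "l i k = l i s + l i t" using l_add[OF i] st(1) by simp
        moreover have "int n \<le> l i s" "1 \<le> l i t" using x y st by (auto simp: PI_def)
        ultimately show ?thesis by simp
      qed
      thus "x * y \<in> {f \<in> A. \<forall>k\<in>Poly_Mapping.keys f. int (Suc n) \<le> l i k}"
        using x yA A_closed by auto
    }
    assume y: "y \<in> {f \<in> A. \<forall>k\<in>Poly_Mapping.keys f. int n \<le> l i k}"
    have "x + y \<in> A" using x y by auto
    thus "x + y \<in> {f \<in> A. \<forall>k\<in>Poly_Mapping.keys f. int n \<le> l i k}"
      using x y keys_add[of x y] by blast
  qed
  assume "f \<in> symbolic_power R (PI i) n"
  then obtain u where u: "u \<in> A" "u \<notin> PI i" "u * f \<in> ideal_pow (PI i) n"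
    by (auto simp: symbolic_power_eq)
  have u0: "u \<noteq> 0" "order_along (l i) u < 1" using u PI_iff[OF i, of u] by auto
  have uf0: "u * f \<noteq> 0"
    using L.no_zero_divisors[OF subsetD[OF A_subset u(1)] subsetD[OF A_subset f(1)]] u0 f by blast
  have "int n \<le> order_along (l i) (u * f)"
    using pow u(3) order_along_ge_iff[OF uf0] by blast
  thus "int n \<le> order_along (l i) f"
    using u0 ord_mult[OF i subsetD[OF A_subset u(1)] subsetD[OF A_subset f(1)] u0(1) f(2)] by simp
next
  assume n: "int n \<le> order_along (l i) f"
  obtain m where m: "m \<in> S" "l i m = 1" using unit_in_S[OF i] .
  have mM: "m \<in> M" using m S_subset by blast
  have nm: "of_nat n *\<^sub>R m \<in> M" "l i (of_nat n *\<^sub>R m) = int n"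
    using nat_scale[OF mM] i m(2) by auto
  have kM: "k \<in> M" if "k \<in> Poly_Mapping.keys f" for k using that A_keys[OF f(1)] S_subset by blast
  let ?K = "(\<lambda>k. k - of_nat n *\<^sub>R m) ` Poly_Mapping.keys f"
  have KM: "?K \<subseteq> M" using kM nm M_diff by auto
  obtain c where c: "c \<in> S" "\<And>j. j \<in> I - (I - {i}) \<Longrightarrow> l j c = 0"
    "\<And>k j. k \<in> ?K \<Longrightarrow> j \<in> I - {i} \<Longrightarrow> 0 \<le> l j (k + c)"
    using shift_exists[OF _ KM, of "I - {i}"] by (metis Diff_subset finite_imageI finite_keys)
  have cM: "c \<in> M" using c S_subset by blast
  have lic: "l i c = 0" using c(2) i by blast
  have "X c * f \<in> ideal_pow (PI i) n"
  proof (rule ideal_contains_by_keys[OF ideal_pow_ideal[OF PI_ideal[OF i]]])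
    fix k' assume "k' \<in> Poly_Mapping.keys (X c * f)"
    then obtain k where k: "k' = k + c" "k \<in> Poly_Mapping.keys f" by (auto simp: keys_X_mult)
    let ?r = "k - of_nat n *\<^sub>R m + c"
    have rM: "?r \<in> M" using k kM nm M_diff M_add cM by blast
    have "0 \<le> l j ?r" if "j \<in> I" for j
    proof (cases "j = i")
      case True
      have "l i ?r = l i k - int n"
        using l_add[OF i M_diff[OF kM[OF k(2)] nm(1)] cM] l_diff[OF i kM[OF k(2)] nm(1)] nm(2) lic by simp
      thus ?thesis using True n order_along_le[OF k(2), of "l i"] by simp
    next
      case False
      thus ?thesis using c(3) k(2) that by blast
    qed
    hence rS: "?r \<in> S" using rM by (simp add: S_eq)
    have "X m \<in> PI i" using m by (auto simp: PI_def)
    hence "X m ^ n \<in> ideal_pow (PI i) n" by (rule power_in_ideal_pow)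
    hence "X ?r * X m ^ n \<in> ideal_pow (PI i) n"
      using idealD(4)[OF ideal_pow_ideal[OF PI_ideal[OF i]]] rS by blast
    moreover have "X ?r * X m ^ n = (X k' :: 'm \<Rightarrow>\<^sub>0 'f)" by (simp add: single_power mult_single k(1))
    ultimately show "X k' \<in> ideal_pow (PI i) n" by simp
  qed
  moreover have "X c \<in> A - PI i" using c(1) lic by (auto simp: PI_def)
  ultimately show "f \<in> symbolic_power R (PI i) n" using f by (auto simp: symbolic_power_eq)
qed

text \<open>A multiplier outside \<open>QI p\<close> does not change the multiplicity of
  \<open>p\<close>. Conversely, one monomial clears the denominators of \<open>p ^ n\<close> and of
  the cofactor together; it is an admissible multiplier because monomials are units in
  \<open>L\<close> and never lie in \<open>QI p\<close>.\<close>

lemma symbolic_QI: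
  assumes p: "prime_in L p" and f: "f \<in> A" "f \<noteq> 0"
  shows "f \<in> symbolic_power R (QI p) n \<longleftrightarrow> dvd_in L (p ^ n) f"
proof
  note pD = prime_inD[OF p]
  have pow: "ideal_pow (QI p) n \<subseteq> {f \<in> A. dvd_in L (p ^ n) f}"
  proof (rule ideal_pow_subset)
    show "A \<subseteq> {f \<in> A. dvd_in L (p ^ 0) f}" using A_subset by (auto simp: dvd_in_def)
    fix n x y assume x: "x \<in> {f \<in> A. dvd_in L (p ^ n) f}"
    {
      assume y: "y \<in> QI p"
      obtain a b where ab: "a \<in> L" "x = p ^ n * a" "b \<in> L" "y = p * b"
        using x y by (auto simp: QI_def dvd_in_def)
      have "x * y = p ^ Suc n * (a * b)" unfolding ab by (simp add: ac_simps)
      hence "dvd_in L (p ^ Suc n) (x * y)" using ab(1,3) L.mult_mem unfolding dvd_in_def by blast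
      thus "x * y \<in> {f \<in> A. dvd_in L (p ^ Suc n) f}" using x y A_closed by (auto simp: QI_def)
    }
    assume "y \<in> {f \<in> A. dvd_in L (p ^ n) f}"
    thus "x + y \<in> {f \<in> A. dvd_in L (p ^ n) f}" using x L.dvd_in_add by auto
  qed
  assume "f \<in> symbolic_power R (QI p) n"
  then obtain u where u: "u \<in> A" "u \<notin> QI p" "u * f \<in> ideal_pow (QI p) n"
    by (auto simp: symbolic_power_eq)
  obtain a g where g: "g \<in> L" "f = p ^ a * g" "\<not> dvd_in L p g"
    using L.prime_power_split[OF p subsetD[OF A_subset f(1)] f(2)] .
  have uL: "u \<in> L" "\<not> dvd_in L p u" using u A_subset by (auto simp: QI_def)
  have ug: "\<not> dvd_in L p (u * g)" using pD(4) uL g by blast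
  have "dvd_in L (p ^ n) (p ^ a * (u * g))" using pow u(3) g(2) by (auto simp: mult.left_commute)
  hence "n \<le> a" using L.power_dvd_in_iff[OF p L.mult_mem[OF uL(1) g(1)] ug] by blast
  thus "dvd_in L (p ^ n) f" using L.power_dvd_in_iff[OF p g(1,3)] g(2) by simp
next
  note pD = prime_inD[OF p]
  assume "dvd_in L (p ^ n) f"
  then obtain g where g: "g \<in> L" "f = p ^ n * g" by (auto simp: dvd_in_def)
  obtain c where c: "c \<in> S" "X c * p \<in> A" using shift_into_A[OF pD(1)] .
  obtain c2 where c2: "c2 \<in> S" "X c2 * g \<in> A" using shift_into_A[OF g(1)] .
  have cM: "c \<in> M" "c2 \<in> M" using c c2 S_subset by auto
  have cp: "X c * p \<in> QI p"
    using c(2) L.dvd_in_mult2[OF L.dvd_in_refl X_mem_L[OF cM(1)]] by (simp add: QI_def)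
  let ?u = "X (of_nat n *\<^sub>R c + c2) :: 'm \<Rightarrow>\<^sub>0 'f"
  have "of_nat n *\<^sub>R c \<in> S" using nat_scale[OF cM(1)] c(1) by (auto simp: S_eq)
  hence uA: "?u \<in> A" using c2 S_add by blast
  have "(X c2 * g) * (X c * p) ^ n \<in> ideal_pow (QI p) n"
    using idealD(4)[OF ideal_pow_ideal[OF QI_ideal[OF p]] c2(2) power_in_ideal_pow[OF cp]] .
  also have "(X c2 * g) * (X c * p) ^ n = (X c ^ n * X c2) * (p ^ n * g)"
    by (simp only: power_mult_distrib ac_simps)
  also have "\<dots> = ?u * f" by (simp add: single_power mult_single g(2))
  finally have "?u * f \<in> ideal_pow (QI p) n" .
  moreover have "?u \<notin> QI p" using X_not_in_QI[OF p] nat_scale[OF cM(1)] cM(2) M_add by blast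
  ultimately show "f \<in> symbolic_power R (QI p) n" using f uA by (auto simp: symbolic_power_eq)
qed

lemma prime_valuation_eqI:
  assumes "\<And>n. f \<in> symbolic_power R Q n \<longleftrightarrow> n \<le> v"
  shows "prime_valuation R Q f = v"
  unfolding prime_valuation_def assms by (rule Greatest_equality) auto

lemma valuation_PI:
  assumes "i \<in> I" "f \<in> A" "f \<noteq> 0"
  shows "prime_valuation R (PI i) f = nat (order_along (l i) f)"
  by (rule prime_valuation_eqI) (simp add: symbolic_PI[OF assms] le_nat_iff[OF ord_nonneg[OF assms]])

lemma valuation_QI:
  assumes p: "prime_in L p" and f: "p ^ n * g \<in> A" "g \<in> L" "\<not> dvd_in L p g"
  shows "prime_valuation R (QI p) (p ^ n * g) = n"
proof (rule prime_valuation_eqI)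
  fix k
  have "g \<noteq> 0" using f(3) L.dvd_in_zero by blast
  hence "p ^ n * g \<noteq> 0"
    using L.no_zero_divisors L.power_nonzero L.power_mem f(2) prime_inD(1,2)[OF p] by blast
  thus "p ^ n * g \<in> symbolic_power R (QI p) k \<longleftrightarrow> k \<le> n"
    using symbolic_QI[OF p f(1)] L.power_dvd_in_iff[OF p f(2,3)] by blast
qed

lemma symbolic_power_iff_valuation:
  assumes Q: "Q \<in> height_one_primes R" and f: "f \<in> A" "f \<noteq> 0"
  shows "f \<in> symbolic_power R Q n \<longleftrightarrow> n \<le> prime_valuation R Q f"
proof -
  consider i where "i \<in> I" "Q = PI i" | p where "prime_in L p" "Q = QI p"
    using Q unfolding height_one_primes_eq by blast
  thus ?thesis
  proof cases
    case 1
    thus ?thesis using symbolic_PI[OF 1(1) f] valuation_PI[OF 1(1) f] ord_nonneg[OF 1(1) f]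
      by (simp add: le_nat_iff)
  next
    case 2
    obtain a g where g: "g \<in> L" "f = p ^ a * g" "\<not> dvd_in L p g"
      using L.prime_power_split[OF 2(1) subsetD[OF A_subset f(1)] f(2)] .
    have "prime_valuation R Q f = a" using valuation_QI[OF 2(1)] g f(1) 2(2) by blast
    thus ?thesis using symbolic_QI[OF 2(1) f] L.power_dvd_in_iff[OF 2(1) g(1,3)] g(2) 2(2) by simp
  qed
qed

lemma valuation_mult:
  assumes Q: "Q \<in> height_one_primes R" and f: "f \<in> A" "f \<noteq> 0" and g: "g \<in> A" "g \<noteq> 0"
  shows "prime_valuation R Q (f * g) = prime_valuation R Q f + prime_valuation R Q g"
proof -
  have fg: "f * g \<in> A" "f * g \<noteq> 0"
    using f g L.no_zero_divisors[OF subsetD[OF A_subset f(1)] subsetD[OF A_subset g(1)]] by auto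
  consider i where "i \<in> I" "Q = PI i" | p where "prime_in L p" "Q = QI p"
    using Q unfolding height_one_primes_eq by blast
  thus ?thesis
  proof cases
    case 1
    have "order_along (l i) (f * g) = order_along (l i) f + order_along (l i) g"
      using ord_mult[OF 1(1)] f g A_subset by blast
    thus ?thesis
      using 1(2) valuation_PI[OF 1(1) f] valuation_PI[OF 1(1) g] valuation_PI[OF 1(1) fg]
        ord_nonneg[OF 1(1) f] ord_nonneg[OF 1(1) g] by simp
  next
    case 2
    obtain a f' where f': "f' \<in> L" "f = p ^ a * f'" "\<not> dvd_in L p f'"
      using L.prime_power_split[OF 2(1) subsetD[OF A_subset f(1)] f(2)] .
    obtain b g' where g': "g' \<in> L" "g = p ^ b * g'" "\<not> dvd_in L p g'"
      using L.prime_power_split[OF 2(1) subsetD[OF A_subset g(1)] g(2)] .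
    have eq: "f * g = p ^ (a + b) * (f' * g')" unfolding f'(2) g'(2) power_add by (simp only: ac_simps)
    have ndvd: "\<not> dvd_in L p (f' * g')" using prime_inD(4)[OF 2(1)] f' g' by blast
    have "prime_valuation R Q (f * g) = a + b"
      unfolding eq 2(2) by (rule valuation_QI[OF 2(1) _ L.mult_mem[OF f'(1) g'(1)] ndvd]) (use fg eq in simp)
    moreover have "prime_valuation R Q f = a" using valuation_QI[OF 2(1)] f' f(1) 2(2) by blast
    moreover have "prime_valuation R Q g = b" using valuation_QI[OF 2(1)] g' g(1) 2(2) by blast
    ultimately show ?thesis by simp
  qed
qed

text \<open>This amounts to \<open>Q\<close> being its own first symbolic power.\<close>

lemma symbolic_power_one:
  assumes Q: "Q \<in> height_one_primes R" and f: "f \<in> A" "f \<noteq> 0"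
  shows "f \<in> Q \<longleftrightarrow> 1 \<le> prime_valuation R Q f"
proof -
  consider i where "i \<in> I" "Q = PI i" | p where "prime_in L p" "Q = QI p"
    using Q unfolding height_one_primes_eq by blast
  hence "f \<in> symbolic_power R Q 1 \<longleftrightarrow> f \<in> Q"
  proof cases
    case 1
    thus ?thesis using symbolic_PI[OF 1(1) f, of 1] PI_iff[OF 1(1)] f by simp
  next
    case 2
    thus ?thesis using symbolic_QI[OF 2(1) f, of 1] f by (simp add: QI_def)
  qed
  thus ?thesis using symbolic_power_iff_valuation[OF Q f] by simp
qed

text \<open>\<open>R\<close> is the intersection of its localizations at height one primes.\<close>

lemma divides_by_valuations:
  assumes f: "f \<in> A" "f \<noteq> 0" and g: "g \<in> A" "g \<noteq> 0"
    and le: "\<And>Q. Q \<in> height_one_primes R \<Longrightarrow> prime_valuation R Q g \<le> prime_valuation R Q f"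
  obtains h where "h \<in> A" "h \<noteq> 0" "f = g * h"
proof -
  have fL: "f \<in> L" and gL: "g \<in> L" using f g A_subset by auto
  obtain m where m: "prime_product L m g" using L.factorization gL g(2) by blast
  have "dvd_in L g f"
  proof (rule L.dvd_in_by_prime_powers[OF m fL f(2)])
    fix q n assume q: "prime_in L q" "dvd_in L (q ^ n) g"
    have Q: "QI q \<in> height_one_primes R" unfolding height_one_primes_eq using q by blast
    have "n \<le> prime_valuation R (QI q) g"
      using symbolic_QI[OF q(1) g] symbolic_power_iff_valuation[OF Q g] q(2) by blast
    hence "n \<le> prime_valuation R (QI q) f" using le[OF Q] by simp
    thus "dvd_in L (q ^ n) f"
      using symbolic_QI[OF q(1) f] symbolic_power_iff_valuation[OF Q f] by blast
  qed
  then obtain h where h: "h \<in> L" "f = g * h" by (auto simp: dvd_in_def)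
  have h0: "h \<noteq> 0" using h f by auto
  \<comment> \<open>The prime elements of \<open>L\<close> produced a quotient in \<open>L\<close>;
    the valuations of the facet primes put it into \<open>A\<close>.\<close>
  have "0 \<le> order_along (l i) h" if i: "i \<in> I" for i
  proof -
    have "PI i \<in> height_one_primes R" unfolding height_one_primes_eq using i by blast
    hence "nat (order_along (l i) g) \<le> nat (order_along (l i) f)"
      using le valuation_PI[OF i f] valuation_PI[OF i g] by metis
    hence "order_along (l i) g \<le> order_along (l i) f"
      using ord_nonneg[OF i f] ord_nonneg[OF i g] by simp
    thus ?thesis using ord_mult[OF i gL h(1) g(2) h0] h(2) by simp
  qed
  hence "h \<in> A" using mem_A_iff[OF h(1) h0] by blast
  thus ?thesis using that h(2) h0 by blast
qed

lemma valuation_power: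
  assumes Q: "Q \<in> height_one_primes R" and h: "h \<in> A" "h \<noteq> 0"
  shows "prime_valuation R Q (h ^ n) = n * prime_valuation R Q h"
proof (induction n)
  case 0
  have "prime_valuation R Q (1 * 1) = prime_valuation R Q 1 + prime_valuation R Q 1"
    by (rule valuation_mult[OF Q]) auto
  thus ?case by simp
next
  case (Suc n)
  have "h ^ n \<in> A" "h ^ n \<noteq> 0"
    using A_power[OF h(1)] L.power_nonzero[OF subsetD[OF A_subset h(1)] h(2)] by auto
  thus ?case using valuation_mult[OF Q h] Suc by simp
qed

subsection \<open>The divisor class group\<close>

abbreviation Div :: "(('m \<Rightarrow>\<^sub>0 'f) set \<Rightarrow>\<^sub>0 int) monoid" where
  "Div \<equiv> free_Abelian_group (height_one_primes R)"

lemma principal_divisors_iff: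
  "x \<in> principal_divisors R \<longleftrightarrow> Poly_Mapping.keys x \<subseteq> height_one_primes R \<and>
     (\<exists>f\<in>A - {0}. \<exists>g\<in>A - {0}. \<forall>P\<in>height_one_primes R.
        Poly_Mapping.lookup x P = int (prime_valuation R P f) - int (prime_valuation R P g))"
  by (simp add: principal_divisors_def)

lemma principal_divisorsI:
  assumes "Poly_Mapping.keys x \<subseteq> height_one_primes R" "f \<in> A" "f \<noteq> 0" "g \<in> A" "g \<noteq> 0"
    and "\<And>P. P \<in> height_one_primes R \<Longrightarrow>
        Poly_Mapping.lookup x P = int (prime_valuation R P f) - int (prime_valuation R P g)"
  shows "x \<in> principal_divisors R"
  using assms unfolding principal_divisors_iff by blast

lemma principal_divisors_subgroup: "subgroup (principal_divisors R) Div"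
proof (rule group.subgroupI[OF group_free_Abelian_group])
  show "principal_divisors R \<subseteq> carrier Div" by (auto simp: principal_divisors_iff)
  have "0 \<in> principal_divisors R" by (rule principal_divisorsI[of _ 1 1]) auto
  thus "principal_divisors R \<noteq> {}" by blast
  fix a assume a: "a \<in> principal_divisors R"
  then obtain f g where fg: "f \<in> A - {0}" "g \<in> A - {0}" "\<forall>P\<in>height_one_primes R.
      Poly_Mapping.lookup a P = int (prime_valuation R P f) - int (prime_valuation R P g)"
    by (auto simp: principal_divisors_iff)
  have ka: "Poly_Mapping.keys a \<subseteq> height_one_primes R" using a by (simp add: principal_divisors_iff)
  have "- a \<in> principal_divisors R"
    by (rule principal_divisorsI[of _ g f]) (use ka fg in auto)
  thus "inv\<^bsub>Div\<^esub> a \<in> principal_divisors R" using ka by simp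
  fix b assume b: "b \<in> principal_divisors R"
  then obtain f' g' where fg': "f' \<in> A - {0}" "g' \<in> A - {0}" "\<forall>P\<in>height_one_primes R.
      Poly_Mapping.lookup b P = int (prime_valuation R P f') - int (prime_valuation R P g')"
    by (auto simp: principal_divisors_iff)
  have nz: "f * f' \<in> A - {0}" "g * g' \<in> A - {0}"
    using fg(1,2) fg'(1,2) L.no_zero_divisors[of f f'] L.no_zero_divisors[of g g'] A_subset by auto
  have "a + b \<in> principal_divisors R"
  proof (rule principal_divisorsI[of _ "f * f'" "g * g'"])
    show "Poly_Mapping.keys (a + b) \<subseteq> height_one_primes R"
      using ka b keys_add[of a b] by (auto simp: principal_divisors_iff)
    fix P assume P: "P \<in> height_one_primes R"
    have "prime_valuation R P (f * f') = prime_valuation R P f + prime_valuation R P f'"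
      "prime_valuation R P (g * g') = prime_valuation R P g + prime_valuation R P g'"
      using valuation_mult[OF P] fg(1,2) fg'(1,2) by auto
    thus "Poly_Mapping.lookup (a + b) P =
        int (prime_valuation R P (f * f')) - int (prime_valuation R P (g * g'))"
      using fg(3) fg'(3) P by (simp add: lookup_add)
  qed (use nz in auto)
  thus "a \<otimes>\<^bsub>Div\<^esub> b \<in> principal_divisors R" by simp
qed

lemma principal_divisors_normal: "principal_divisors R \<lhd> Div"
  by (rule comm_group.subgroup_imp_normal[OF abelian_free_Abelian_group principal_divisors_subgroup])

lemma principal_add: "a \<in> principal_divisors R \<Longrightarrow> b \<in> principal_divisors R \<Longrightarrow> a + b \<in> principal_divisors R"
  using subgroup.m_closed[OF principal_divisors_subgroup] by simp

lemma principal_uminus: "a \<in> principal_divisors R \<Longrightarrow> - a \<in> principal_divisors R"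
  using subgroup.m_inv_closed[OF principal_divisors_subgroup, of a] by (auto simp: principal_divisors_iff)

lemma principal_zero: "0 \<in> principal_divisors R"
  using subgroup.one_closed[OF principal_divisors_subgroup] by simp

lemma principal_sum: "(\<And>j. j \<in> J \<Longrightarrow> h j \<in> principal_divisors R) \<Longrightarrow> sum h J \<in> principal_divisors R"
  by (induction J rule: infinite_finite_induct) (auto simp: principal_zero principal_add)

lemma principal_cmul: "a \<in> principal_divisors R \<Longrightarrow> frag_cmul n a \<in> principal_divisors R"
proof -
  assume a: "a \<in> principal_divisors R"
  have nat: "frag_cmul (int k) a \<in> principal_divisors R" for k
    by (induction k) (use a in \<open>auto simp: principal_zero frag_cmul_distrib intro: principal_add\<close>)
  show ?thesis
  proof (cases n rule: int_cases2)
    case (nonneg k)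
    thus ?thesis using nat by simp
  next
    case (nonpos k)
    have "- frag_cmul (int k) a \<in> principal_divisors R" by (rule principal_uminus[OF nat])
    thus ?thesis using nonpos by simp
  qed
qed

lemma annihilates_imp_principal:
  assumes D: "annihilates_class_group D R" and Q: "Q \<in> height_one_primes R"
  shows "frag_cmul (int D) (frag_of Q) \<in> principal_divisors R"
proof -
  let ?H = "principal_divisors R"
  interpret normal ?H Div by (rule principal_divisors_normal)
  have q: "frag_of Q \<in> carrier Div" using Q by simp
  have cin: "?H #>\<^bsub>Div\<^esub> frag_of Q \<in> carrier (divisor_class_group R)"
    unfolding divisor_class_group_def carrier_FactGroup using q by blast
  have "(?H #>\<^bsub>Div\<^esub> frag_of Q) [^]\<^bsub>divisor_class_group R\<^esub> D = \<one>\<^bsub>divisor_class_group R\<^esub>"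
    using D cin unfolding annihilates_class_group_def by blast
  hence "?H #>\<^bsub>Div\<^esub> (frag_of Q [^]\<^bsub>Div\<^esub> D) = ?H"
    unfolding divisor_class_group_def FactGroup_pow[OF q] one_FactGroup .
  hence "?H #>\<^bsub>Div\<^esub> frag_cmul (int D) (frag_of Q) = ?H" by simp
  moreover have "frag_cmul (int D) (frag_of Q) \<in> carrier Div" using Q keys_cmul[of "int D" "frag_of Q"] by auto
  ultimately show ?thesis by (rule coset_join1[OF _ _ principal_divisors_subgroup])
qed

text \<open>If \<open>D [Q]\<close> is principal, then \<open>Q\<^bsup>(D n + k)\<^esup> = h\<^sup>n Q\<^bsup>(k)\<^esup>\<close> for a generator \<open>h\<close> of \<open>Q\<^bsup>(D)\<^esup>\<close>.\<close>

theorem height_one_containment: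
  assumes Q: "Q \<in> height_one_primes R" and D: "annihilates_class_group D R" "D > 0"
    and DT: "D \<le> T" and r: "r > 0"
  shows "symbolic_power R Q (T * (r - 1) + 1) \<subseteq> ideal_pow Q r"
proof
  fix F assume F: "F \<in> symbolic_power R Q (T * (r - 1) + 1)"
  hence FA: "F \<in> A" by (simp add: symbolic_power_eq)
  have id: "ideal Q R" using Q by (simp add: height_one_primes_def primeideal_iff)
  obtain f g where fg: "f \<in> A - {0}" "g \<in> A - {0}" "\<And>P. P \<in> height_one_primes R \<Longrightarrow>
      Poly_Mapping.lookup (frag_cmul (int D) (frag_of Q)) P = int (prime_valuation R P f) - int (prime_valuation R P g)"
    using annihilates_imp_principal[OF D(1) Q] unfolding principal_divisors_iff by blast
  have val: "int (prime_valuation R P f) = int (prime_valuation R P g) + (if P = Q then int D else 0)"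
    if "P \<in> height_one_primes R" for P
    using fg(3)[OF that] by (simp split: if_splits)
  have fg': "f \<in> A" "f \<noteq> 0" "g \<in> A" "g \<noteq> 0" using fg by auto
  have "prime_valuation R P g \<le> prime_valuation R P f" if "P \<in> height_one_primes R" for P
    using val[OF that] by (simp split: if_splits)
  \<comment> \<open>The divisor of \<open>f / g\<close> is \<open>D [Q]\<close>, which is effective,
    so the fraction is an element \<open>h\<close> of \<open>R\<close> with exactly this
    divisor.\<close>
  from divides_by_valuations[OF fg' this] obtain h where h: "h \<in> A" "h \<noteq> 0" "f = g * h" .
  have vh: "prime_valuation R P h = (if P = Q then D else 0)" if P: "P \<in> height_one_primes R" for P
    using val[OF P] valuation_mult[OF P fg'(3,4) h(1,2)] h(3) by (simp split: if_splits)
  have hQ: "h \<in> Q" using symbolic_power_one[OF Q h(1,2)] vh[OF Q] D(2) by simp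
  show "F \<in> ideal_pow Q r"
  proof (cases "F = 0")
    case True
    thus ?thesis using idealD(2)[OF ideal_pow_ideal[OF id]] by simp
  next
    case False
    have hr: "h ^ (r - 1) \<in> A" "h ^ (r - 1) \<noteq> 0"
      using A_power[OF h(1)] L.power_nonzero[OF subsetD[OF A_subset h(1)] h(2)] by auto
    have vF: "T * (r - 1) + 1 \<le> prime_valuation R Q F"
      using F symbolic_power_iff_valuation[OF Q FA False] by blast
    have vhr: "prime_valuation R P (h ^ (r - 1)) = (if P = Q then (r - 1) * D else 0)"
      if "P \<in> height_one_primes R" for P
      using valuation_power[OF that h(1,2)] vh[OF that] by simp
    have le: "(r - 1) * D + 1 \<le> prime_valuation R Q F"
    proof -
      have "(r - 1) * D \<le> T * (r - 1)" by (subst mult.commute) (rule mult_le_mono1[OF DT])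
      thus ?thesis using vF by linarith
    qed
    have "prime_valuation R P (h ^ (r - 1)) \<le> prime_valuation R P F" if "P \<in> height_one_primes R" for P
      using vhr[OF that] le by (simp split: if_splits)
    from divides_by_valuations[OF FA False hr this] obtain G where
      G: "G \<in> A" "G \<noteq> 0" "F = h ^ (r - 1) * G" .
    \<comment> \<open>Dividing by \<open>h ^ (r - 1)\<close> uses up \<open>(r - 1) * D\<close> of
      the valuation, and the summand 1 is left for \<open>G\<close>. This makes \<open>r - 1\<close>
      factors \<open>h\<close> and one factor \<open>G\<close>, all in \<open>Q\<close>.\<close>
    have "1 \<le> prime_valuation R Q G"
      using valuation_mult[OF Q hr G(1,2)] G(3) vhr[OF Q] le by simp
    hence "G \<in> Q" using symbolic_power_one[OF Q G(1,2)] by blast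
    hence "h ^ (r - 1) * G \<in> ideal_pow Q (Suc (r - 1))"
      by (rule ideal_pow_mult[OF power_in_ideal_pow[OF hQ]])
    thus ?thesis using G(3) r by simp
  qed
qed

section \<open>Torus-invariant divisors and finiteness of the class group\<close>

definition div_PI :: "('i \<Rightarrow> int) \<Rightarrow> (('m \<Rightarrow>\<^sub>0 'f) set \<Rightarrow>\<^sub>0 int)" where
  "div_PI a = (\<Sum>i\<in>I. frag_cmul (a i) (frag_of (PI i)))"

lemma PI_height_one: "i \<in> I \<Longrightarrow> PI i \<in> height_one_primes R"
  unfolding height_one_primes_eq by blast

lemma PI_eq_iff: "i \<in> I \<Longrightarrow> j \<in> I \<Longrightarrow> PI i = PI j \<longleftrightarrow> i = j"
  using PI_subset_PI by blast

lemma PI_neq_QI: "i \<in> I \<Longrightarrow> prime_in L p \<Longrightarrow> PI i \<noteq> QI p"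
  using PI_not_subset_QI by blast

lemma keys_div_PI: "Poly_Mapping.keys (div_PI a) \<subseteq> height_one_primes R"
proof -
  have "div_PI a \<in> carrier Div" unfolding div_PI_def
  proof (rule sum_closed_free_Abelian_group)
    fix i assume "i \<in> I"
    thus "frag_cmul (a i) (frag_of (PI i)) \<in> carrier Div"
      using keys_cmul[of "a i" "frag_of (PI i)"] PI_height_one by auto
  qed
  thus ?thesis by simp
qed

lemma lookup_div_PI:
  "j \<in> I \<Longrightarrow> Poly_Mapping.lookup (div_PI a) (PI j) = a j"
  "prime_in L p \<Longrightarrow> Poly_Mapping.lookup (div_PI a) (QI p) = 0"
proof -
  assume j: "j \<in> I"
  have "Poly_Mapping.lookup (div_PI a) (PI j) = (\<Sum>i\<in>I. if i = j then a i else 0)"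
    unfolding div_PI_def lookup_sum by (intro sum.cong refl) (use j PI_eq_iff in auto)
  thus "Poly_Mapping.lookup (div_PI a) (PI j) = a j" using j I_finite by simp
next
  assume p: "prime_in L p"
  show "Poly_Mapping.lookup (div_PI a) (QI p) = 0"
    unfolding div_PI_def lookup_sum by (intro sum.neutral ballI) (use p PI_neq_QI in auto)
qed

lemma div_PI_diff: "div_PI a - div_PI b = div_PI (\<lambda>i. a i - b i)"
  unfolding div_PI_def sum_subtractf[symmetric] by (simp add: frag_cmul_diff_distrib)

lemma valuation_one: "Q \<in> height_one_primes R \<Longrightarrow> prime_valuation R Q 1 = 0"
  using valuation_power[of Q 1 0] by auto

text \<open>The monomial \<open>X (w i)\<close> has value \<open>d\<close> at \<open>PI i\<close>,
  value 0 at the other facets, and is a unit in \<open>L\<close>, so its divisor is \<open>d\<close>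
  times \<open>PI i\<close>.\<close>

lemma d_PI_principal:
  assumes i: "i \<in> I"
  shows "frag_cmul d (frag_of (PI i)) \<in> principal_divisors R"
proof -
  have wA: "X (w i) \<in> A" "X (w i) \<noteq> (0::'m \<Rightarrow>\<^sub>0 'f)" using w_in_S[OF i] X_nonzero by auto
  show ?thesis
  proof (rule principal_divisorsI[of _ "X (w i)" 1])
    show "Poly_Mapping.keys (frag_cmul d (frag_of (PI i))) \<subseteq> height_one_primes R"
      using keys_cmul[of d "frag_of (PI i)"] PI_height_one[OF i] by auto
    fix P assume P: "P \<in> height_one_primes R"
    consider j where "j \<in> I" "P = PI j" | p where "prime_in L p" "P = QI p"
      using P unfolding height_one_primes_eq by blast
    thus "Poly_Mapping.lookup (frag_cmul d (frag_of (PI i))) P =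
        int (prime_valuation R P (X (w i))) - int (prime_valuation R P 1)"
    proof cases
      case 1
      have "prime_valuation R P (X (w i)) = nat (l j (w i))"
        using valuation_PI[OF 1(1) wA] 1(2) ord_X by simp
      thus ?thesis using valuation_one[OF P] 1 PI_eq_iff[OF i 1(1)] l_w[OF i 1(1)] d_pos by auto
    next
      case 2
      have "X (w i) \<notin> P" using X_not_in_QI[OF 2(1) w_mem[OF i]] 2(2) by blast
      hence "prime_valuation R P (X (w i)) = 0" using symbolic_power_one[OF P wA] by simp
      thus ?thesis using valuation_one[OF P] 2 PI_neq_QI[OF i 2(1)] by auto
    qed
  qed (use wA in auto)
qed

text \<open>The contracted prime becomes principal in \<open>L\<close>: the divisor of
  \<open>X c * p\<close> is \<open>QI p\<close> plus a combination of facet primes, and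
  \<open>a\<close> records the negatives of these coefficients.\<close>

lemma QI_equivalent_to_div_PI:
  assumes p: "prime_in L p"
  obtains a where "frag_of (QI p) - div_PI a \<in> principal_divisors R"
proof -
  note pD = prime_inD[OF p]
  obtain c where c: "c \<in> S" "X c * p \<in> A" using shift_into_A[OF pD(1)] .
  have cM: "c \<in> M" using c S_subset by blast
  define f where "f = X c * p"
  have f: "f \<in> A" "f \<noteq> 0"
    unfolding f_def using c L.no_zero_divisors[OF X_mem_L[OF cM] pD(1)] X_nonzero pD(2) by auto
  define a where "a = (\<lambda>i. - int (prime_valuation R (PI i) f))"
  have "frag_of (QI p) - div_PI a \<in> principal_divisors R"
  proof (rule principal_divisorsI[of _ f 1])
    have "QI p \<in> height_one_primes R" unfolding height_one_primes_eq using p by blast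
    thus "Poly_Mapping.keys (frag_of (QI p) - div_PI a) \<subseteq> height_one_primes R"
      using keys_diff[of "frag_of (QI p)" "div_PI a"] keys_div_PI[of a] by auto
    fix P assume P: "P \<in> height_one_primes R"
    consider j where "j \<in> I" "P = PI j" | q where "prime_in L q" "P = QI q"
      using P unfolding height_one_primes_eq by blast
    thus "Poly_Mapping.lookup (frag_of (QI p) - div_PI a) P =
        int (prime_valuation R P f) - int (prime_valuation R P 1)"
    proof cases
      case 1
      thus ?thesis using valuation_one[OF P] lookup_div_PI(1)[OF 1(1)] PI_neq_QI[OF 1(1) p]
        by (auto simp: lookup_minus a_def)
    next
      case 2
      have "prime_valuation R P f = (if QI p = P then 1 else 0)"
      proof (cases "QI p = P")
        case True
        have "X c * (1::'m \<Rightarrow>\<^sub>0 'f) = X c" by simp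
        hence nd: "\<not> dvd_in L p (X c)" using dvd_X_mult[of p c 1] cM pD(3) by auto
        have "f = p ^ 1 * X c" by (simp add: f_def mult.commute)
        hence "prime_valuation R (QI p) f = 1" using valuation_QI[OF p _ X_mem_L[OF cM] nd] f by metis
        thus ?thesis using True by simp
      next
        case False
        have "f \<notin> P"
        proof
          assume "f \<in> P"
          hence "dvd_in L q p" using 2 dvd_X_mult[OF _ cM] by (auto simp: QI_def f_def)
          hence "QI p \<subseteq> QI q" using L.dvd_in_trans by (auto simp: QI_def)
          thus False using QI_subset_QI[OF 2(1) p] 2(2) False by blast
        qed
        thus ?thesis using False symbolic_power_one[OF P f] by simp
      qed
      thus ?thesis using valuation_one[OF P] lookup_div_PI(2)[OF 2(1)] 2(2)
        by (auto simp: lookup_minus)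
    qed
  qed (use f in auto)
  thus ?thesis using that by blast
qed

lemma divisor_equivalent_to_div_PI:
  assumes "Poly_Mapping.keys x \<subseteq> height_one_primes R"
  shows "\<exists>a. x - div_PI a \<in> principal_divisors R"
proof (rule free_Abelian_group_induct[OF assms])
  have "div_PI (\<lambda>_. 0) = 0" by (simp add: div_PI_def)
  thus "\<exists>a. 0 - div_PI a \<in> principal_divisors R" using principal_zero by (intro exI[of _ "\<lambda>_. 0"]) simp
next
  fix x y
  assume "\<exists>a. x - div_PI a \<in> principal_divisors R" "\<exists>a. y - div_PI a \<in> principal_divisors R"
  then obtain a b where ab: "x - div_PI a \<in> principal_divisors R" "y - div_PI b \<in> principal_divisors R"
    by blast
  have "(x - div_PI a) + - (y - div_PI b) \<in> principal_divisors R"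
    using ab principal_add principal_uminus by blast
  also have "(x - div_PI a) + - (y - div_PI b) = (x - y) - (div_PI a - div_PI b)" by simp
  finally show "\<exists>a. x - y - div_PI a \<in> principal_divisors R" unfolding div_PI_diff by blast
next
  fix Q assume "Q \<in> height_one_primes R"
  then consider i where "i \<in> I" "Q = PI i" | p where "prime_in L p" "Q = QI p"
    unfolding height_one_primes_eq by blast
  thus "\<exists>a. frag_of Q - div_PI a \<in> principal_divisors R"
  proof cases
    case 1
    have "div_PI (\<lambda>j. if j = i then 1 else 0) = (\<Sum>j\<in>I. if j = i then frag_of (PI i) else 0)"
      unfolding div_PI_def by (intro sum.cong refl) auto
    also have "\<dots> = frag_of Q" using 1 I_finite by simp
    finally show ?thesis using principal_zero by (intro exI[of _ "\<lambda>j. if j = i then 1 else 0"]) simp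
  next
    case 2
    thus ?thesis using QI_equivalent_to_div_PI by blast
  qed
qed

theorem divisor_class_group_finite: "finite (carrier (divisor_class_group R))"
proof -
  let ?H = "principal_divisors R"
  interpret normal ?H Div by (rule principal_divisors_normal)
  let ?N = "PiE I (\<lambda>_. {0..<d})"
  have "carrier (divisor_class_group R) \<subseteq> (\<lambda>a. ?H #>\<^bsub>Div\<^esub> div_PI a) ` ?N"
  proof
    fix c assume "c \<in> carrier (divisor_class_group R)"
    then obtain x where x: "x \<in> carrier Div" "c = ?H #>\<^bsub>Div\<^esub> x"
      unfolding divisor_class_group_def carrier_FactGroup by blast
    obtain a where a: "x - div_PI a \<in> ?H" using divisor_equivalent_to_div_PI x(1) by auto
    define b where "b = restrict (\<lambda>i. a i mod d) I"
    \<comment> \<open>Reducing the coefficients modulo \<open>d\<close> changes the divisor by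
      multiples of the principal divisors \<open>d\<close> times \<open>PI i\<close>, so the
      finitely many reduced coefficient families represent all classes.\<close>
    have "div_PI a - div_PI b = (\<Sum>i\<in>I. frag_cmul (a i div d) (frag_cmul d (frag_of (PI i))))"
      unfolding div_PI_diff unfolding div_PI_def
      by (intro sum.cong refl) (simp add: b_def minus_mod_eq_div_mult)
    also have "\<dots> \<in> ?H" by (intro principal_sum principal_cmul d_PI_principal)
    finally have "(x - div_PI a) + (div_PI a - div_PI b) \<in> ?H" using a principal_add by blast
    hence "x - div_PI b \<in> ?H" by simp
    hence "(x - div_PI b) \<otimes>\<^bsub>Div\<^esub> div_PI b \<in> ?H #>\<^bsub>Div\<^esub> div_PI b"
      by (auto simp: r_coset_def intro!: bexI[of _ "x - div_PI b"])
    hence "x \<in> ?H #>\<^bsub>Div\<^esub> div_PI b" by simp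
    hence "?H #>\<^bsub>Div\<^esub> div_PI b = ?H #>\<^bsub>Div\<^esub> x"
      by (rule repr_independence[OF _ _ principal_divisors_subgroup]) (use keys_div_PI in auto)
    moreover have "b \<in> ?N" using d_pos by (auto simp: b_def)
    ultimately show "c \<in> (\<lambda>a. ?H #>\<^bsub>Div\<^esub> div_PI a) ` ?N" using x(2) by blast
  qed
  moreover have "finite ?N" using I_finite by (intro finite_PiE) auto
  ultimately show ?thesis using finite_surj by blast
qed

lemma divisor_class_group_group: "group (divisor_class_group R)"
  unfolding divisor_class_group_def by (rule normal.factorgroup_is_group[OF principal_divisors_normal])

theorem order_annihilates_class_group:
  "annihilates_class_group (card (carrier (divisor_class_group R))) R"
  using group.pow_order_eq_1[OF divisor_class_group_group]
  by (simp add: annihilates_class_group_def order_def)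

theorem card_divisor_class_group: "card (carrier (divisor_class_group R)) > 0"
  using divisor_class_group_finite group.is_monoid[OF divisor_class_group_group]
    monoid.one_closed card_gt_0_iff by (metis empty_iff)

subsection \<open>The minimal generating set\<close>

text \<open>An element with \<open>d < l i b\<close> splits as \<open>w i + (b - w i)\<close> in \<open>S\<close>, hence is redundant.\<close>

lemma minimal_generator_bounded:
  assumes B: "minimal_generating_set B S" and b: "b \<in> B" and i: "i \<in> I"
  shows "l i b \<le> d"
proof (rule ccontr)
  assume "\<not> l i b \<le> d"
  hence lb: "d < l i b" by simp
  have gen: "semigroup_generated B = S" using B by (simp add: minimal_generating_set_def)
  have bS: "b \<in> S" using semigroup_generated_base[OF b] gen by simp
  hence bM: "b \<in> M" using S_subset by blast
  define c where "c = b - w i"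
  have cM: "c \<in> M" unfolding c_def using bM w_mem[OF i] M_diff by blast
  have lc: "l j c = l j b - (if i = j then d else 0)" if "j \<in> I" for j
    unfolding c_def using l_diff[OF that bM w_mem[OF i]] l_w[OF i that] by simp
  have cS: "c \<in> S" using cM lc lb bS unfolding S_eq by auto
  have lci: "l i c > 0" using lc[OF i] lb by simp
  have lwi: "l i (w i) > 0" using l_w[OF i i] d_pos by simp
  have bc: "b = w i + c" by (simp add: c_def)
  \<comment> \<open>If an expression of \<open>x\<close> used \<open>b\<close>, then
    \<open>x = b + x'\<close> and hence \<open>x' + y = 0\<close>, although \<open>l i\<close> is
    nonnegative on \<open>x'\<close> and positive on \<open>y\<close>.\<close>
  have avoid: "x \<in> semigroup_generated (B - {b})"
    if xy: "x \<in> S" "y \<in> S" "b = x + y" "l i y > 0" for x y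
  proof -
    obtain xs where xs: "x = sum_list xs" "set xs \<subseteq> B"
      using xy(1) gen unfolding semigroup_generated_def by blast
    have "b \<notin> set xs"
    proof
      assume "b \<in> set xs"
      then obtain ys zs where split: "xs = ys @ b # zs" by (meson split_list)
      define x' where "x' = sum_list ys + sum_list zs"
      have "x' \<in> semigroup_generated B" unfolding semigroup_generated_def x'_def
        using xs(2) split by (intro CollectI exI[of _ "ys @ zs"]) auto
      hence x'S: "x' \<in> S" using gen by simp
      have "x = b + x'" using xs(1) split by (simp add: x'_def algebra_simps)
      hence "x' + y = 0" using xy(3) by (simp add: add.commute)
      hence "l i x' + l i y = 0" using l_add[OF i, of x' y] l_zero[OF i] x'S xy(2) S_subset by auto
      moreover have "0 \<le> l i x'" using x'S i by (simp add: S_eq)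
      ultimately show False using xy(4) by simp
    qed
    hence "set xs \<subseteq> B - {b}" using xs(2) by blast
    thus ?thesis unfolding semigroup_generated_def using xs(1) by blast
  qed
  have "w i \<in> semigroup_generated (B - {b})" using avoid[OF w_in_S[OF i] cS bc lci] .
  moreover have "c \<in> semigroup_generated (B - {b})"
    using avoid[OF cS w_in_S[OF i] _ lwi] bc by (simp add: add.commute)
  ultimately have "b \<in> semigroup_generated (B - {b})" using bc semigroup_generated_add by metis
  hence "x \<in> semigroup_generated (B - {b})" if "x \<in> B" for x
    using that semigroup_generated_base[of x "B - {b}"] by (cases "x = b") auto
  hence "semigroup_generated B \<subseteq> semigroup_generated (B - {b})"
    by (intro semigroup_generated_subset subsetI)
  moreover have "semigroup_generated (B - {b}) \<subseteq> semigroup_generated B"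
    by (intro semigroup_generated_subset subsetI semigroup_generated_base) simp
  ultimately have "semigroup_generated (B - {b}) = S" using gen by blast
  moreover have "B - {b} \<subset> B" using b by blast
  ultimately show False using B by (simp add: minimal_generating_set_def)
qed

text \<open>Ensures that the maximum in the definition of \<open>T\<close> is taken over a finite
  set of values: each \<open>l i\<close> lies between 0 and \<open>d\<close> on
  \<open>B\<close>.\<close>

lemma minimal_generators_finite_image:
  assumes B: "minimal_generating_set B S"
  shows "finite ((\<lambda>b. \<Sum>i\<in>I. l i b) ` B)"
proof -
  have "(\<Sum>i\<in>I. l i b) \<in> {0..int (card I) * d}" if b: "b \<in> B" for b
  proof -
    have "b \<in> S" using semigroup_generated_base[OF b] B by (simp add: minimal_generating_set_def)
    hence "0 \<le> (\<Sum>i\<in>I. l i b)" by (intro sum_nonneg) (simp add: S_eq)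
    moreover have "(\<Sum>i\<in>I. l i b) \<le> int (card I) * d"
      using sum_bounded_above[of I "\<lambda>i. l i b" d] minimal_generator_bounded[OF B b] by simp
    ultimately show ?thesis by simp
  qed
  thus ?thesis by (meson finite_atLeastAtMost_int finite_subset image_subsetI)
qed

end

section \<open>Lattices and simplicial cones\<close>

lemma is_lattice_iff:
  "is_lattice N \<longleftrightarrow> (\<exists>E. finite E \<and> independent E \<and> span E = UNIV \<and> N = integer_span E)"
  by (simp add: is_lattice_def integer_span_def)

lemma integer_span_int_scale:
  assumes "x \<in> integer_span E"
  shows "of_int k *\<^sub>R x \<in> integer_span E"
proof -
  obtain c where "x = (\<Sum>e\<in>E. of_int (c e) *\<^sub>R e)" using assms by (auto simp: integer_span_def)
  hence "of_int k *\<^sub>R x = (\<Sum>e\<in>E. of_int (k * c e) *\<^sub>R e)" by (simp add: scaleR_sum_right)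
  thus ?thesis unfolding integer_span_def by (intro CollectI exI[of _ "\<lambda>e. k * c e"]) simp
qed

lemma integer_span_sum:
  "(\<And>i. i \<in> J \<Longrightarrow> f i \<in> integer_span E) \<Longrightarrow> sum f J \<in> integer_span E"
  by (induction J rule: infinite_finite_induct) (auto simp: zero_in_integer_span add_in_integer_span)

lemma integer_span_base:
  assumes "finite E" "e \<in> E"
  shows "e \<in> integer_span E"
proof -
  have "(\<Sum>a\<in>E. of_int (if a = e then 1 else 0) *\<^sub>R a) = (\<Sum>a\<in>E. if a = e then a else 0)"
    by (intro sum.cong) auto
  also have "\<dots> = e" using assms by simp
  finally show ?thesis unfolding integer_span_def by (intro CollectI exI[of _ "\<lambda>a. if a = e then 1 else 0"]) simp
qed

lemma integer_span_subset:
  assumes "finite E" "\<And>e. e \<in> E \<Longrightarrow> of_int k *\<^sub>R e \<in> integer_span U" "x \<in> integer_span E"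
  shows "of_int k *\<^sub>R x \<in> integer_span U"
proof -
  obtain c where c: "x = (\<Sum>e\<in>E. of_int (c e) *\<^sub>R e)" using assms(3) by (auto simp: integer_span_def)
  have "of_int k *\<^sub>R x = (\<Sum>e\<in>E. of_int (c e) *\<^sub>R (of_int k *\<^sub>R e))"
    unfolding c scaleR_sum_right by (simp add: mult.commute)
  also have "\<dots> \<in> integer_span U"
    by (rule integer_span_sum) (rule integer_span_int_scale[OF assms(2)])
  finally show ?thesis .
qed

lemma independent_coefficients_eq:
  assumes "independent E" "finite E" "(\<Sum>e\<in>E. a e *\<^sub>R e) = (\<Sum>e\<in>E. b e *\<^sub>R e)" "e \<in> E"
  shows "a e = b e"
proof -
  have "(\<Sum>e\<in>E. (a e - b e) *\<^sub>R e) = 0"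
    using assms(3) by (simp add: scaleR_left_diff_distrib sum_subtractf)
  from independentD[OF assms(1,2) subset_refl this assms(4)] show ?thesis by simp
qed

lemma representation_integer_span:
  assumes "independent E" "finite E" "x \<in> integer_span E" "e \<in> E"
  shows "representation E x e \<in> \<int>"
proof -
  obtain c where c: "x = (\<Sum>e\<in>E. of_int (c e) *\<^sub>R e)" using assms(3) by (auto simp: integer_span_def)
  have "x \<in> span E" using assms(3) integer_span_subset_span by blast
  hence "(\<Sum>e\<in>E. representation E x e *\<^sub>R e) = (\<Sum>e\<in>E. of_int (c e) *\<^sub>R e)"
    using sum_representation_eq[OF assms(1) _ assms(2) subset_refl] c by metis
  from independent_coefficients_eq[OF assms(1,2) this assms(4)] show ?thesis by simp
qed

text \<open>If \<open>v\<close> divided by \<open>k\<close> is in \<open>N\<close>, then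
  \<open>k\<close> divides every coordinate of \<open>v\<close>, in particular a nonzero one. So the
  possible \<open>k\<close> are bounded, and the largest one leaves a primitive vector.\<close>

lemma primitive_multiple_exists:
  assumes N: "is_lattice N" and v: "v \<in> N" "v \<noteq> 0"
  obtains k :: int where "k \<ge> 1" "(1 / of_int k) *\<^sub>R v \<in> N"
    "\<And>j::int. j > 1 \<Longrightarrow> (1 / of_int j) *\<^sub>R ((1 / of_int k) *\<^sub>R v) \<notin> N"
proof -
  obtain E where E: "finite E" "independent E" "span E = UNIV" "N = integer_span E"
    using N by (auto simp: is_lattice_iff)
  obtain c where c: "v = (\<Sum>e\<in>E. of_int (c e) *\<^sub>R e)" using v(1) E(4) by (auto simp: integer_span_def)
  obtain e where e: "e \<in> E" "c e \<noteq> 0"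
  proof (rule ccontr)
    assume "\<not> thesis"
    hence "\<forall>e\<in>E. c e = 0" using that by blast
    thus False using c v(2) by simp
  qed
  define K where "K = {k::int. k \<ge> 1 \<and> (1 / of_int k) *\<^sub>R v \<in> N}"
  have "k \<le> \<bar>c e\<bar>" if k: "k \<in> K" for k
  proof -
    have k1: "k \<ge> 1" using k by (simp add: K_def)
    obtain b where b: "(1 / of_int k) *\<^sub>R v = (\<Sum>e\<in>E. of_int (b e) *\<^sub>R e)"
      using k E(4) by (auto simp: K_def integer_span_def)
    have "v = of_int k *\<^sub>R ((1 / of_int k) *\<^sub>R v)" using k1 by simp
    also have "\<dots> = (\<Sum>e\<in>E. of_int (k * b e) *\<^sub>R e)" unfolding b by (simp add: scaleR_sum_right)
    finally have "(\<Sum>e\<in>E. of_int (c e) *\<^sub>R e) = (\<Sum>e\<in>E. of_int (k * b e) *\<^sub>R e)" using c by simp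
    from independent_coefficients_eq[OF E(2,1) this e(1)] have "real_of_int (c e) = real_of_int (k * b e)" .
    hence "c e = k * b e" by (simp only: of_int_eq_iff)
    hence "k dvd c e" by simp
    thus ?thesis using dvd_imp_le_int[OF e(2), of k] by simp
  qed
  hence "K \<subseteq> {1..\<bar>c e\<bar>}" by (auto simp: K_def)
  hence fin: "finite K" using finite_subset by blast
  have "1 \<in> K" using v(1) by (simp add: K_def)
  define m where "m = Max K"
  have "m \<in> K" unfolding m_def using fin \<open>1 \<in> K\<close> by (intro Max_in) auto
  hence m: "m \<ge> 1" "(1 / of_int m) *\<^sub>R v \<in> N" by (auto simp: K_def)
  show ?thesis
  proof (rule that[OF m])
    fix j :: int assume j: "j > 1"
    have lt: "m < j * m" using mult_strict_right_mono[OF j, of m] m(1) by simp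
    show "(1 / of_int j) *\<^sub>R ((1 / of_int m) *\<^sub>R v) \<notin> N"
    proof
      assume "(1 / of_int j) *\<^sub>R ((1 / of_int m) *\<^sub>R v) \<in> N"
      moreover have "1 \<le> j * m" using lt m(1) by linarith
      ultimately have "j * m \<in> K" by (simp add: K_def)
      hence "j * m \<le> m" unfolding m_def using fin by simp
      thus False using lt by simp
    qed
  qed
qed

subsection \<open>Commensurability\<close>

text \<open>In a lattice basis such points have integer coordinates, bounded by the sums of the
  absolute coordinates of the \<open>u\<close>.\<close>

lemma lattice_points_bounded_coordinates_finite:
  assumes N: "is_lattice N" and U: "finite U"
  shows "finite (N \<inter> {\<Sum>u\<in>U. s u *\<^sub>R u | s. \<forall>u\<in>U. 0 \<le> s u \<and> s u \<le> 1})"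
proof -
  obtain E where E: "finite E" "independent E" "span E = UNIV" "N = integer_span E"
    using N by (auto simp: is_lattice_iff)
  define b where "b = (\<lambda>e. \<lceil>\<Sum>u\<in>U. \<bar>representation E u e\<bar>\<rceil>)"
  have "N \<inter> {\<Sum>u\<in>U. s u *\<^sub>R u | s. \<forall>u\<in>U. 0 \<le> s u \<and> s u \<le> 1} \<subseteq>
      (\<lambda>c. \<Sum>e\<in>E. of_int (c e) *\<^sub>R e) ` PiE E (\<lambda>e. {- b e..b e})"
  proof
    fix x assume x: "x \<in> N \<inter> {\<Sum>u\<in>U. s u *\<^sub>R u | s. \<forall>u\<in>U. 0 \<le> s u \<and> s u \<le> 1}"
    then obtain s where s: "x = (\<Sum>u\<in>U. s u *\<^sub>R u)" "\<And>u. u \<in> U \<Longrightarrow> 0 \<le> s u \<and> s u \<le> 1" by blast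
    define c where "c = restrict (\<lambda>e. \<lfloor>representation E x e\<rfloor>) E"
    have ce: "of_int (c e) = representation E x e" if "e \<in> E" for e
      using representation_integer_span[OF E(2,1) _ that, of x] x E(4) that by (simp add: c_def)
    have "x = (\<Sum>e\<in>E. representation E x e *\<^sub>R e)"
      using sum_representation_eq[OF E(2) _ E(1) subset_refl, of x] E(3) by simp
    also have "\<dots> = (\<Sum>e\<in>E. of_int (c e) *\<^sub>R e)" by (intro sum.cong) (simp_all add: ce)
    finally have "x = (\<Sum>e\<in>E. of_int (c e) *\<^sub>R e)" .
    moreover have "c e \<in> {- b e..b e}" if e: "e \<in> E" for e
    proof -
      have "representation E x = (\<lambda>e. \<Sum>u\<in>U. representation E (s u *\<^sub>R u) e)"
        unfolding s(1) using E by (intro representation_sum) auto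
      hence "representation E x e = (\<Sum>u\<in>U. s u * representation E u e)"
        using E by (simp add: representation_scale)
      also have "\<bar>\<dots>\<bar> \<le> (\<Sum>u\<in>U. \<bar>s u * representation E u e\<bar>)" by (rule sum_abs)
      also have "\<dots> \<le> (\<Sum>u\<in>U. \<bar>representation E u e\<bar>)"
      proof (rule sum_mono)
        fix u assume "u \<in> U"
        thus "\<bar>s u * representation E u e\<bar> \<le> \<bar>representation E u e\<bar>"
          using s(2)[of u] by (simp add: abs_mult mult_left_le_one_le)
      qed
      finally have "\<bar>real_of_int (c e)\<bar> \<le> (\<Sum>u\<in>U. \<bar>representation E u e\<bar>)" using ce[OF e] by simp
      hence "real_of_int \<bar>c e\<bar> \<le> of_int (b e)" unfolding b_def by linarith
      hence "\<bar>c e\<bar> \<le> b e" by (simp only: of_int_le_iff)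
      thus ?thesis by auto
    qed
    ultimately show "x \<in> (\<lambda>c. \<Sum>e\<in>E. of_int (c e) *\<^sub>R e) ` PiE E (\<lambda>e. {- b e..b e})"
      by (intro image_eqI[of _ _ c]) (auto simp: c_def)
  qed
  moreover have "finite (PiE E (\<lambda>e. {- b e..b e}))" using E(1) by (intro finite_PiE) auto
  ultimately show ?thesis using finite_surj by blast
qed

text \<open>By the pigeonhole principle two multiples of \<open>n\<close> have the same fractional coordinates.\<close>

lemma lattice_multiple_in_integer_span:
  assumes N: "is_lattice N" and U: "finite U" "U \<subseteq> N" "span U = UNIV" and n: "n \<in> N"
  obtains k :: int where "k > 0" "of_int k *\<^sub>R n \<in> integer_span U"
proof -
  obtain E where E: "finite E" "independent E" "span E = UNIV" "N = integer_span E"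
    using N by (auto simp: is_lattice_iff)
  have "n \<in> span U" using U by simp
  then obtain t where t: "n = (\<Sum>u\<in>U. t u *\<^sub>R u)" using span_finite[OF U(1)] by auto
  define fl where "fl = (\<lambda>k::nat. \<Sum>u\<in>U. of_int \<lfloor>of_nat k * t u\<rfloor> *\<^sub>R u)"
  define fr where "fr = (\<lambda>k::nat. of_nat k *\<^sub>R n - fl k)"
  have flU: "fl k \<in> integer_span U" for k unfolding fl_def integer_span_def
    by (intro CollectI exI[of _ "\<lambda>u. \<lfloor>of_nat k * t u\<rfloor>"]) simp
  have flN: "fl k \<in> N" for k unfolding fl_def E(4)
    using U(2) E(4) by (intro integer_span_sum integer_span_int_scale) auto
  have kn: "of_nat k *\<^sub>R n \<in> N" for k
    using integer_span_int_scale[of n E "int k"] n E(4) by simp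
  have "fr k \<in> N \<inter> {\<Sum>u\<in>U. s u *\<^sub>R u | s. \<forall>u\<in>U. 0 \<le> s u \<and> s u \<le> 1}" for k
  proof
    show "fr k \<in> N" unfolding fr_def using kn flN E(4) diff_in_integer_span by blast
    have "fr k = (\<Sum>u\<in>U. frac (of_nat k * t u) *\<^sub>R u)"
      unfolding fr_def fl_def t scaleR_sum_right
      by (simp add: sum_subtractf[symmetric] frac_def scaleR_left_diff_distrib)
    thus "fr k \<in> {\<Sum>u\<in>U. s u *\<^sub>R u | s. \<forall>u\<in>U. 0 \<le> s u \<and> s u \<le> 1}"
      by (intro CollectI exI[of _ "\<lambda>u. frac (of_nat k * t u)"])
        (simp add: frac_ge_0 frac_lt_1 less_imp_le)
  qed
  hence "finite (range fr)"
    using lattice_points_bounded_coordinates_finite[OF N U(1)] by (meson finite_subset image_subsetI)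
  hence "\<not> inj fr" using finite_imageD infinite_UNIV_nat by blast
  then obtain i j where ij: "i < j" "fr i = fr j" by (metis injI linorder_neqE_nat)
  have "of_int (int j - int i) *\<^sub>R n = fl j - fl i"
    using ij(2) by (simp add: fr_def algebra_simps)
  hence "of_int (int j - int i) *\<^sub>R n \<in> integer_span U" using flU diff_in_integer_span by metis
  thus ?thesis using that[of "int j - int i"] ij(1) by simp
qed

text \<open>The origin of the constant \<open>d\<close>: the multipliers of the individual basis
  vectors of \<open>N\<close> are multiplied together.\<close>

lemma lattice_commensurable:
  assumes N: "is_lattice N" and U: "finite U" "U \<subseteq> N" "span U = UNIV"
  obtains d :: int where "d > 0" "\<And>n. n \<in> N \<Longrightarrow> of_int d *\<^sub>R n \<in> integer_span U"
proof -
  obtain E where E: "finite E" "independent E" "span E = UNIV" "N = integer_span E"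
    using N by (auto simp: is_lattice_iff)
  have "\<exists>d::int. d > 0 \<and> (\<forall>e\<in>F. of_int d *\<^sub>R e \<in> integer_span U)" if "finite F" "F \<subseteq> E" for F
    using that
  proof (induction F rule: finite_induct)
    case empty
    show ?case by (intro exI[of _ 1]) simp
  next
    case (insert e F)
    then obtain d :: int where d: "d > 0" "\<forall>e\<in>F. of_int d *\<^sub>R e \<in> integer_span U" by auto
    have "e \<in> N" using insert.prems integer_span_base[OF E(1)] E(4) by auto
    then obtain k :: int where k: "k > 0" "of_int k *\<^sub>R e \<in> integer_span U"
      using lattice_multiple_in_integer_span[OF N U] by blast
    have "of_int (d * k) *\<^sub>R a \<in> integer_span U" if a: "a \<in> insert e F" for a
    proof (cases "a = e")
      case True
      thus ?thesis using integer_span_int_scale[OF k(2), of d] by simp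
    next
      case False
      hence "of_int k *\<^sub>R (of_int d *\<^sub>R a) \<in> integer_span U" using a d integer_span_int_scale by blast
      thus ?thesis by (simp add: mult.commute)
    qed
    thus ?case using d k by (intro exI[of _ "d * k"]) auto
  qed
  then obtain d :: int where d: "d > 0" "\<forall>e\<in>E. of_int d *\<^sub>R e \<in> integer_span U" using E(1) by blast
  show ?thesis
    by (rule that[OF d(1)]) (use integer_span_subset[OF E(1)] d(2) E(4) in blast)
qed

subsection \<open>Extreme rays\<close>

definition cone_of :: "'v::real_vector set \<Rightarrow> 'v set" where
  "cone_of G = {\<Sum>v\<in>G. a v *\<^sub>R v | a. \<forall>v\<in>G. 0 \<le> a v}"

lemma cone_of_zero: "0 \<in> cone_of G"
  unfolding cone_of_def by (intro CollectI exI[of _ "\<lambda>_. 0"]) simp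

lemma cone_of_add: "x \<in> cone_of G \<Longrightarrow> y \<in> cone_of G \<Longrightarrow> x + y \<in> cone_of G"
proof -
  assume "x \<in> cone_of G" "y \<in> cone_of G"
  then obtain a b where ab: "x = (\<Sum>v\<in>G. a v *\<^sub>R v)" "y = (\<Sum>v\<in>G. b v *\<^sub>R v)"
    "\<forall>v\<in>G. 0 \<le> a v" "\<forall>v\<in>G. 0 \<le> b v" by (auto simp: cone_of_def)
  hence "x + y = (\<Sum>v\<in>G. (a v + b v) *\<^sub>R v)" by (simp add: scaleR_left_distrib sum.distrib)
  thus ?thesis unfolding cone_of_def using ab by (intro CollectI exI[of _ "\<lambda>v. a v + b v"]) simp
qed

lemma cone_of_scale: "x \<in> cone_of G \<Longrightarrow> 0 \<le> t \<Longrightarrow> t *\<^sub>R x \<in> cone_of G"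
proof -
  assume "x \<in> cone_of G" and t: "0 \<le> t"
  then obtain a where a: "x = (\<Sum>v\<in>G. a v *\<^sub>R v)" "\<forall>v\<in>G. 0 \<le> a v" by (auto simp: cone_of_def)
  hence "t *\<^sub>R x = (\<Sum>v\<in>G. (t * a v) *\<^sub>R v)" by (simp add: scaleR_sum_right)
  thus ?thesis unfolding cone_of_def using a t by (intro CollectI exI[of _ "\<lambda>v. t * a v"]) simp
qed

lemma cone_of_base: "finite G \<Longrightarrow> g \<in> G \<Longrightarrow> g \<in> cone_of G"
proof -
  assume g: "finite G" "g \<in> G"
  have "(\<Sum>v\<in>G. (if v = g then 1 else 0) *\<^sub>R v) = (\<Sum>v\<in>G. if v = g then v else 0)"
    by (intro sum.cong) auto
  also have "\<dots> = g" using g by simp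
  finally show ?thesis unfolding cone_of_def
    by (intro CollectI exI[of _ "\<lambda>v. if v = g then 1 else 0"]) simp
qed

lemma cone_of_sum: "(\<And>i. i \<in> J \<Longrightarrow> f i \<in> cone_of G) \<Longrightarrow> sum f J \<in> cone_of G"
  by (induction J rule: infinite_finite_induct) (auto simp: cone_of_zero cone_of_add)

lemma cone_of_subset: "(\<And>h. h \<in> H \<Longrightarrow> h \<in> cone_of G) \<Longrightarrow> cone_of H \<subseteq> cone_of G"
proof
  fix x assume H: "\<And>h. h \<in> H \<Longrightarrow> h \<in> cone_of G" and "x \<in> cone_of H"
  then obtain a where a: "x = (\<Sum>v\<in>H. a v *\<^sub>R v)" "\<forall>v\<in>H. 0 \<le> a v" by (auto simp: cone_of_def)
  thus "x \<in> cone_of G" unfolding a(1) by (intro cone_of_sum cone_of_scale) (auto simp: H)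
qed

lemma cone_of_convex: "convex (cone_of G)"
  unfolding convex_def by (auto intro!: cone_of_add cone_of_scale)

text \<open>Expand a positive combination of \<open>x\<close> and \<open>y\<close> lying on the line
  of \<open>v\<close> in the generators. Irredundancy of \<open>v\<close> bounds its multiple on the
  ray by the coefficient at \<open>v\<close>, and pointedness then annihilates every other term, so
  \<open>x\<close> and \<open>y\<close> are multiples of \<open>v\<close>.\<close>

lemma ray_face_of_cone:
  assumes G: "finite G" and p: "pointed_cone (cone_of G)" and v: "v \<in> G" "v \<notin> cone_of (G - {v})"
  shows "{t *\<^sub>R v | t. 0 \<le> t} face_of cone_of G"
  unfolding face_of_def
proof (intro conjI ballI impI)
  let ?r = "{t *\<^sub>R v | t. 0 \<le> t}"
  show "?r \<subseteq> cone_of G" using cone_of_scale cone_of_base[OF G v(1)] by blast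
  have "?r = cone_of {v}"
  proof (intro equalityI subsetI)
    fix x assume "x \<in> ?r"
    then obtain t where "x = t *\<^sub>R v" "0 \<le> t" by blast
    thus "x \<in> cone_of {v}" unfolding cone_of_def by (intro CollectI exI[of _ "\<lambda>_. t"]) simp
  qed (auto simp: cone_of_def)
  thus "convex ?r" by (simp add: cone_of_convex)
  have key: "x \<in> ?r" if "x \<in> cone_of G" "y \<in> cone_of G" "0 < \<alpha>" "0 \<le> \<beta>"
    "\<alpha> *\<^sub>R x + \<beta> *\<^sub>R y = s *\<^sub>R v" for x y and \<alpha> \<beta> s :: real
  proof -
    obtain a b where ab: "x = (\<Sum>v\<in>G. a v *\<^sub>R v)" "y = (\<Sum>v\<in>G. b v *\<^sub>R v)"
      "\<forall>v\<in>G. 0 \<le> a v" "\<forall>v\<in>G. 0 \<le> b v" using \<open>x \<in> cone_of G\<close> \<open>y \<in> cone_of G\<close> by (auto simp: cone_of_def)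
    define c where "c = (\<lambda>g. \<alpha> * a g + \<beta> * b g)"
    have c: "0 \<le> c g" if "g \<in> G" for g using ab that \<open>0 < \<alpha>\<close> \<open>0 \<le> \<beta>\<close> by (simp add: c_def)
    have "s *\<^sub>R v = (\<Sum>g\<in>G. c g *\<^sub>R g)"
      unfolding \<open>\<alpha> *\<^sub>R x + \<beta> *\<^sub>R y = s *\<^sub>R v\<close>[symmetric] ab(1,2) c_def
      by (simp add: scaleR_sum_right scaleR_left_distrib sum.distrib)
    also have "\<dots> = c v *\<^sub>R v + (\<Sum>g\<in>G - {v}. c g *\<^sub>R g)" by (rule sum.remove[OF G v(1)])
    finally have eq: "(s - c v) *\<^sub>R v = (\<Sum>g\<in>G - {v}. c g *\<^sub>R g)" by (simp add: scaleR_left_diff_distrib)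
    have rest: "(\<Sum>g\<in>G - {v}. c g *\<^sub>R g) \<in> cone_of (G - {v})"
      unfolding cone_of_def using c by auto
    \<comment> \<open>Otherwise \<open>v\<close> would be a nonnegative combination of the other
      generators.\<close>
    have le: "s - c v \<le> 0"
    proof (rule ccontr)
      assume neg: "\<not> s - c v \<le> 0"
      hence "(1 / (s - c v)) *\<^sub>R ((s - c v) *\<^sub>R v) \<in> cone_of (G - {v})"
        unfolding eq using rest by (intro cone_of_scale) auto
      thus False using v(2) neg by simp
    qed
    \<comment> \<open>A nonzero term could be solved for \<open>- g\<close>, and the cone would
      contain the line through \<open>g\<close>.\<close>
    have zero: "c g = 0 \<or> g = 0" if g: "g \<in> G - {v}" for g
    proof (rule ccontr)
      assume ng: "\<not> ?thesis"
      hence cg: "0 < c g" using c[of g] g by simp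
      have "(\<Sum>g\<in>G - {v}. c g *\<^sub>R g) = c g *\<^sub>R g + (\<Sum>h\<in>G - {v} - {g}. c h *\<^sub>R h)"
        using G g by (intro sum.remove) auto
      hence "- (c g *\<^sub>R g) = (\<Sum>h\<in>G - {v} - {g}. c h *\<^sub>R h) + (c v - s) *\<^sub>R v"
        using eq by (simp add: algebra_simps)
      also have "\<dots> \<in> cone_of G"
        using le c v(1) G by (intro cone_of_add cone_of_sum cone_of_scale cone_of_base) auto
      finally have neg: "- (c g *\<^sub>R g) \<in> cone_of G" .
      have "(1 / c g) *\<^sub>R (- (c g *\<^sub>R g)) \<in> cone_of G" using cg by (intro cone_of_scale[OF neg]) simp
      hence mg: "- g \<in> cone_of G" using cg by simp
      have "t *\<^sub>R g \<in> cone_of G" for t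
      proof (cases "0 \<le> t")
        case True
        thus ?thesis using cone_of_scale cone_of_base[OF G] g by blast
      next
        case False
        hence "(- t) *\<^sub>R (- g) \<in> cone_of G" using mg by (intro cone_of_scale) auto
        thus ?thesis by simp
      qed
      hence "range (\<lambda>t. t *\<^sub>R g) \<subseteq> cone_of G" by blast
      thus False using p ng unfolding pointed_cone_def by blast
    qed
    have "a g *\<^sub>R g = 0" if g: "g \<in> G - {v}" for g
    proof -
      have "\<alpha> * a g \<le> c g" "0 \<le> a g" using g ab \<open>0 \<le> \<beta>\<close> by (auto simp: c_def)
      moreover have "a g = 0 \<or> 0 < \<alpha> * a g" using \<open>0 < \<alpha>\<close> \<open>0 \<le> a g\<close> by (metis mult_pos_pos order_le_less)
      ultimately show ?thesis using zero[OF g] by auto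
    qed
    hence "(\<Sum>g\<in>G - {v}. a g *\<^sub>R g) = 0" by (intro sum.neutral) auto
    hence "x = a v *\<^sub>R v" unfolding ab(1) using sum.remove[OF G v(1), of "\<lambda>g. a g *\<^sub>R g"] by simp
    thus ?thesis using ab(3) v(1) by blast
  qed
  fix x y z assume xy: "x \<in> cone_of G" "y \<in> cone_of G" and z: "z \<in> ?r" "z \<in> open_segment x y"
  obtain t where t: "0 < t" "t < 1" "z = (1 - t) *\<^sub>R x + t *\<^sub>R y"
    using z(2) by (auto simp: in_segment)
  obtain s where s: "z = s *\<^sub>R v" using z(1) by blast
  show "x \<in> ?r" using key[OF xy, of "1 - t" t s] t s by simp
  show "y \<in> ?r" using key[OF xy(2,1), of t "1 - t" s] t s by (simp add: add.commute)
qed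

lemma dim_ray:
  assumes "v \<noteq> 0"
  shows "dim {t *\<^sub>R v | t. 0 \<le> t} = 1"
proof -
  have "span {t *\<^sub>R v | t. 0 \<le> t} = span {v}"
  proof (rule subset_antisym)
    show "span {t *\<^sub>R v | t. 0 \<le> t} \<subseteq> span {v}"
      by (intro span_minimal) (auto intro: span_scale span_base)
    have "v \<in> {t *\<^sub>R v | t. 0 \<le> t}" by (auto intro!: exI[of _ 1])
    thus "span {v} \<subseteq> span {t *\<^sub>R v | t. 0 \<le> t}" by (intro span_mono) auto
  qed
  moreover have "dim {v} = 1" using assms by (simp add: dim_eq_card_independent)
  ultimately show ?thesis by (metis dim_span)
qed

lemma minimal_cone_generators:
  assumes "finite G"
  obtains H where "H \<subseteq> G" "cone_of H = cone_of G" "\<And>v. v \<in> H \<Longrightarrow> v \<notin> cone_of (H - {v})"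
proof -
  have "\<exists>H. (H \<subseteq> G \<and> cone_of H = cone_of G) \<and>
      (\<forall>H'. H' \<subseteq> G \<and> cone_of H' = cone_of G \<longrightarrow> card H \<le> card H')"
    by (rule ex_has_least_nat[of "\<lambda>H. H \<subseteq> G \<and> cone_of H = cone_of G" G]) simp
  then obtain H where min: "(H \<subseteq> G \<and> cone_of H = cone_of G) \<and>
      (\<forall>H'. H' \<subseteq> G \<and> cone_of H' = cone_of G \<longrightarrow> card H \<le> card H')" by (elim exE)
  hence H: "H \<subseteq> G" "cone_of H = cone_of G"
    "\<And>H'. H' \<subseteq> G \<Longrightarrow> cone_of H' = cone_of G \<Longrightarrow> card H \<le> card H'" by simp_all
  have fH: "finite H" using H(1) assms finite_subset by blast
  have "v \<notin> cone_of (H - {v})" if v: "v \<in> H" for v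
  proof
    assume c: "v \<in> cone_of (H - {v})"
    have "cone_of H \<subseteq> cone_of (H - {v})"
    proof (rule cone_of_subset)
      fix h assume "h \<in> H"
      thus "h \<in> cone_of (H - {v})" using c cone_of_base[of "H - {v}" h] fH by (cases "h = v") auto
    qed
    moreover have "cone_of (H - {v}) \<subseteq> cone_of H"
      by (rule cone_of_subset) (use cone_of_base[OF fH] in auto)
    ultimately have "cone_of (H - {v}) = cone_of G" using H(2) by simp
    hence "card H \<le> card (H - {v})" using H(1) by (intro H(3)) auto
    thus False using v fH by (metis card_Diff1_less not_le)
  qed
  thus ?thesis by (rule that[OF H(1,2)])
qed

text \<open>The ray of an irredundant generator is a face, so its primitive vector belongs to
  \<open>U\<close>. Hence \<open>C\<close> is contained in the cone of \<open>U\<close>, and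
  \<open>U\<close> spans because \<open>C\<close> is full; independence is the simplicial
  hypothesis.\<close>

lemma simplicial_cone_generators:
  assumes N: "is_lattice N" and C: "rational_polyhedral_cone N C" "full_cone C" "pointed_cone C"
    "simplicial_cone N C"
  defines "U \<equiv> primitive_generators N C"
  shows "finite U" "independent U" "span U = UNIV" "U \<subseteq> N" "U \<subseteq> C"
    "\<And>u k. u \<in> U \<Longrightarrow> k > (1::int) \<Longrightarrow> (1 / of_int k) *\<^sub>R u \<notin> N" "C \<subseteq> cone_of U"
proof -
  obtain G where G: "finite G" "G \<subseteq> N" "C = cone_of G"
    using C(1) by (auto simp: rational_polyhedral_cone_def cone_of_def)
  obtain H where H: "H \<subseteq> G" "cone_of H = cone_of G" "\<And>v. v \<in> H \<Longrightarrow> v \<notin> cone_of (H - {v})"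
    using minimal_cone_generators[OF G(1)] by blast
  have fH: "finite H" using H(1) G(1) finite_subset by blast
  obtain EN where EN: "finite EN" "independent EN" "span EN = UNIV" "N = integer_span EN"
    using N by (auto simp: is_lattice_iff)
  obtain E where E: "independent E" "span E = UNIV" "U \<subseteq> E"
    using C(4) by (auto simp: simplicial_cone_def U_def)
  \<comment> \<open>The basis in the definition of a simplicial cone carries no finiteness
    condition; the lattice basis bounds its size.\<close>
  have "finite E" using independent_span_bound[OF EN(1) E(1)] EN(3) by simp
  thus fU: "finite U" using E(3) finite_subset by blast
  show "independent U" using independent_mono[OF E(1,3)] .
  show "U \<subseteq> N" "U \<subseteq> C"
    "\<And>u k. u \<in> U \<Longrightarrow> k > (1::int) \<Longrightarrow> (1 / of_int k) *\<^sub>R u \<notin> N"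
    unfolding U_def primitive_generators_def face_of_def by blast+
  have "v \<in> cone_of U" if v: "v \<in> H" for v
  proof -
    have v0: "v \<noteq> 0" using H(3)[OF v] cone_of_zero by auto
    have vN: "v \<in> N" using v H(1) G(2) by blast
    obtain k :: int where k: "k \<ge> 1" "(1 / of_int k) *\<^sub>R v \<in> N"
      "\<And>j::int. j > 1 \<Longrightarrow> (1 / of_int j) *\<^sub>R ((1 / of_int k) *\<^sub>R v) \<notin> N"
      using primitive_multiple_exists[OF N vN v0] by blast
    let ?r = "{t *\<^sub>R v | t. 0 \<le> t}"
    have "?r face_of C"
      using ray_face_of_cone[OF fH _ v H(3)[OF v]] C(3) G(3) H(2) by simp
    moreover have "(1 / of_int k) *\<^sub>R v \<in> ?r"
      using k(1) by (intro CollectI exI[of _ "1 / of_int k"]) simp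
    ultimately have "(1 / of_int k) *\<^sub>R v \<in> U"
      unfolding U_def primitive_generators_def using k dim_ray[OF v0] by blast
    hence "of_int k *\<^sub>R ((1 / of_int k) *\<^sub>R v) \<in> cone_of U"
      using k(1) by (intro cone_of_scale cone_of_base[OF fU]) auto
    thus ?thesis using k(1) by simp
  qed
  thus CU: "C \<subseteq> cone_of U" using cone_of_subset H(2) G(3) by metis
  have "cone_of U \<subseteq> span U"
    unfolding cone_of_def by (auto intro!: span_sum intro: span_scale span_base)
  hence "span C \<subseteq> span U" using CU by (intro span_minimal) auto
  thus "span U = UNIV" using C(2) by (auto simp: full_cone_def)
qed

section \<open>The semigroup of a simplicial cone\<close>

lemma dual_lattices_represent_left:
  assumes "dual_lattices M N pair" "\<And>x y. x \<in> N \<Longrightarrow> y \<in> N \<Longrightarrow> f (x + y) = f x + (f y :: int)"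
  shows "\<exists>!m. m \<in> M \<and> (\<forall>n\<in>N. pair m n = of_int (f n))"
  using assms by (simp add: dual_lattices_def)

lemma dual_lattices_represent_right:
  assumes "dual_lattices M N pair" "\<And>x y. x \<in> M \<Longrightarrow> y \<in> M \<Longrightarrow> g (x + y) = g x + (g y :: int)"
  shows "\<exists>!n. n \<in> N \<and> (\<forall>m\<in>M. pair m n = of_int (g m))"
  using assms by (simp add: dual_lattices_def)

text \<open>The zero functional on \<open>N\<close> is represented by both 0 and \<open>m\<close>,
  and the representing element is unique.\<close>

lemma dual_lattices_nondegenerate:
  assumes dl: "dual_lattices M N pair" and m: "m \<in> M" "\<And>n. n \<in> N \<Longrightarrow> pair m n = 0"
  shows "m = 0"
proof -
  have ex1: "\<exists>!m. m \<in> M \<and> (\<forall>n\<in>N. pair m n = of_int 0)"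
    by (rule dual_lattices_represent_left[OF dl, of "\<lambda>_. 0"]) simp
  have "is_lattice M" "bilinear pair" using dl by (auto simp: dual_lattices_def)
  hence "0 \<in> M" "\<And>n. pair 0 n = 0"
    using zero_in_integer_span by (auto simp: is_lattice_iff bilinear_lzero)
  thus ?thesis using ex1 m by auto
qed

text \<open>If the values of \<open>pair _ u\<close> were the multiples of some \<open>g > 1\<close>, then the additive function
  \<open>pair _ u / g\<close> would be represented by an element of \<open>N\<close>, necessarily \<open>u / g\<close>.\<close>

lemma primitive_pairing_one:
  assumes dl: "dual_lattices M N pair" and u: "u \<in> N"
    and prim: "\<And>k::int. k > 1 \<Longrightarrow> (1 / of_int k) *\<^sub>R u \<notin> N"
    and pos: "\<exists>m\<in>M. 0 < pair m u"
  shows "\<exists>m\<in>M. pair m u = 1"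
proof -
  have bil: "bilinear pair" and latM: "is_lattice M" and latN: "is_lattice N"
    and int: "\<And>m n. m \<in> M \<Longrightarrow> n \<in> N \<Longrightarrow> pair m n \<in> \<int>"
    using dl by (auto simp: dual_lattices_def)
  obtain E where E: "M = integer_span E" using latM by (auto simp: is_lattice_iff)
  obtain E' where E': "N = integer_span E'" using latN by (auto simp: is_lattice_iff)
  define p where "p = (\<lambda>m. \<lfloor>pair m u\<rfloor>)"
  have p: "of_int (p m) = pair m u" if "m \<in> M" for m using int[OF that u] by (simp add: p_def)
  have p_lin: "p (a - of_int k *\<^sub>R b) = p a - k * p b" if "a \<in> M" "b \<in> M" for a b k
  proof -
    have "a - of_int k *\<^sub>R b \<in> M" using that E diff_in_integer_span integer_span_int_scale by blast
    from p[OF this] have "real_of_int (p (a - of_int k *\<^sub>R b)) = of_int (p a - k * p b)"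
      using that p by (simp add: bilinear_lsub[OF bil] bilinear_lmul[OF bil])
    thus ?thesis by (simp only: of_int_eq_iff)
  qed
  obtain m1 where m1: "m1 \<in> M" "0 < p m1" using pos p by (metis of_int_0_less_iff)
  define q where "q = (\<lambda>k. \<exists>m\<in>M. 0 < p m \<and> nat (p m) = k)"
  have "q (nat (p m1))" using m1 by (auto simp: q_def)
  define k where "k = (LEAST k. q k)"
  have qk: "q k" unfolding k_def by (rule LeastI) fact
  obtain m where m: "m \<in> M" "0 < p m" "nat (p m) = k" using qk by (auto simp: q_def)
  have least: "p m \<le> p a" if "a \<in> M" "0 < p a" for a
  proof -
    have "q (nat (p a))" using that by (auto simp: q_def)
    hence "k \<le> nat (p a)" unfolding k_def by (rule Least_le)
    thus ?thesis using m by simp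
  qed
  \<comment> \<open>The remainder of \<open>p a\<close> modulo the least positive value is again a
    value of \<open>p\<close>, hence 0.\<close>
  have dvd: "p m dvd p a" if a: "a \<in> M" for a
  proof (rule ccontr)
    assume nd: "\<not> p m dvd p a"
    let ?r = "a - of_int (p a div p m) *\<^sub>R m"
    have "p ?r = p a mod p m" using p_lin[OF a m(1)] by (simp add: minus_div_mult_eq_mod)
    moreover have "?r \<in> M" using a m(1) E diff_in_integer_span integer_span_int_scale by blast
    moreover have "0 < p a mod p m"
      using nd m(2) pos_mod_sign[OF m(2), of "p a"] by (metis dvd_eq_mod_eq_0 order_le_less)
    ultimately show False using least[of ?r] pos_mod_bound[OF m(2), of "p a"] by simp
  qed
  have "p m = 1"
  proof (rule ccontr)
    assume "p m \<noteq> 1"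
    hence gt: "1 < p m" using m(2) by simp
    have p_add: "p (x + y) = p x + p y" if "x \<in> M" "y \<in> M" for x y
      using p_lin[of x y "-1"] that by simp
    have "\<exists>n\<in>N. \<forall>a\<in>M. pair a n = of_int (p a div p m)"
    proof -
      have "p (x + y) div p m = p x div p m + p y div p m" if "x \<in> M" "y \<in> M" for x y
        using p_add that dvd by (simp add: div_plus_div_distrib_dvd_left)
      from ex1_implies_ex[OF dual_lattices_represent_right[OF dl, of "\<lambda>a. p a div p m", OF this]]
      show ?thesis by blast
    qed
    then obtain n where n: "n \<in> N" "\<And>a. a \<in> M \<Longrightarrow> pair a n = of_int (p a div p m)" by blast
    have "of_int (p m) *\<^sub>R n \<in> N" using n(1) E' integer_span_int_scale by blast
    moreover have "pair a (of_int (p m) *\<^sub>R n) = of_int (p a)" if "a \<in> M" for a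
    proof -
      have "p m * (p a div p m) = p a" using dvd[OF that] by simp
      hence "real_of_int (p m) * of_int (p a div p m) = of_int (p a)" by (metis of_int_mult)
      thus ?thesis using n(2)[OF that] by (simp add: bilinear_rmul[OF bil])
    qed
    moreover have "\<exists>!n. n \<in> N \<and> (\<forall>a\<in>M. pair a n = of_int (p a))"
      by (rule dual_lattices_represent_right[OF dl p_add])
    ultimately have "of_int (p m) *\<^sub>R n = u" using u p by metis
    hence "(1 / of_int (p m)) *\<^sub>R u = n" using gt by auto
    thus False using prim[OF gt] n(1) by simp
  qed
  thus ?thesis using m(1) p by (metis of_int_1)
qed

text \<open>Provides the data of the abstract setting: perfectness of the pairing yields
  \<open>w\<close> inside \<open>M\<close>, and primitivity of the generators yields the value 1 for
  each functional.\<close>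

lemma simplicial_cone_semigroup:
  fixes R :: "('m::real_vector \<Rightarrow>\<^sub>0 'f::field) ring"
  assumes dl: "dual_lattices M N pair"
    and C: "rational_polyhedral_cone N C" "full_cone C" "pointed_cone C" "simplicial_cone N C"
    and S: "S = dual_cone pair C \<inter> M" and R: "R = semigroup_algebra S"
  obtains d w where
    "simplicial_semigroup S R (supported_in S) M (supported_in M) (primitive_generators N C)
       (\<lambda>u m. \<lfloor>pair m u\<rfloor>) w d"
proof -
  define U where "U = primitive_generators N C"
  have bil: "bilinear pair" and latM: "is_lattice M" and latN: "is_lattice N"
    and int: "\<And>m n. m \<in> M \<Longrightarrow> n \<in> N \<Longrightarrow> pair m n \<in> \<int>"
    using dl by (auto simp: dual_lattices_def)
  note gens = simplicial_cone_generators[OF latN C, folded U_def]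
  obtain EM where EM: "finite EM" "independent EM" "M = integer_span EM"
    using latM by (auto simp: is_lattice_iff)
  obtain EN where EN: "N = integer_span EN" using latN by (auto simp: is_lattice_iff)
  have l: "of_int \<lfloor>pair m u\<rfloor> = pair m u" if "m \<in> M" "u \<in> U" for m u
    using int[OF that(1) subsetD[OF gens(4) that(2)]] by (metis Ints_cases of_int_floor_cancel)
  have S_eq: "S = {m \<in> M. \<forall>u\<in>U. 0 \<le> \<lfloor>pair m u\<rfloor>}"
  proof (intro equalityI subsetI)
    fix m assume "m \<in> S"
    thus "m \<in> {m \<in> M. \<forall>u\<in>U. 0 \<le> \<lfloor>pair m u\<rfloor>}" using S gens(5) by (auto simp: dual_cone_def)
  next
    fix m assume m: "m \<in> {m \<in> M. \<forall>u\<in>U. 0 \<le> \<lfloor>pair m u\<rfloor>}"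
    have "0 \<le> pair m v" if vC: "v \<in> C" for v
    proof -
      obtain a where a: "v = (\<Sum>u\<in>U. a u *\<^sub>R u)" "\<forall>u\<in>U. 0 \<le> a u"
        using vC gens(7) unfolding cone_of_def by blast
      have "linear (pair m)" using bil by (simp add: bilinear_def)
      hence "pair m v = (\<Sum>u\<in>U. a u * pair m u)"
        unfolding a(1) by (simp add: linear_sum linear_scale)
      thus ?thesis using a(2) m by (auto intro!: sum_nonneg mult_nonneg_nonneg)
    qed
    thus "m \<in> S" using m S by (auto simp: dual_cone_def)
  qed
  obtain d :: int where d: "d > 0" "\<And>n. n \<in> N \<Longrightarrow> of_int d *\<^sub>R n \<in> integer_span U"
    using lattice_commensurable[OF latN gens(1,4,3)] by blast
  have "\<exists>w\<in>M. \<forall>u'\<in>U. pair w u' = (if u = u' then of_int d else 0)" if u: "u \<in> U" for u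
  proof -
    \<comment> \<open>\<open>d\<close> times the coordinate at \<open>u\<close> is an integer on all
      of \<open>N\<close> by the choice of \<open>d\<close>, so the pairing represents it by an
      element of \<open>M\<close>, which becomes \<open>w u\<close>.\<close>
    define f where "f = (\<lambda>n. \<lfloor>representation U (of_int d *\<^sub>R n) u\<rfloor>)"
    have f: "of_int (f n) = of_int d * representation U n u" if "n \<in> N" for n
      using representation_integer_span[OF gens(2,1) d(2)[OF that] u] gens(2,3)
      by (simp add: f_def representation_scale)
    have "f (x + y) = f x + f y" if "x \<in> N" "y \<in> N" for x y
    proof -
      have "x + y \<in> N" using that EN add_in_integer_span by blast
      hence "real_of_int (f (x + y)) = of_int (f x + f y)"
        using f that gens(2,3) by (simp add: representation_add algebra_simps)
      thus ?thesis by (simp only: of_int_eq_iff)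
    qed
    from ex1_implies_ex[OF dual_lattices_represent_left[OF dl this]]
    obtain w where w: "w \<in> M" "\<And>n. n \<in> N \<Longrightarrow> pair w n = of_int (f n)" by blast
    have "pair w u' = (if u = u' then of_int d else 0)" if u': "u' \<in> U" for u'
      using w(2)[of u'] f[of u'] u' gens(4) representation_basis[OF gens(2) u'] by auto
    thus ?thesis using w(1) by blast
  qed
  then obtain w where w: "\<And>u. u \<in> U \<Longrightarrow> w u \<in> M"
    "\<And>u u'. u \<in> U \<Longrightarrow> u' \<in> U \<Longrightarrow> pair (w u) u' = (if u = u' then of_int d else 0)" by metis
  have M0: "0 \<in> M" and Madd: "\<And>a b. a \<in> M \<Longrightarrow> b \<in> M \<Longrightarrow> a + b \<in> M"
    and Mminus: "\<And>a. a \<in> M \<Longrightarrow> - a \<in> M"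
    using EM(3) zero_in_integer_span add_in_integer_span minus_in_integer_span by blast+
  have ladd: "\<lfloor>pair (a + b) u\<rfloor> = \<lfloor>pair a u\<rfloor> + \<lfloor>pair b u\<rfloor>" if "u \<in> U" "a \<in> M" "b \<in> M" for a b u
  proof -
    have "real_of_int \<lfloor>pair (a + b) u\<rfloor> = pair a u + pair b u"
      unfolding l[OF Madd[OF that(2,3)] that(1)] by (rule bilinear_ladd[OF bil])
    also have "\<dots> = of_int (\<lfloor>pair a u\<rfloor> + \<lfloor>pair b u\<rfloor>)"
      by (simp only: of_int_add l[OF that(2,1)] l[OF that(3,1)])
    finally show ?thesis by (simp only: of_int_eq_iff)
  qed
  have "simplicial_semigroup S R (supported_in S) M (supported_in M) U (\<lambda>u m. \<lfloor>pair m u\<rfloor>) w d"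
  proof (intro simplicial_semigroup.intro affine_semigroup.intro simplicial_semigroup_axioms.intro)
    show "0 \<in> S" using M0 by (simp add: S_eq bilinear_lzero[OF bil])
    show "a + b \<in> S" if "a \<in> S" "b \<in> S" for a b
      using that Madd by (auto simp: S_eq bilinear_ladd[OF bil])
    show "factorial_set (supported_in M :: ('m \<Rightarrow>\<^sub>0 'f) set)"
      unfolding EM(3) by (rule integer_span_algebra_factorial[OF EM(1,2)])
    show "m = 0" if m: "m \<in> M" "\<And>u. u \<in> U \<Longrightarrow> \<lfloor>pair m u\<rfloor> = 0" for m
    proof (rule dual_lattices_nondegenerate[OF dl m(1)])
      fix n assume "n \<in> N"
      have "n \<in> span U" using gens(3) by simp
      then obtain a where a: "n = (\<Sum>u\<in>U. a u *\<^sub>R u)" using span_finite[OF gens(1)] by auto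
      have "pair m u = 0" if "u \<in> U" for u using l[OF m(1) that] m(2)[OF that] by simp
      moreover have "linear (pair m)" using bil by (simp add: bilinear_def)
      ultimately show "pair m n = 0" unfolding a by (simp add: linear_sum linear_scale)
    qed
    show "\<lfloor>pair (w u) u'\<rfloor> = (if u = u' then d else 0)" if "u \<in> U" "u' \<in> U" for u u'
      using w(2)[OF that] by simp
    show "\<exists>m\<in>M. \<lfloor>pair m u\<rfloor> = 1" if u: "u \<in> U" for u
    proof -
      have "\<exists>m\<in>M. 0 < pair m u" using w(1)[OF u] w(2)[OF u u] d(1) by (intro bexI[of _ "w u"]) auto
      hence "\<exists>m\<in>M. pair m u = 1" using primitive_pairing_one[OF dl] gens(4,6) u by blast
      thus ?thesis by force
    qed
  qed (use R S_eq M0 Madd Mminus ladd w(1) gens(1) d(1) in auto)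
  thus ?thesis using that unfolding U_def by blast
qed

section \<open>The containment theorem for simplicial toric algebras\<close>

theorem theorem3p2:
  fixes M :: "'m::real_vector set" and N :: "'n::real_vector set"
    and pair :: "'m \<Rightarrow> 'n \<Rightarrow> real"
    and C :: "'n set" and S B :: "'m set" and v\<^sub>C :: 'n
    and R :: "('m \<Rightarrow>\<^sub>0 'f::field) ring"
    and T :: "nat \<Rightarrow> nat"
  assumes "dual_lattices M N pair"
    and "0 < dim (UNIV :: 'm set)" and "0 < dim (UNIV :: 'n set)"
    and "rational_polyhedral_cone N C" and "full_cone C" and "pointed_cone C"
    and "simplicial_cone N C"
    and "S = dual_cone pair C \<inter> M"
    and "R = semigroup_algebra S"
    and "minimal_generating_set B S"
    and "v\<^sub>C = \<Sum>(primitive_generators N C)"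
    and "\<And>D. T D = nat \<lfloor>max (Max ((\<lambda>m. pair m v\<^sub>C) ` B)) (real D)\<rfloor>"
  shows "(\<forall>D>0. annihilates_class_group D R \<longrightarrow>
            (\<forall>r>0. \<forall>P. primeideal P R \<and> (monomial_ideal S P \<or> ideal_height R P = 1) \<longrightarrow>
               symbolic_power R P (T D * (r - 1) + 1) \<subseteq> P [^]\<^bsub>ideals_set R\<^esub> r))
         \<and> finite (carrier (divisor_class_group R))
         \<and> card (carrier (divisor_class_group R)) > 0
         \<and> annihilates_class_group (card (carrier (divisor_class_group R))) R"
proof -
  note dl = assms(1) and B = assms(10)
  define U where "U = primitive_generators N C"
  obtain d w where ss: "simplicial_semigroup S R (supported_in S) M (supported_in M) U
      (\<lambda>u m. \<lfloor>pair m u\<rfloor>) w d"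
    using simplicial_cone_semigroup[OF dl assms(4-9)] unfolding U_def by blast
  interpret simplicial_semigroup S R "supported_in S" M "supported_in M" U "\<lambda>u m. \<lfloor>pair m u\<rfloor>" w d
    by (rule ss)
  have bil: "bilinear pair" and int: "\<And>m n. m \<in> M \<Longrightarrow> n \<in> N \<Longrightarrow> pair m n \<in> \<int>"
    using dl by (auto simp: dual_lattices_def)
  have UN: "U \<subseteq> N" by (auto simp: U_def primitive_generators_def)
  have gen: "semigroup_generated B = S" using B by (simp add: minimal_generating_set_def)
  have pair_vC: "pair b v\<^sub>C = of_int (\<Sum>u\<in>U. \<lfloor>pair b u\<rfloor>)" if "b \<in> B" for b
  proof -
    have "b \<in> M" using semigroup_generated_base[OF that] gen S_subset by blast
    hence floor: "pair b u = of_int \<lfloor>pair b u\<rfloor>" if "u \<in> U" for u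
      using int[OF \<open>b \<in> M\<close> subsetD[OF UN that]] by (metis Ints_cases of_int_floor_cancel)
    have "linear (pair b)" using bil by (simp add: bilinear_def)
    hence "pair b v\<^sub>C = (\<Sum>u\<in>U. pair b u)" using assms(11) by (simp add: linear_sum U_def)
    also have "\<dots> = (\<Sum>u\<in>U. of_int \<lfloor>pair b u\<rfloor>)" by (rule sum.cong[OF refl floor])
    finally show ?thesis by (simp only: of_int_sum)
  qed
  have "(\<lambda>m. pair m v\<^sub>C) ` B = of_int ` ((\<lambda>b. \<Sum>u\<in>U. \<lfloor>pair b u\<rfloor>) ` B)"
    using pair_vC by (auto simp: image_image)
  hence fin: "finite ((\<lambda>m. pair m v\<^sub>C) ` B)" using minimal_generators_finite_image[OF B] by simp
  \<comment> \<open>\<open>T D\<close> arises from a real maximum by floor and \<open>nat\<close>;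
    integers below the maximum survive the floor, and \<open>nat\<close> can only raise the
    value.\<close>
  have le_T: "k \<le> int (T D)" if "of_int k \<le> max (Max ((\<lambda>m. pair m v\<^sub>C) ` B)) (real D)" for k D
  proof -
    have "k \<le> \<lfloor>max (Max ((\<lambda>m. pair m v\<^sub>C) ` B)) (real D)\<rfloor>" using that by (simp add: le_floor_iff)
    thus ?thesis unfolding assms(12) by linarith
  qed
  have T_B: "(\<Sum>u\<in>U. \<lfloor>pair b u\<rfloor>) \<le> int (T D)" if "b \<in> B" for b D
  proof (rule le_T)
    have "pair b v\<^sub>C \<le> Max ((\<lambda>m. pair m v\<^sub>C) ` B)" using fin that by (intro Max_ge) auto
    thus "of_int (\<Sum>u\<in>U. \<lfloor>pair b u\<rfloor>) \<le> max (Max ((\<lambda>m. pair m v\<^sub>C) ` B)) (real D)"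
      using pair_vC[OF that] by simp
  qed
  have T_D: "D \<le> T D" for D using le_T[of "int D" D] by simp
  have "symbolic_power R P (T D * (r - 1) + 1) \<subseteq> ideal_pow P r"
    if "D > 0" "annihilates_class_group D R" "r > 0" "primeideal P R"
      "monomial_ideal S P \<or> ideal_height R P = 1" for D r P
    using that(5)
  proof
    assume "monomial_ideal S P"
    thus ?thesis by (rule monomial_prime_containment[OF that(4) _ gen T_B that(3)])
  next
    assume "ideal_height R P = 1"
    hence "P \<in> height_one_primes R" using that(4) by (simp add: height_one_primes_def)
    thus ?thesis by (rule height_one_containment[OF _ that(2,1) T_D that(3)])
  qed
  thus ?thesis
    using divisor_class_group_finite card_divisor_class_group order_annihilates_class_group by blast
qed

end
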